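(* Let $F$ be a field of characteristic $p$, let $K/F$ be a purely inseparable field extension of exponent one, and let $\delta$ be an algebraic derivation on $K$ with ${\rm Const}(\delta)=F$ and minimum polynomial $g(t)=t^{p^e}+c_1t^{p^{e-1}}+\dots+c_et\in F[t]$. Let $R=K[t;\delta]$ and $x=g(t)$, and let $N$ be the reduced norm of the central simple $F(x)$-algebra $K(t;\delta)$. Let $f\in R$ be a monic polynomial of degree $m$, let $h(t)=\hat h(g(t))$ with $\hat h\in F[x]$ monic be its minimal central left multiple, and suppose that $\deg(\hat h)=m$ (degree in $x$). (i) If $N(f)=\hat h_1\cdots\hat h_l$ such that $\hat h_i\in F[x]$ is irreducible for $1\le i\le l$, then there exists a decomposition $f=f_1\cdots f_l$ of $f$ into irreducible factors such that $N(f_i)=\hat h_i$ for all $i$, $1\le i\le l$. The degree of $f_i$ in $R$ equals the degree of $\hat h_i$ in $F[x]$ for all $i$. (ii) Assume that $N(f)$ is the product of $l$ distinct irreducible factors $\hat h_1,\dots,\hat h_l$ in $F[x]$. Then $f$ has exactly $l!$ irreducible decompositions (decompositions into irreducible factors in $R$), corresponding to each possible ordering of the factors of $N(f)$.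
   Context: ${\rm Const}(\delta)=\{a\in K:\delta(a)=0\}$. $K[t;\delta]$ is the ring of polynomials $\sum a_it^i$, $a_i\in K$, with $ta=at+\delta(a)$ for $a\in K$. Its center is $C(R)=F[x]$, $x=g(t)$. The ring of central quotients $K(t;\delta)=\{f/q: f\in R,\ 0\neq q\in F[x]\}$ is a central simple algebra of degree $p^e$ over $F(x)$; $N$ is its reduced norm, and $N(f)\in F[x]$ for $f\in R$. An element $f\in R$ is irreducible if it is not a unit and is not a product $qr$ with $q,r\in R$ and $1\le\deg q,\deg r<\deg f$. The minimal central left multiple of $f\neq0$ is the unique polynomial $h\in C(R)$ of minimal degree such that $h=qf$ for some $q\in R$ and $h(t)=\hat h(g(t))$ with $\hat h\in F[x]$ monic.
   Formalization: The irreducible factors ĥ_i of N(f) are taken monic (for arbitrary leading coefficients (i) fails), and in (ii) the l! irreducible decompositions are those into monic factors, since otherwise units of K can be moved between factors and there are infinitely many. *)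

theory Defs
  imports
    "HOL-Algebra.Algebraic_Closure_Type"
    "Jordan_Normal_Form.Determinant"
begin

text \<open>A field extension \<open>K/F\<close> is an embedding \<open>\<iota>\<close> of the type \<open>'f\<close> (the field \<open>F\<close>) into
  the type \<open>'k\<close> (the field \<open>K\<close>); the subfield \<open>F\<close> of \<open>K\<close> is \<open>range \<iota>\<close>.\<close>

definition purely_inseparable_of_exponent :: "nat \<Rightarrow> ('f::field \<Rightarrow> 'k::field) \<Rightarrow> nat \<Rightarrow> bool" where
  "purely_inseparable_of_exponent p \<iota> n \<longleftrightarrow>
     (\<forall>a. a ^ (p ^ n) \<in> range \<iota>) \<and> (\<forall>k<n. \<exists>a. a ^ (p ^ k) \<notin> range \<iota>)"

definition is_derivation :: "('k::field \<Rightarrow> 'k) \<Rightarrow> bool" where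
  "is_derivation \<delta> \<longleftrightarrow>
     (\<forall>a b. \<delta> (a + b) = \<delta> a + \<delta> b) \<and> (\<forall>a b. \<delta> (a * b) = \<delta> a * b + a * \<delta> b)"

definition Const :: "('k::field \<Rightarrow> 'k) \<Rightarrow> 'k set" where
  "Const \<delta> = {a. \<delta> a = 0}"

definition annihilates :: "('f::field \<Rightarrow> 'k::field) \<Rightarrow> ('k \<Rightarrow> 'k) \<Rightarrow> 'f poly \<Rightarrow> bool" where
  "annihilates \<iota> \<delta> q \<longleftrightarrow> (\<forall>a. (\<Sum>i\<le>degree q. \<iota> (coeff q i) * (\<delta> ^^ i) a) = 0)"

definition algebraic_derivation :: "('f::field \<Rightarrow> 'k::field) \<Rightarrow> ('k \<Rightarrow> 'k) \<Rightarrow> bool" where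
  "algebraic_derivation \<iota> \<delta> \<longleftrightarrow> is_derivation \<delta> \<and> (\<exists>q. q \<noteq> 0 \<and> annihilates \<iota> \<delta> q)"

definition is_minimum_polynomial :: "('f::field \<Rightarrow> 'k::field) \<Rightarrow> ('k \<Rightarrow> 'k) \<Rightarrow> 'f poly \<Rightarrow> bool" where
  "is_minimum_polynomial \<iota> \<delta> g \<longleftrightarrow>
     lead_coeff g = 1 \<and> annihilates \<iota> \<delta> g \<and> (\<forall>q. q \<noteq> 0 \<and> annihilates \<iota> \<delta> q \<longrightarrow> degree g \<le> degree q)"

text \<open>The elements \<open>\<Sum> a\<^sub>i t\<^sup>i\<close> of the differential polynomial ring \<open>K[t;\<delta>]\<close>, with coefficients
  on the left, are represented by the type \<open>'k poly\<close>; only the multiplication changes.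
  Left multiplication by \<open>t\<close> sends \<open>\<Sum> a\<^sub>i t\<^sup>i\<close> to \<open>\<Sum> a\<^sub>i t\<^bsup>i+1\<^esup> + \<Sum> \<delta>(a\<^sub>i) t\<^sup>i\<close>.\<close>

definition t_times :: "('k::field \<Rightarrow> 'k) \<Rightarrow> 'k poly \<Rightarrow> 'k poly" where
  "t_times \<delta> q = pCons 0 q + map_poly \<delta> q"

definition dp_mult :: "('k::field \<Rightarrow> 'k) \<Rightarrow> 'k poly \<Rightarrow> 'k poly \<Rightarrow> 'k poly" where
  "dp_mult \<delta> f q = (\<Sum>i\<le>degree f. smult (coeff f i) ((t_times \<delta> ^^ i) q))"

definition dp_ring :: "('k::field \<Rightarrow> 'k) \<Rightarrow> 'k poly ring" where
  "dp_ring \<delta> = \<lparr>carrier = UNIV, monoid.mult = dp_mult \<delta>, one = 1, ring.zero = 0, add = (+)\<rparr>"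

definition ring_center :: "('a, 'b) ring_scheme \<Rightarrow> 'a set" where
  "ring_center R = {z \<in> carrier R. \<forall>r \<in> carrier R. z \<otimes>\<^bsub>R\<^esub> r = r \<otimes>\<^bsub>R\<^esub> z}"

definition dp_irreducible :: "('k::field \<Rightarrow> 'k) \<Rightarrow> 'k poly \<Rightarrow> bool" where
  "dp_irreducible \<delta> f \<longleftrightarrow> f \<notin> Units (dp_ring \<delta>) \<and>
     \<not> (\<exists>q r. f = q \<otimes>\<^bsub>dp_ring \<delta>\<^esub> r \<and> 1 \<le> degree q \<and> degree q < degree f \<and>
                1 \<le> degree r \<and> degree r < degree f)"

definition dp_prod_list :: "('k::field \<Rightarrow> 'k) \<Rightarrow> 'k poly list \<Rightarrow> 'k poly" where
  "dp_prod_list \<delta> fs = foldr (monoid.mult (dp_ring \<delta>)) fs \<one>\<^bsub>dp_ring \<delta>\<^esub>"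

text \<open>The element \<open>q(g(t))\<close> of \<open>K[t;\<delta>]\<close>, for \<open>q \<in> F[x]\<close>.\<close>

definition subst_center ::
    "('f::field \<Rightarrow> 'k::field) \<Rightarrow> ('k \<Rightarrow> 'k) \<Rightarrow> 'f poly \<Rightarrow> 'f poly \<Rightarrow> 'k poly" where
  "subst_center \<iota> \<delta> g q =
     (\<Sum>i\<le>degree q. smult (\<iota> (coeff q i)) (map_poly \<iota> g [^]\<^bsub>dp_ring \<delta>\<^esub> i))"

definition central_left_multiples :: "('k::field \<Rightarrow> 'k) \<Rightarrow> 'k poly \<Rightarrow> 'k poly set" where
  "central_left_multiples \<delta> f =
     {h \<in> ring_center (dp_ring \<delta>). h \<noteq> 0 \<and> (\<exists>q. h = q \<otimes>\<^bsub>dp_ring \<delta>\<^esub> f)}"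

definition is_min_central_left_multiple ::
    "('f::field \<Rightarrow> 'k::field) \<Rightarrow> ('k \<Rightarrow> 'k) \<Rightarrow> 'f poly \<Rightarrow> 'k poly \<Rightarrow> 'k poly \<Rightarrow> bool" where
  "is_min_central_left_multiple \<iota> \<delta> g f h \<longleftrightarrow>
     h \<in> central_left_multiples \<delta> f \<and>
     (\<forall>h' \<in> central_left_multiples \<delta> f. degree h \<le> degree h') \<and>
     (\<exists>q. lead_coeff q = 1 \<and> h = subst_center \<iota> \<delta> g q)"

text \<open>The ring of central quotients \<open>K(t;\<delta>)\<close>: a fraction \<open>f/q\<close> is the class of the pair
  \<open>(f, q)\<close> with \<open>f \<in> K[t;\<delta>]\<close> and \<open>0 \<noteq> q \<in> F[x]\<close>.\<close>

definition cq_class ::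
    "('f::field \<Rightarrow> 'k::field) \<Rightarrow> ('k \<Rightarrow> 'k) \<Rightarrow> 'f poly \<Rightarrow> 'k poly \<Rightarrow> 'f poly \<Rightarrow> ('k poly \<times> 'f poly) set" where
  "cq_class \<iota> \<delta> g f q =
     {(f', q'). q' \<noteq> 0 \<and>
        subst_center \<iota> \<delta> g q' \<otimes>\<^bsub>dp_ring \<delta>\<^esub> f = subst_center \<iota> \<delta> g q \<otimes>\<^bsub>dp_ring \<delta>\<^esub> f'}"

definition cq_ring ::
    "('f::field \<Rightarrow> 'k::field) \<Rightarrow> ('k \<Rightarrow> 'k) \<Rightarrow> 'f poly \<Rightarrow> ('k poly \<times> 'f poly) set ring" where
  "cq_ring \<iota> \<delta> g =
     \<lparr>carrier = {cq_class \<iota> \<delta> g f q | f q. q \<noteq> 0},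
      monoid.mult = (\<lambda>U V. \<Union>(f, q)\<in>U. \<Union>(f', q')\<in>V.
        cq_class \<iota> \<delta> g (f \<otimes>\<^bsub>dp_ring \<delta>\<^esub> f') (q * q')),
      one = cq_class \<iota> \<delta> g 1 1,
      ring.zero = cq_class \<iota> \<delta> g 0 1,
      add = (\<lambda>U V. \<Union>(f, q)\<in>U. \<Union>(f', q')\<in>V.
        cq_class \<iota> \<delta> g
          (subst_center \<iota> \<delta> g q' \<otimes>\<^bsub>dp_ring \<delta>\<^esub> f \<oplus>\<^bsub>dp_ring \<delta>\<^esub> subst_center \<iota> \<delta> g q \<otimes>\<^bsub>dp_ring \<delta>\<^esub> f')
          (q * q'))\<rparr>"

text \<open>The structure map \<open>F(x) \<rightarrow> K(t;\<delta>)\<close>, \<open>a/b \<mapsto> a(g(t))/b\<close>. All representations \<open>a/b\<close> of the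
  same rational function give the same class, so that the union is that class.\<close>

definition cq_scalar ::
    "('f::field \<Rightarrow> 'k::field) \<Rightarrow> ('k \<Rightarrow> 'k) \<Rightarrow> 'f poly \<Rightarrow> 'f poly fract \<Rightarrow> ('k poly \<times> 'f poly) set" where
  "cq_scalar \<iota> \<delta> g z =
     \<Union>{cq_class \<iota> \<delta> g (subst_center \<iota> \<delta> g a) b | a b. b \<noteq> 0 \<and> z = Fract a b}"

text \<open>Let \<open>A\<close> be a central simple algebra over the field \<open>'z\<close>, with structure map \<open>\<sigma>\<close>, and let
  \<open>L\<close> be the algebraic closure of \<open>'z\<close>. A splitting is a homomorphism of \<open>'z\<close>-algebras
  \<open>\<phi> : A \<rightarrow> M\<^sub>n(L)\<close> whose extension \<open>A \<otimes> L \<rightarrow> M\<^sub>n(L)\<close> is an isomorphism, which means that \<open>\<phi>\<close>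
  sends a \<open>'z\<close>-basis of \<open>A\<close> to an \<open>L\<close>-basis of \<open>M\<^sub>n(L)\<close>. The reduced norm is \<open>det \<circ> \<phi>\<close>; by the
  Skolem-Noether theorem it depends neither on \<open>\<phi>\<close> nor on the choice of a splitting field, and
  it takes values in \<open>'z\<close>.\<close>

definition is_algebra_basis :: "('a, 'b) ring_scheme \<Rightarrow> ('z::field \<Rightarrow> 'a) \<Rightarrow> 'a list \<Rightarrow> bool" where
  "is_algebra_basis A \<sigma> bs \<longleftrightarrow> set bs \<subseteq> carrier A \<and>
     (\<forall>a \<in> carrier A. \<exists>!cs. length cs = length bs \<and>
        a = (\<Oplus>\<^bsub>A\<^esub>i\<in>{..<length bs}. \<sigma> (cs ! i) \<otimes>\<^bsub>A\<^esub> bs ! i))"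

definition is_splitting ::
    "('a, 'b) ring_scheme \<Rightarrow> ('z::field \<Rightarrow> 'a) \<Rightarrow> nat \<Rightarrow> ('a \<Rightarrow> 'z alg_closure mat) \<Rightarrow> bool" where
  "is_splitting A \<sigma> n \<phi> \<longleftrightarrow>
     \<phi> \<in> Ring.ring_hom A (ring_mat TYPE('z alg_closure) n ()) \<and>
     (\<forall>z. \<phi> (\<sigma> z) = to_ac z \<cdot>\<^sub>m 1\<^sub>m n) \<and>
     (\<exists>bs. is_algebra_basis A \<sigma> bs \<and>
       is_algebra_basis (ring_mat TYPE('z alg_closure) n ()) (\<lambda>l. l \<cdot>\<^sub>m 1\<^sub>m n) (map \<phi> bs))"

definition reduced_norm :: "('a, 'b) ring_scheme \<Rightarrow> ('z::field \<Rightarrow> 'a) \<Rightarrow> 'a \<Rightarrow> 'z" where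
  "reduced_norm A \<sigma> a = (THE z. \<exists>n \<phi>. is_splitting A \<sigma> n \<phi> \<and> to_ac z = det (\<phi> a))"

definition dp_norm ::
    "('f::field \<Rightarrow> 'k::field) \<Rightarrow> ('k \<Rightarrow> 'k) \<Rightarrow> 'f poly \<Rightarrow> 'k poly \<Rightarrow> 'f poly fract" where
  "dp_norm \<iota> \<delta> g f = reduced_norm (cq_ring \<iota> \<delta> g) (cq_scalar \<iota> \<delta> g) (cq_class \<iota> \<delta> g f 1)"

definition monic_decompositions :: "('k::field \<Rightarrow> 'k) \<Rightarrow> 'k poly \<Rightarrow> 'k poly list set" where
  "monic_decompositions \<delta> f =
     {fs. dp_prod_list \<delta> fs = f \<and> (\<forall>q \<in> set fs. dp_irreducible \<delta> q \<and> lead_coeff q = 1)}"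

end

theory Submission
  imports Defs "Jordan_Normal_Form.Char_Poly" "HOL-Combinatorics.Multiset_Permutations"
begin

text \<open>Write \<open>R = K[t;\<delta>]\<close> and \<open>n = p\<^sup>e\<close>. As a left \<open>K[x]\<close>-module \<open>R\<close> is free on
  \<open>1, t, \<dots>, t\<^bsup>n-1\<^esup>\<close>, and right multiplication by \<open>f\<close> has a matrix \<open>\<Psi>(f)\<close> over \<open>K[x]\<close>. Left
  multiplication by \<open>t\<close> commutes with it up to \<open>\<delta>\<close>, so \<open>\<delta>(\<Psi>(f))\<close> is a commutator of \<open>\<Psi>(f)\<close>,
  whence \<open>det \<Psi>(f)\<close> is killed by \<open>\<delta>\<close> and lies in \<open>F[x]\<close>. Embedding \<open>K\<close> into the algebraic
  closure of \<open>F(x)\<close> by \<open>p\<close>-th roots turns \<open>\<Psi>\<close> into a splitting of \<open>K(t;\<delta>)\<close>, and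
  Skolem--Noether shows that \<open>N(f) = det \<Psi>(f)\<close>. It is monic of degree \<open>deg f\<close> for monic \<open>f\<close>,
  and the adjugate shows that it is a left multiple of \<open>f\<close>.

  If the minimal central left multiple \<open>h\<close> has \<open>x\<close>-degree \<open>deg f\<close>, then \<open>h\<close> is \<open>N(f)\<close>, and this
  property passes to the factors of \<open>f\<close>. For an irreducible factor \<open>k\<close> of \<open>N(f)\<close> the greatest
  common right divisor of \<open>f\<close> and \<open>k(g(t))\<close> then has norm exactly \<open>k\<close>, and it is the only monic
  right factor of \<open>f\<close> with norm \<open>k\<close>; induct on the number of factors.\<close>

section \<open>Differential polynomials\<close>

text \<open>Two products live on \<open>'k poly\<close>: the commutative \<open>*\<close> of K[t]
  and the skew product of R. They agree when the left factor lies in K[g(t)] or the right factor has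
  constant coefficients. Hence the module structure over K[x], the expansion in powers of g and all
  degrees can be treated in K[t]; only t itself is twisted, acting as the variable plus
  \<open>dd\<close>.

  A splitting must take values over the algebraic closure of F(x), so K has to be mapped there. In
  characteristic p a p-th root is unique, so choosing roots elementwise is automatically a ring
  homomorphism. It must also be shown that an F(x)-basis of the algebra becomes a basis of all
  matrices; this reduces to a nonzero Wronskian of n elements of K and a unipotent triangular system
  coming from the Leibniz formula.

  The degree condition on the minimal central left multiple keeps the greatest common right divisor
  with k(g(t)) small: in general its norm can be a higher power of k, as f = k(g(t)) with norm k^n
  shows.\<close>

locale derivation =
  fixes \<delta> :: "'k::field \<Rightarrow> 'k"
  assumes is_derivation: "is_derivation \<delta>"
begin

abbreviation skew_mult (infixl "\<odot>" 70) where "f \<odot> q \<equiv> dp_mult \<delta> f q"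
abbreviation tt where "tt \<equiv> t_times \<delta>"
abbreviation dd where "dd \<equiv> map_poly \<delta>"

lemma delta_add [simp]: "\<delta> (a + b) = \<delta> a + \<delta> b"
  and delta_mult: "\<delta> (a * b) = \<delta> a * b + a * \<delta> b"
  using is_derivation by (auto simp: is_derivation_def)

lemma delta_0 [simp]: "\<delta> 0 = 0"
  using delta_add[of 0 0] by (metis add.right_neutral add_left_cancel)

lemma delta_1 [simp]: "\<delta> 1 = 0"
  using delta_mult[of 1 1] by (metis add.right_neutral add_left_cancel mult.right_neutral mult_1)

lemma delta_sum: "\<delta> (sum f A) = (\<Sum>i\<in>A. \<delta> (f i))"
  by (induction A rule: infinite_finite_induct) auto

lemma delta_pow_0 [simp]: "(\<delta> ^^ i) 0 = 0"
  by (induction i) auto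

lemma dd_add [simp]: "dd (f + q) = dd f + dd q"
  by (intro poly_eqI) (simp add: coeff_map_poly)

lemma dd_pCons [simp]: "dd (pCons a f) = pCons (\<delta> a) (dd f)"
  by (intro poly_eqI) (simp add: coeff_map_poly coeff_pCons split: nat.splits)

lemma dd_smult: "dd (smult a f) = smult (\<delta> a) f + smult a (dd f)"
  by (intro poly_eqI) (simp add: coeff_map_poly delta_mult)

lemma dd_mult: "dd (f * q) = dd f * q + f * dd q"
  by (induction f) (simp_all add: dd_smult algebra_simps)

lemma dd_1 [simp]: "dd 1 = 0"
  by (simp add: one_pCons)

lemma degree_dd_le: "degree (dd f) \<le> degree f"
  by (rule degree_le) (simp add: coeff_map_poly coeff_eq_0)

lemma tt_add [simp]: "tt (f + q) = tt f + tt q"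
  by (simp add: t_times_def)

lemma tt_0 [simp]: "tt 0 = 0"
  by (simp add: t_times_def)

lemma tt_smult: "tt (smult a f) = smult (\<delta> a) f + smult a (tt f)"
  by (simp add: t_times_def dd_smult smult_add_right)

text \<open>\<open>*\<close> is still the product of K[t]. For it, left multiplication by t is the
  variable plus the derivation \<open>dd\<close>, whence a single correction term.\<close>

lemma tt_mult: "tt (f * q) = f * tt q + dd f * q"
  by (simp add: t_times_def dd_mult algebra_simps)

lemma tt_sum: "tt (sum F A) = (\<Sum>i\<in>A. tt (F i))"
  by (induction A rule: infinite_finite_induct) auto

lemma tt_pow_add: "(tt ^^ i) (f + q) = (tt ^^ i) f + (tt ^^ i) q"
  by (induction i) auto

lemma tt_pow_0 [simp]: "(tt ^^ i) 0 = 0"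
  by (induction i) auto

lemma degree_tt: "f \<noteq> 0 \<Longrightarrow> degree (tt f) = Suc (degree f)"
  and lead_coeff_tt: "f \<noteq> 0 \<Longrightarrow> lead_coeff (tt f) = lead_coeff f"
proof -
  assume f: "f \<noteq> 0"
  have lt: "degree (dd f) < degree (pCons 0 f)"
    using degree_dd_le[of f] f by simp
  show d: "degree (tt f) = Suc (degree f)"
    using degree_add_eq_left[OF lt] f by (simp add: t_times_def)
  show "lead_coeff (tt f) = lead_coeff f"
    unfolding d using degree_dd_le[of f]
    by (simp add: t_times_def coeff_eq_0)
qed

lemma tt_eq_0_iff [simp]: "tt f = 0 \<longleftrightarrow> f = 0"
  using degree_tt[of f] by (cases "f = 0") auto

lemma dp_mult_sum_bound:
  assumes "degree f \<le> N"
  shows "f \<odot> q = (\<Sum>i\<le>N. smult (coeff f i) ((tt ^^ i) q))"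
  unfolding dp_mult_def using assms
  by (intro sum.mono_neutral_left) (auto simp: coeff_eq_0)

lemma skew_add_left [simp]: "(f + f') \<odot> q = f \<odot> q + f' \<odot> q"
proof -
  let ?N = "max (degree f) (degree f')"
  have "degree (f + f') \<le> ?N" by (rule degree_add_le_max)
  then show ?thesis
    by (simp add: dp_mult_sum_bound[of _ ?N] smult_add_left sum.distrib)
qed

lemma skew_add_right [simp]: "f \<odot> (q + q') = f \<odot> q + f \<odot> q'"
  by (simp add: dp_mult_def tt_pow_add smult_add_right sum.distrib)

lemma skew_0_left [simp]: "0 \<odot> q = 0"
  and skew_0_right [simp]: "f \<odot> 0 = 0"
  by (simp_all add: dp_mult_def)

lemma skew_smult_left [simp]: "smult a f \<odot> q = smult a (f \<odot> q)"
proof -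
  have "degree (smult a f) \<le> degree f" by (rule degree_smult_le)
  then show ?thesis
    by (simp add: dp_mult_sum_bound[of _ "degree f"] poly_eq_iff coeff_sum sum_distrib_left mult.assoc)
qed

lemma skew_pCons: "pCons a f \<odot> q = smult a q + f \<odot> tt q"
proof -
  have "pCons a f \<odot> q = (\<Sum>i\<le>Suc (degree f). smult (coeff (pCons a f) i) ((tt ^^ i) q))"
    by (rule dp_mult_sum_bound) (simp add: degree_pCons_le)
  also have "\<dots> = smult a q + f \<odot> tt q"
    by (simp add: dp_mult_def sum.atMost_Suc_shift funpow_swap1 del: sum.atMost_Suc)
  finally show ?thesis .
qed

lemma skew_uminus_left [simp]: "(- f) \<odot> q = - (f \<odot> q)"
  using skew_smult_left[of "-1" f q] by simp

lemma skew_diff_left [simp]: "(f - f') \<odot> q = f \<odot> q - f' \<odot> q"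
  using skew_add_left[of f "- f'" q] by simp

lemma skew_sum_left: "sum f A \<odot> q = (\<Sum>i\<in>A. f i \<odot> q)"
  by (induction A rule: infinite_finite_induct) auto

lemma skew_const_left [simp]: "[:a:] \<odot> q = smult a q"
  by (simp add: skew_pCons)

lemma skew_1_left [simp]: "1 \<odot> q = q"
  by (simp add: one_pCons)

lemma skew_monom_left: "monom a i \<odot> q = smult a ((tt ^^ i) q)"
  by (induction i arbitrary: q) (simp_all add: monom_0 monom_Suc skew_pCons funpow_swap1)

text \<open>Associativity with t as the left factor, where the product rule for \<delta> enters;
  \<open>skew_assoc\<close> follows from the Horner form of the left factor.\<close>

lemma skew_tt_left: "tt f \<odot> q = tt (f \<odot> q)"
proof (induction f arbitrary: q)
  case 0
  then show ?case by simp
next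
  case (pCons a f)
  have "tt (pCons a f) = pCons (\<delta> a) (tt f + [:a:])"
    by (simp add: t_times_def pCons_eq_iff add.commute)
  then show ?case
    by (simp add: skew_pCons pCons.IH tt_smult algebra_simps)
qed

lemma skew_assoc: "(f \<odot> q) \<odot> r = f \<odot> (q \<odot> r)"
  by (induction f arbitrary: q) (simp_all add: skew_pCons skew_tt_left)

text \<open>Coefficients killed by \<delta> commute with t, so such a right factor multiplies as in
  K[t]. This covers g(t) and everything in F[x].\<close>

lemma skew_const_coeffs_right: "dd u = 0 \<Longrightarrow> f \<odot> u = f * u"
proof (induction f arbitrary: u)
  case (pCons a f)
  have "tt u = pCons 0 u" using pCons.prems by (simp add: t_times_def)
  moreover have "dd (pCons 0 u) = 0" using pCons.prems by simp
  ultimately show ?case using pCons.IH by (simp add: skew_pCons)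
qed simp

lemma skew_1_right [simp]: "f \<odot> 1 = f"
  by (simp add: skew_const_coeffs_right)

lemma degree_tt_pow: "f \<noteq> 0 \<Longrightarrow> degree ((tt ^^ i) f) = degree f + i \<and> (tt ^^ i) f \<noteq> 0 \<and>
    lead_coeff ((tt ^^ i) f) = lead_coeff f"
proof (induction i)
  case (Suc i)
  then have nz: "(tt ^^ i) f \<noteq> 0" by blast
  show ?case
    using Suc degree_tt[OF nz] lead_coeff_tt[OF nz] by (simp add: nz) (metis)
qed simp

lemma degree_skew_aux:
  assumes "f \<noteq> 0" "q \<noteq> 0"
  shows "degree (f \<odot> q) \<le> degree f + degree q \<and>
    coeff (f \<odot> q) (degree f + degree q) = lead_coeff f * lead_coeff q"
proof (intro conjI)
  show "degree (f \<odot> q) \<le> degree f + degree q"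
    unfolding dp_mult_def using degree_tt_pow[OF assms(2)]
    by (intro degree_sum_le) (auto intro: order_trans[OF degree_smult_le])
  have "coeff (f \<odot> q) (degree f + degree q) =
     (\<Sum>i\<le>degree f. if i = degree f then lead_coeff f * lead_coeff q else 0)"
    unfolding dp_mult_def coeff_sum
  proof (intro sum.cong refl)
    fix i assume i: "i \<in> {..degree f}"
    have "coeff ((tt ^^ i) q) (degree f + degree q) = (if i = degree f then lead_coeff q else 0)"
      using degree_tt_pow[OF assms(2), of i] i by (auto simp: coeff_eq_0 add.commute)
    then show "coeff (smult (coeff f i) ((tt ^^ i) q)) (degree f + degree q) =
      (if i = degree f then lead_coeff f * lead_coeff q else 0)"
      by simp
  qed
  then show "coeff (f \<odot> q) (degree f + degree q) = lead_coeff f * lead_coeff q"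
    by simp
qed

lemma degree_skew: "f \<noteq> 0 \<Longrightarrow> q \<noteq> 0 \<Longrightarrow> degree (f \<odot> q) = degree f + degree q"
  using degree_skew_aux[of f q]
  by (metis antisym le_degree leading_coeff_neq_0 mult_eq_0_iff)

lemma lead_coeff_skew: "lead_coeff (f \<odot> q) = lead_coeff f * lead_coeff q"
  using degree_skew_aux[of f q] degree_skew[of f q] by (cases "f = 0 \<or> q = 0") auto

lemma skew_eq_0_iff [simp]: "f \<odot> q = 0 \<longleftrightarrow> f = 0 \<or> q = 0"
  using lead_coeff_skew[of f q] by (metis leading_coeff_0_iff mult_eq_0_iff)

lemma skew_right_cancel: "q \<noteq> 0 \<Longrightarrow> f \<odot> q = f' \<odot> q \<longleftrightarrow> f = f'"
  using skew_eq_0_iff[of "f - f'" q] by auto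

section \<open>Right division and greatest common right divisors\<close>

lemma right_division:
  assumes "lead_coeff q = 1"
  shows "\<exists>s r. f = s \<odot> q + r \<and> (r = 0 \<or> degree r < degree q)"
proof (induction "degree f" arbitrary: f rule: less_induct)
  case less
  show ?case
  proof (cases "f = 0 \<or> degree f < degree q")
    case True
    then have "f = 0 \<odot> q + f \<and> (f = 0 \<or> degree f < degree q)" by simp
    then show ?thesis by blast
  next
    case False
    let ?s = "monom (lead_coeff f) (degree f - degree q)"
    let ?f = "f - ?s \<odot> q"
    have q0: "q \<noteq> 0" using assms by auto
    have s0: "?s \<noteq> 0" using False by simp
    have ds: "degree ?s = degree f - degree q"
      by (rule Polynomial.degree_monom_eq) (use False in auto)
    have d: "degree (?s \<odot> q) = degree f"
      using degree_skew[OF s0 q0] ds False by linarith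
    have "lead_coeff (?s \<odot> q) = lead_coeff f"
      unfolding lead_coeff_skew ds using assms by simp
    then have c: "coeff ?f (degree f) = 0" using d by simp
    have "degree ?f \<le> degree f" using d by (simp add: degree_diff_le)
    then have "?f = 0 \<or> degree ?f < degree f"
      using c by (metis leading_coeff_0_iff order_less_le)
    then obtain s r where "?f = s \<odot> q + r" "r = 0 \<or> degree r < degree q"
      using less[of ?f] by (metis skew_0_left add_0)
    then have "f = (?s + s) \<odot> q + r" "r = 0 \<or> degree r < degree q"
      by (auto simp: algebra_simps)
    then show ?thesis by blast
  qed
qed

text \<open>An element of least degree in the left ideal generated by f and h divides the whole
  ideal from the right, by division with remainder. Making it monic is a scaling from the left and
  stays in the ideal.\<close>

lemma bezout_right:
  assumes "f \<noteq> 0"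
  obtains d a b f' h' where "lead_coeff d = 1" "d = a \<odot> f + b \<odot> h" "f = f' \<odot> d" "h = h' \<odot> d"
proof -
  let ?I = "{a \<odot> f + b \<odot> h | a b. True}"
  let ?P = "\<lambda>d. d \<in> ?I \<and> d \<noteq> 0"
  have fI: "f \<in> ?I" by (rule CollectI, rule exI[of _ 1], rule exI[of _ 0]) simp
  have hI: "h \<in> ?I" by (rule CollectI, rule exI[of _ 0], rule exI[of _ 1]) simp
  have "?P f" using fI assms by blast
  then obtain d0 where d0: "?P d0" and min: "\<And>d. ?P d \<Longrightarrow> degree d0 \<le> degree d"
    using ex_has_least_nat[of ?P f degree] by auto
  define d where "d = smult (inverse (lead_coeff d0)) d0"
  have lc: "lead_coeff d = 1" using d0 by (simp add: d_def)
  have deg: "degree d = degree d0" using d0 by (simp add: d_def)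
  obtain a0 b0 where "d0 = a0 \<odot> f + b0 \<odot> h" using d0 by blast
  then obtain a b where d: "d = a \<odot> f + b \<odot> h"
    unfolding d_def by (metis skew_smult_left smult_add_right)
  have mult: "\<exists>s. z = s \<odot> d" if z: "z \<in> ?I" for z
  proof -
    obtain s r where sr: "z = s \<odot> d + r" "r = 0 \<or> degree r < degree d"
      using right_division[OF lc] by blast
    obtain u v where uv: "z = u \<odot> f + v \<odot> h" using z by blast
    have "r = z - s \<odot> d" using sr by simp
    also have "\<dots> = (u - s \<odot> a) \<odot> f + (v - s \<odot> b) \<odot> h"
      unfolding uv d by (simp add: skew_assoc)
    finally have "r \<in> ?I" by blast
    then have "r = 0" using sr(2) min[of r] deg by force
    then show ?thesis using sr by auto
  qed
  obtain f' h' where "f = f' \<odot> d" "h = h' \<odot> d" using mult fI hI by meson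
  then show ?thesis using that[OF lc d] by blast
qed

text \<open>Multiplication by the variable and \<open>dd\<close> commute as operators on K[t], and t
  acts as their sum; this is the binomial theorem for the two.\<close>

lemma tt_pow_leibniz:
  "(tt ^^ N) q = (\<Sum>i\<le>N. of_nat (N choose i) * (monom 1 (N - i) * map_poly (\<delta> ^^ i) q))"
proof (induction N)
  case 0
  show ?case by (simp add: map_poly_idI)
next
  case (Suc N)
  have D: "dd (map_poly (\<delta> ^^ i) q) = map_poly (\<delta> ^^ Suc i) q" for i
    by (intro poly_eqI) (simp add: coeff_map_poly)
  have dn: "dd (of_nat k) = 0" for k by (induction k) auto
  have dm: "dd (monom 1 k) = 0" for k
    by (intro poly_eqI) (simp add: coeff_map_poly)
  let ?M = "\<lambda>i. map_poly (\<delta> ^^ i) q"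
  have "(tt ^^ Suc N) q =
      (\<Sum>i\<le>N. tt (of_nat (N choose i) * (monom 1 (N - i) * ?M i)))"
    by (simp add: Suc.IH tt_sum)
  also have "\<dots> = (\<Sum>i\<le>N. of_nat (N choose i) * (monom 1 (Suc N - i) * ?M i)) +
      (\<Sum>i\<le>N. of_nat (N choose i) * (monom 1 (N - i) * ?M (Suc i)))"
    unfolding sum.distrib[symmetric]
  proof (intro sum.cong refl)
    fix i assume "i \<in> {..N}"
    then have "monom 1 (Suc N - i) = pCons 0 (monom (1 :: 'k) (N - i))"
      by (simp add: Suc_diff_le monom_Suc)
    then show "tt (of_nat (N choose i) * (monom 1 (N - i) * ?M i)) =
        of_nat (N choose i) * (monom 1 (Suc N - i) * ?M i) +
        of_nat (N choose i) * (monom 1 (N - i) * ?M (Suc i))"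
      by (simp add: tt_mult dd_mult dn dm D t_times_def algebra_simps del: funpow.simps)
  qed
  \<comment> \<open>The added summand has binomial coefficient N choose Suc N = 0. After an index
    shift, Pascal's rule applies term by term.\<close>
  also have "(\<Sum>i\<le>N. of_nat (N choose i) * (monom 1 (Suc N - i) * ?M i)) =
      (\<Sum>i\<le>Suc N. of_nat (N choose i) * (monom 1 (Suc N - i) * ?M i))"
    by (simp add: binomial_eq_0)
  also have "\<dots> + (\<Sum>i\<le>N. of_nat (N choose i) * (monom 1 (N - i) * ?M (Suc i))) =
      (\<Sum>i\<le>Suc N. of_nat (Suc N choose i) * (monom 1 (Suc N - i) * ?M i))"
    by (subst (1 2) sum.atMost_Suc_shift)
       (simp add: sum.distrib[symmetric] algebra_simps del: funpow.simps sum.atMost_Suc)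
  finally show ?case .
qed

lemma dp_ring_simps [simp]:
  "monoid.mult (dp_ring \<delta>) = dp_mult \<delta>" "one (dp_ring \<delta>) = 1" "ring.zero (dp_ring \<delta>) = 0"
  "add (dp_ring \<delta>) = (+)" "carrier (dp_ring \<delta>) = UNIV"
  by (simp_all add: dp_ring_def)

end

section \<open>Determinants and the Skolem--Noether theorem\<close>

lemma index_mult_mat_sum:
  "A \<in> carrier_mat n m \<Longrightarrow> B \<in> carrier_mat m l \<Longrightarrow> i < n \<Longrightarrow> j < l \<Longrightarrow>
    (A * B) $$ (i, j) = (\<Sum>k<m. A $$ (i, k) * B $$ (k, j))"
  by (simp add: scalar_prod_def lessThan_atLeast0)

text \<open>Cramer's rule. The system is given by index functions, the form in which the Wronskian
  matrices below occur.\<close>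

lemma det_solve:
  fixes W :: "nat \<Rightarrow> nat \<Rightarrow> 'a::field"
  assumes det: "det (mat n n (\<lambda>(k, i). W k i)) \<noteq> 0"
  shows "\<exists>c. \<forall>k<n. (\<Sum>i<n. W k i * c i) = w k"
proof -
  let ?A = "mat n n (\<lambda>(k, i). W k i)"
  have A: "?A \<in> carrier_mat n n" by simp
  note adj = adj_mat[OF A]
  define c where "c i = (\<Sum>j<n. adj_mat ?A $$ (i, j) * w j) / det ?A" for i
  have "(\<Sum>i<n. W k i * c i) = w k" if k: "k < n" for k
  proof -
    have "(\<Sum>i<n. W k i * c i) = (\<Sum>i<n. \<Sum>j<n. W k i * adj_mat ?A $$ (i, j) * w j) / det ?A"
      by (simp add: c_def sum_divide_distrib sum_distrib_left mult.assoc)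
    also have "\<dots> = (\<Sum>j<n. (?A * adj_mat ?A) $$ (k, j) * w j) / det ?A"
      using k by (subst sum.swap)
        (simp add: index_mult_mat_sum[OF A adj(1)] sum_distrib_right)
    also have "\<dots> = (\<Sum>j<n. if j = k then det ?A * w k else 0) / det ?A"
      unfolding adj(2) using k
      by (intro arg_cong2[of _ _ _ _ "(/)"] sum.cong refl) auto
    also have "\<dots> = w k" using k det by simp
    finally show ?thesis .
  qed
  then show ?thesis by blast
qed

lemma det_kernel:
  fixes W :: "nat \<Rightarrow> nat \<Rightarrow> 'a::field"
  assumes det: "det (mat n n (\<lambda>(k, i). W k i)) \<noteq> 0"
    and ker: "\<And>k. k < n \<Longrightarrow> (\<Sum>i<n. W k i * c i) = 0" and j: "j < n"
  shows "c j = 0"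
proof -
  let ?A = "mat n n (\<lambda>(k, i). W k i)"
  have A: "?A \<in> carrier_mat n n" by simp
  note adj = adj_mat[OF A]
  have "0 = (\<Sum>k<n. adj_mat ?A $$ (j, k) * (\<Sum>i<n. W k i * c i))"
    using ker by simp
  also have "\<dots> = (\<Sum>k<n. \<Sum>i<n. adj_mat ?A $$ (j, k) * W k i * c i)"
    by (simp add: sum_distrib_left mult.assoc)
  also have "\<dots> = (\<Sum>i<n. (adj_mat ?A * ?A) $$ (j, i) * c i)"
    using j by (subst sum.swap)
        (simp add: index_mult_mat_sum[OF adj(1) A] sum_distrib_right)
  also have "\<dots> = (\<Sum>i<n. if i = j then det ?A * c j else 0)"
    unfolding adj(3) using j by (intro sum.cong refl) auto
  also have "\<dots> = det ?A * c j" using j by simp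
  finally show ?thesis using det by simp
qed

text \<open>Once N points are fixed, expansion along the last column turns the next determinant into
  a linear combination of the functions at the new point, whose last coefficient is the previous
  determinant. Independence provides a point where it does not vanish.\<close>

lemma exists_nonsingular_points:
  fixes u :: "nat \<Rightarrow> 'b \<Rightarrow> 'a::field"
  assumes "\<And>a. (\<And>x. (\<Sum>k<N. a k * u k x) = 0) \<Longrightarrow> (\<forall>k<N. a k = 0)"
  shows "\<exists>b. det (mat N N (\<lambda>(k, i). u k (b i))) \<noteq> 0"
  using assms
proof (induction N)
  case 0
  show ?case by (simp add: det_def)
next
  case (Suc N)
  have "\<forall>k<N. a k = 0" if a: "\<And>x. (\<Sum>k<N. a k * u k x) = 0" for a
    using Suc.prems[of "\<lambda>k. if k < N then a k else 0"] a by (auto simp: less_Suc_eq)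
  then obtain b where b: "det (mat N N (\<lambda>(k, i). u k (b i))) \<noteq> 0"
    using Suc.IH by blast
  define A where "A x = mat (Suc N) (Suc N) (\<lambda>(k, i). u k ((b(N := x)) i))" for x
  \<comment> \<open>The cofactor of entry (k, N). It omits the last column and so does not depend on
    the new point x.\<close>
  define C where "C k = (-1) ^ (k + N) *
     det (mat N N (\<lambda>(k', i). u (if k' < k then k' else Suc k') (b i)))" for k
  have A: "A x \<in> carrier_mat (Suc N) (Suc N)" for x by (simp add: A_def)
  have C: "cofactor (A x) k N = C k" if "k < Suc N" for x k
  proof -
    have "mat_delete (A x) k N = mat N N (\<lambda>(k', i). u (if k' < k then k' else Suc k') (b i))"
      by (rule eq_matI) (auto simp: mat_delete_def A_def)
    then show ?thesis by (simp add: cofactor_def C_def)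
  qed
  have AN: "A x $$ (k, N) = u k x" if "k < Suc N" for x k
    using that by (simp add: A_def)
  have "det (A x) = (\<Sum>k<Suc N. A x $$ (k, N) * cofactor (A x) k N)" for x
    by (rule laplace_expansion_column[OF A]) simp
  also have "\<dots> x = (\<Sum>k<Suc N. C k * u k x)" for x
    by (intro sum.cong refl) (simp add: C AN)
  finally have det: "det (A x) = (\<Sum>k<Suc N. C k * u k x)" for x .
  have "mat N N (\<lambda>(k', i). u (if k' < N then k' else Suc k') (b i)) = mat N N (\<lambda>(k, i). u k (b i))"
    by (rule eq_matI) auto
  then have "C N \<noteq> 0" using b by (simp add: C_def)
  then obtain x where "det (A x) \<noteq> 0"
    using Suc.prems[of C] unfolding det by blast
  then show ?case unfolding A_def by blast
qed

section \<open>Derivations applied to determinants\<close>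

lemma derivation_prod:
  fixes D :: "'a::comm_ring_1 \<Rightarrow> 'a"
  assumes D1: "D 1 = 0" and mult: "\<And>a b. D (a * b) = D a * b + a * D b" and fin: "finite I"
  shows "D (prod f I) = (\<Sum>i\<in>I. prod (f(i := D (f i))) I)"
  using fin
proof (induction I)
  case (insert i I)
  have "prod (f(i := D (f i))) I = prod f I"
    using insert.hyps by (intro prod.cong) auto
  moreover have "(f(j := D (f j))) i = f i" if "j \<in> I" for j
    using that insert.hyps by auto
  ultimately show ?case using insert
    by (simp add: mult sum_distrib_left)
qed (simp add: D1)

text \<open>Jacobi's formula: by the Leibniz rule the derivative is a sum of determinants with one
  row differentiated, and each is expanded along that row.\<close>

lemma derivation_det:
  fixes D :: "'a::comm_ring_1 \<Rightarrow> 'a"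
  assumes add: "\<And>a b. D (a + b) = D a + D b" and mult: "\<And>a b. D (a * b) = D a * b + a * D b"
    and A: "A \<in> carrier_mat n n"
  shows "D (det A) = (\<Sum>i<n. \<Sum>k<n. D (A $$ (i, k)) * cofactor A i k)"
proof -
  have D0: "D 0 = 0" using add[of 0 0] by (metis add.right_neutral add_left_cancel)
  have D1: "D 1 = 0"
    using mult[of 1 1] by (metis add.right_neutral add_left_cancel mult.right_neutral mult_1)
  have Dm: "D (- a) = - D a" for a
    using add[of a "- a"] D0 by (metis add.right_inverse minus_unique)
  have Dsum: "D (sum f I) = (\<Sum>i\<in>I. D (f i))" for f :: "_ \<Rightarrow> 'a" and I :: "'c set"
    by (induction I rule: infinite_finite_induct) (auto simp: D0 add)
  have Dsign: "D (signof q * a) = signof q * D a" for q :: "nat \<Rightarrow> nat" and a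
    by (simp add: sign_def Dm)
  define B where "B i = mat n n (\<lambda>(j, k). if j = i then D (A $$ (i, k)) else A $$ (j, k))" for i
  have B: "B i \<in> carrier_mat n n" for i by (simp add: B_def)
  let ?P = "{q. q permutes {0..<n}}"
  have "D (det A) = (\<Sum>q\<in>?P. signof q * (\<Sum>i<n. \<Prod>j = 0..<n. B i $$ (j, q j)))"
    unfolding det_def'[OF A] Dsum
  proof (intro sum.cong refl)
    fix q assume "q \<in> ?P"
    then have q: "q permutes {0..<n}" by simp
    have "D (\<Prod>j = 0..<n. A $$ (j, q j)) =
        (\<Sum>i<n. \<Prod>j = 0..<n. ((\<lambda>j. A $$ (j, q j))(i := D (A $$ (i, q i)))) j)"
      by (subst derivation_prod[OF D1 mult]) (simp_all add: lessThan_atLeast0)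
    also have "\<dots> = (\<Sum>i<n. \<Prod>j = 0..<n. B i $$ (j, q j))"
      using permutes_in_image[OF q] by (intro sum.cong prod.cong refl) (auto simp: B_def)
    finally show "D (signof q * (\<Prod>j = 0..<n. A $$ (j, q j))) =
        signof q * (\<Sum>i<n. \<Prod>j = 0..<n. B i $$ (j, q j))"
      by (simp add: Dsign)
  qed
  also have "\<dots> = (\<Sum>i<n. det (B i))"
    unfolding det_def'[OF B] by (subst sum.swap) (simp add: sum_distrib_left)
  also have "\<dots> = (\<Sum>i<n. \<Sum>k<n. D (A $$ (i, k)) * cofactor A i k)"
  proof (intro sum.cong refl)
    fix i assume i: "i \<in> {..<n}"
    have "mat_delete (B i) i k = mat_delete A i k" if "k < n" for k
      using A i that by (intro eq_matI) (auto simp: mat_delete_def B_def)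
    then show "det (B i) = (\<Sum>k<n. D (A $$ (i, k)) * cofactor A i k)"
      using i by (subst laplace_expansion_row[OF B, of i])
        (auto simp: B_def cofactor_def)
  qed
  finally show ?thesis .
qed

text \<open>By Jacobi's formula D (det A) is the trace of D(A) adj(A), and D(A) = T A - A T. Both
  tr(T A adj(A)) and tr(A T adj(A)) equal det(A) tr(T), the second after a cyclic shift.\<close>

lemma derivation_det_commutator:
  fixes D :: "'a::comm_ring_1 \<Rightarrow> 'a"
  assumes add: "\<And>a b. D (a + b) = D a + D b" and mult: "\<And>a b. D (a * b) = D a * b + a * D b"
    and A: "A \<in> carrier_mat n n" and T: "T \<in> carrier_mat n n"
    and comm: "\<And>i k. i < n \<Longrightarrow> k < n \<Longrightarrow> (T * A) $$ (i, k) = (A * T) $$ (i, k) + D (A $$ (i, k))"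
  shows "D (det A) = 0"
proof -
  note adj = adj_mat[OF A]
  have TA: "T * A \<in> carrier_mat n n" and AT: "A * T \<in> carrier_mat n n" using A T by auto
  have cof: "cofactor A i k = adj_mat A $$ (k, i)" if "i < n" "k < n" for i k
    using that A by (simp add: adj_mat_def)
  have tr: "(\<Sum>i<n. T $$ (i, i) * det A) = (\<Sum>i<n. \<Sum>k<n. (T * A) $$ (i, k) * cofactor A i k)"
  proof -
    have "(\<Sum>k<n. (T * A) $$ (i, k) * cofactor A i k) = T $$ (i, i) * det A" if i: "i < n" for i
    proof -
      have "(\<Sum>k<n. (T * A) $$ (i, k) * cofactor A i k) = (T * A * adj_mat A) $$ (i, i)"
        using i by (subst index_mult_mat_sum[OF TA adj(1)]) (simp_all add: cof)
      also have "T * A * adj_mat A = T * (det A \<cdot>\<^sub>m 1\<^sub>m n)"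
        using assoc_mult_mat[OF T A adj(1)] adj(2) by simp
      also have "\<dots> = det A \<cdot>\<^sub>m T" using T by auto
      finally show ?thesis using T i by (simp add: mult.commute)
    qed
    then show ?thesis by simp
  qed
  have tr': "(\<Sum>i<n. T $$ (i, i) * det A) = (\<Sum>i<n. \<Sum>k<n. (A * T) $$ (i, k) * cofactor A i k)"
  proof -
    have "(\<Sum>i<n. (A * T) $$ (i, k) * cofactor A i k) = T $$ (k, k) * det A" if k: "k < n" for k
    proof -
      have "(\<Sum>i<n. (A * T) $$ (i, k) * cofactor A i k) = (adj_mat A * (A * T)) $$ (k, k)"
        using k by (subst index_mult_mat_sum[OF adj(1) AT]) (simp_all add: cof mult.commute)
      also have "adj_mat A * (A * T) = (det A \<cdot>\<^sub>m 1\<^sub>m n) * T"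
        using assoc_mult_mat[OF adj(1) A T] adj(3) by simp
      also have "\<dots> = det A \<cdot>\<^sub>m T" using T by auto
      finally show ?thesis using T k by (simp add: mult.commute)
    qed
    then show ?thesis by (subst sum.swap) simp
  qed
  have "(\<Sum>i<n. \<Sum>k<n. (T * A) $$ (i, k) * cofactor A i k) =
      (\<Sum>i<n. \<Sum>k<n. (A * T) $$ (i, k) * cofactor A i k) + D (det A)"
    unfolding derivation_det[OF add mult A] sum.distrib[symmetric]
    by (intro sum.cong refl) (simp add: comm algebra_simps)
  then show ?thesis using tr tr' by simp
qed

section \<open>Skolem--Noether for full matrix algebras\<close>

lemma exists_kernel_vector:
  fixes P :: "nat \<Rightarrow> nat \<Rightarrow> 'a::field"
  assumes "m < n \<or> m = n \<and> det (mat n n (\<lambda>(a, j). P a j)) = 0"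
  shows "\<exists>v. (\<exists>s<n. v s \<noteq> 0) \<and> (\<forall>a<m. (\<Sum>j<n. P a j * v j) = 0)"
proof -
  \<comment> \<open>Zero rows fill up the system when there are fewer equations than unknowns, so
    both cases become a square matrix of determinant 0.\<close>
  define Q where "Q = mat n n (\<lambda>(a, j). if a < m then P a j else 0)"
  have Q: "Q \<in> carrier_mat n n" by (simp add: Q_def)
  have "det Q = 0"
  proof (cases "m < n")
    case True
    then show ?thesis using laplace_expansion_row[OF Q True] by (simp add: Q_def)
  next
    case False
    have "Q = mat n n (\<lambda>(a, j). P a j)" using False assms by (intro eq_matI) (auto simp: Q_def)
    then show ?thesis using False assms by simp
  qed
  then obtain v where v: "v \<in> carrier_vec n" "v \<noteq> 0\<^sub>v n" "Q *\<^sub>v v = 0\<^sub>v n"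
    using det_0_iff_vec_prod_zero_field[OF Q] by blast
  have "\<exists>s<n. v $ s \<noteq> 0" using v(1,2) by auto
  moreover have "(\<Sum>j<n. P a j * v $ j) = 0" if a: "a < m" for a
  proof -
    have an: "a < n" using a assms by auto
    have "(Q *\<^sub>v v) $ a = (\<Sum>j<n. P a j * v $ j)"
      using v(1) a an by (simp add: Q_def scalar_prod_def lessThan_atLeast0)
    then show ?thesis using v(3) an by simp
  qed
  ultimately show ?thesis by (intro exI[of _ "\<lambda>j. v $ j"]) auto
qed

text \<open>Entrywise, so that the result has dimension n whatever the index set and the summands
  are.\<close>

definition mat_lincomb :: "nat \<Rightarrow> 'i set \<Rightarrow> ('i \<Rightarrow> 'a::comm_ring_1) \<Rightarrow> ('i \<Rightarrow> 'a mat) \<Rightarrow> 'a mat" where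
  "mat_lincomb n I c M = mat n n (\<lambda>(a, b). \<Sum>i\<in>I. c i * M i $$ (a, b))"

lemma mat_lincomb_carrier [simp]: "mat_lincomb n I c M \<in> carrier_mat n n"
  by (simp add: mat_lincomb_def)

lemma mat_lincomb_index: "a < n \<Longrightarrow> b < n \<Longrightarrow> mat_lincomb n I c M $$ (a, b) = (\<Sum>i\<in>I. c i * M i $$ (a, b))"
  by (simp add: mat_lincomb_def)

lemma linear_mat_lincomb:
  assumes add: "\<And>A B. A \<in> carrier_mat n n \<Longrightarrow> B \<in> carrier_mat n n \<Longrightarrow> \<psi> (A + B) = \<psi> A + \<psi> B"
    and smult: "\<And>a A. A \<in> carrier_mat n n \<Longrightarrow> \<psi> (a \<cdot>\<^sub>m A) = a \<cdot>\<^sub>m \<psi> A"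
    and closed: "\<And>A. A \<in> carrier_mat n n \<Longrightarrow> \<psi> A \<in> carrier_mat m m"
    and "finite I" and M: "\<And>i. i \<in> I \<Longrightarrow> M i \<in> carrier_mat n n"
  shows "\<psi> (mat_lincomb n I c M) = mat_lincomb m I c (\<lambda>i. \<psi> (M i))"
  using \<open>finite I\<close> M
proof (induction I)
  case empty
  \<comment> \<open>The zero matrix is written as 0 times itself, so that homogeneity gives the
    value of \<psi> there.\<close>
  have "\<psi> (mat_lincomb n {} c M) = \<psi> (0 \<cdot>\<^sub>m 0\<^sub>m n n)"
    by (rule arg_cong[of _ _ \<psi>]) (auto simp: mat_lincomb_def)
  also have "\<dots> = 0 \<cdot>\<^sub>m \<psi> (0\<^sub>m n n)" by (simp only: smult zero_carrier_mat)
  finally show ?case using closed[of "0\<^sub>m n n"] by (auto simp: mat_lincomb_def)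
next
  case (insert i I)
  have Mi: "M i \<in> carrier_mat n n" using insert.prems by simp
  have "\<psi> (mat_lincomb n (insert i I) c M) = \<psi> (c i \<cdot>\<^sub>m M i + mat_lincomb n I c M)"
    using insert.hyps Mi by (intro arg_cong[of _ _ \<psi>] eq_matI) (auto simp: mat_lincomb_def)
  also have "\<dots> = c i \<cdot>\<^sub>m \<psi> (M i) + mat_lincomb m I c (\<lambda>i. \<psi> (M i))"
    using insert Mi by (simp add: add smult)
  also have "\<dots> = mat_lincomb m (insert i I) c (\<lambda>i. \<psi> (M i))"
    using insert.hyps closed[OF Mi] by (intro eq_matI) (auto simp: mat_lincomb_def)
  finally show ?case .
qed

text \<open>The columns of the conjugating matrix \<open>P\<close> are one fixed nonzero column of the images of
  the matrix units \<open>E\<^sub>j\<^sub>0\<close>.\<close>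

lemma skolem_noether_det:
  fixes \<psi> :: "'a::field mat \<Rightarrow> 'a mat"
  assumes closed: "\<And>A. A \<in> carrier_mat n n \<Longrightarrow> \<psi> A \<in> carrier_mat m m"
    and add: "\<And>A B. A \<in> carrier_mat n n \<Longrightarrow> B \<in> carrier_mat n n \<Longrightarrow> \<psi> (A + B) = \<psi> A + \<psi> B"
    and mult: "\<And>A B. A \<in> carrier_mat n n \<Longrightarrow> B \<in> carrier_mat n n \<Longrightarrow> \<psi> (A * B) = \<psi> A * \<psi> B"
    and smult: "\<And>a A. A \<in> carrier_mat n n \<Longrightarrow> \<psi> (a \<cdot>\<^sub>m A) = a \<cdot>\<^sub>m \<psi> A"
    and one: "\<psi> (1\<^sub>m n) = 1\<^sub>m m"
    and surj: "\<And>B. B \<in> carrier_mat m m \<Longrightarrow> \<exists>A\<in>carrier_mat n n. \<psi> A = B"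
    and m: "m > 0"
  shows "n = m" and "\<And>A. A \<in> carrier_mat n n \<Longrightarrow> det (\<psi> A) = det A"
proof -
  note lin = linear_mat_lincomb[of n \<psi> m, OF add smult closed]
  define E :: "nat \<Rightarrow> nat \<Rightarrow> 'a mat" where
    "E i j = mat n n (\<lambda>(a, b). if a = i \<and> b = j then 1 else 0)" for i j
  have E [simp]: "E i j \<in> carrier_mat n n" for i j by (simp add: E_def)
  have EE: "E i 0 * E 0 j = E i j" if "n > 0" for i j
  proof (rule eq_matI)
    fix a b assume "a < dim_row (E i j)" "b < dim_col (E i j)"
    then have ab: "a < n" "b < n" by (auto simp: E_def)
    have "(E i 0 * E 0 j) $$ (a, b) = (\<Sum>k<n. E i 0 $$ (a, k) * E 0 j $$ (k, b))"
      by (rule index_mult_mat_sum[OF E E ab])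
    also have "\<dots> = (\<Sum>k<n. if k = 0 then E i j $$ (a, b) else 0)"
      using ab by (intro sum.cong) (auto simp: E_def)
    also have "\<dots> = E i j $$ (a, b)" using that by simp
    finally show "(E i 0 * E 0 j) $$ (a, b) = E i j $$ (a, b)" .
  qed (auto simp: E_def)
  have n: "n > 0"
  proof (rule ccontr)
    assume "\<not> n > 0"
    then have "1\<^sub>m n = 0 \<cdot>\<^sub>m (1\<^sub>m n :: 'a mat)" by (intro eq_matI) auto
    then have "1\<^sub>m m = (0 :: 'a) \<cdot>\<^sub>m 1\<^sub>m m" using smult[of "1\<^sub>m n" 0] one by simp
    then have "(1\<^sub>m m :: 'a mat) $$ (0, 0) = ((0 :: 'a) \<cdot>\<^sub>m 1\<^sub>m m) $$ (0, 0)" by simp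
    then show False using m by simp
  qed
  \<comment> \<open>Otherwise every \<open>E i i\<close>, being the product of \<open>E i 0\<close>,
    \<open>E 0 0\<close> and \<open>E 0 i\<close>, would be killed, and with them the identity
    matrix.\<close>
  have "\<psi> (E 0 0) \<noteq> 0\<^sub>m m m"
  proof
    assume 0: "\<psi> (E 0 0) = 0\<^sub>m m m"
    have "\<psi> (E i i) = 0\<^sub>m m m" for i
    proof -
      have "\<psi> (E i i) = \<psi> (E i 0 * (E 0 0 * E 0 i))" using EE[OF n] by simp
      also have "\<dots> = \<psi> (E i 0) * (\<psi> (E 0 0) * \<psi> (E 0 i))"
        by (subst mult, simp, rule mult_carrier_mat[of _ n n], simp, simp, subst mult, simp_all)
      also have "\<dots> = 0\<^sub>m m m" unfolding 0
        using left_mult_zero_mat[OF closed[OF E]] right_mult_zero_mat[OF closed[OF E]] by simp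
      finally show ?thesis .
    qed
    moreover have "1\<^sub>m n = mat_lincomb n {..<n} (\<lambda>_. 1) (\<lambda>i. E i i)"
      by (intro eq_matI) (auto simp: mat_lincomb_def E_def intro!: sum.neutral)
    ultimately have "1\<^sub>m m = mat_lincomb m {..<n} (\<lambda>_. 1) (\<lambda>i. 0\<^sub>m m m :: 'a mat)"
      using lin[of "{..<n}" "\<lambda>i. E i i" "\<lambda>_. 1"] one by simp
    then have "(1\<^sub>m m :: 'a mat) $$ (0, 0) = mat_lincomb m {..<n} (\<lambda>_. 1) (\<lambda>i. 0\<^sub>m m m) $$ (0, 0)"
      by simp
    then show False using m by (simp add: mat_lincomb_index)
  qed
  then obtain a0 r where r: "a0 < m" "r < m" "\<psi> (E 0 0) $$ (a0, r) \<noteq> 0"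
    using closed[OF E, of 0 0] by (metis carrier_matD eq_matI index_zero_mat)
  define P where "P = mat m n (\<lambda>(a, j). \<psi> (E j 0) $$ (a, r))"
  have P: "P \<in> carrier_mat m n" by (simp add: P_def)
  have P0: "P $$ (a0, 0) \<noteq> 0" using r n by (simp add: P_def)
  \<comment> \<open>\<open>A * E j 0\<close> is the combination of the \<open>E i 0\<close> with
    coefficients from column j of A. Applying \<psi> and reading off column r gives the intertwining
    relation.\<close>
  have inter: "\<psi> A * P = P * A" if A: "A \<in> carrier_mat n n" for A
  proof (rule eq_matI)
    fix a j assume "a < dim_row (P * A)" "j < dim_col (P * A)"
    then have a: "a < m" and j: "j < n" using A P by auto
    have AE: "A * E j 0 = mat_lincomb n {..<n} (\<lambda>i. A $$ (i, j)) (\<lambda>i. E i 0)"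
    proof (rule eq_matI)
      fix c b assume "c < dim_row (mat_lincomb n {..<n} (\<lambda>i. A $$ (i, j)) (\<lambda>i. E i 0))"
        "b < dim_col (mat_lincomb n {..<n} (\<lambda>i. A $$ (i, j)) (\<lambda>i. E i 0))"
      then have cb: "c < n" "b < n" by (auto simp: mat_lincomb_def)
      have "(A * E j 0) $$ (c, b) = (\<Sum>k<n. A $$ (c, k) * E j 0 $$ (k, b))"
        by (rule index_mult_mat_sum[OF A E cb])
      also have "\<dots> = (\<Sum>k<n. if k = j then (if b = 0 then A $$ (c, j) else 0) else 0)"
        using cb by (intro sum.cong) (auto simp: E_def)
      also have "\<dots> = (\<Sum>k<n. if k = c then (if b = 0 then A $$ (c, j) else 0) else 0)"
        using j cb by simp
      also have "\<dots> = (\<Sum>k<n. A $$ (k, j) * E k 0 $$ (c, b))"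
        using cb by (intro sum.cong) (auto simp: E_def)
      finally show "(A * E j 0) $$ (c, b) =
          mat_lincomb n {..<n} (\<lambda>i. A $$ (i, j)) (\<lambda>i. E i 0) $$ (c, b)"
        using cb by (simp add: mat_lincomb_index)
    qed (use A in \<open>auto simp: mat_lincomb_def E_def\<close>)
    have "(\<psi> A * P) $$ (a, j) = (\<Sum>k<m. \<psi> A $$ (a, k) * \<psi> (E j 0) $$ (k, r))"
      using j by (subst index_mult_mat_sum[OF closed[OF A] P a j]) (simp add: P_def)
    also have "\<dots> = \<psi> (A * E j 0) $$ (a, r)"
      using index_mult_mat_sum[OF closed[OF A] closed[OF E] a r(2)] by (simp add: mult A)
    also have "\<dots> = (\<Sum>i<n. A $$ (i, j) * \<psi> (E i 0) $$ (a, r))"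
      unfolding AE using a r by (subst lin) (simp_all add: mat_lincomb_index)
    also have "\<dots> = (P * A) $$ (a, j)"
      using a j by (subst index_mult_mat_sum[OF P A a j]) (simp add: P_def mult.commute)
    finally show "(\<psi> A * P) $$ (a, j) = (P * A) $$ (a, j)" .
  qed (use A P closed in auto)
  \<comment> \<open>If P v = 0, then P (E_0s v) = \<psi>(E_0s) P v = 0. But E_0s v is v_s times the
    first unit vector, so entry a0 of the left side is P(a0, 0) v_s, which is nonzero.\<close>
  have no_ker: False
    if s: "s < n" "v s \<noteq> 0" and v: "\<And>a. a < m \<Longrightarrow> (\<Sum>j<n. P $$ (a, j) * v j) = 0" for v s
  proof -
    have "(\<Sum>j<n. (P * E 0 s) $$ (a0, j) * v j) = (\<Sum>j<n. (\<psi> (E 0 s) * P) $$ (a0, j) * v j)"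
      by (simp add: inter)
    also have "\<dots> = (\<Sum>j<n. \<Sum>k<m. \<psi> (E 0 s) $$ (a0, k) * (P $$ (k, j) * v j))"
      using r by (intro sum.cong refl)
        (simp add: index_mult_mat_sum[OF closed[OF E] P] sum_distrib_right mult.assoc del: index_mult_mat)
    also have "\<dots> = (\<Sum>k<m. \<psi> (E 0 s) $$ (a0, k) * (\<Sum>j<n. P $$ (k, j) * v j))"
      by (subst sum.swap) (simp add: sum_distrib_left)
    also have "\<dots> = 0" by (simp add: v)
    finally have 1: "(\<Sum>j<n. (P * E 0 s) $$ (a0, j) * v j) = 0" .
    have "(P * E 0 s) $$ (a0, j) = (if j = s then P $$ (a0, 0) else 0)" if j: "j < n" for j
    proof -
      have "(P * E 0 s) $$ (a0, j) = (\<Sum>k<n. P $$ (a0, k) * E 0 s $$ (k, j))"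
        by (rule index_mult_mat_sum[OF P E r(1) j])
      also have "\<dots> = (\<Sum>k<n. if k = 0 then (if j = s then P $$ (a0, 0) else 0) else 0)"
        using j by (intro sum.cong) (auto simp: E_def)
      finally show ?thesis using n by simp
    qed
    then have "(\<Sum>j<n. (P * E 0 s) $$ (a0, j) * v j) =
        (\<Sum>j<n. if j = s then P $$ (a0, 0) * v s else 0)"
      by (intro sum.cong refl) auto
    then show False using 1 s P0 by simp
  qed
  \<comment> \<open>The dual argument on the left: surjectivity provides A whose image is the matrix
    unit B at (s, a0). Then w annihilates P A = B P, whose first column has the single nonzero entry
    P(a0, 0) in row s.\<close>
  have no_coker: False
    if s: "s < m" "w s \<noteq> 0" and w: "\<And>j. j < n \<Longrightarrow> (\<Sum>a<m. P $$ (a, j) * w a) = 0" for w s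
  proof -
    define B where "B = mat m m (\<lambda>(a, b). if a = s \<and> b = a0 then 1 else 0 :: 'a)"
    have B: "B \<in> carrier_mat m m" by (simp add: B_def)
    obtain A where A: "A \<in> carrier_mat n n" "\<psi> A = B" using surj[OF B] by blast
    have "(\<Sum>a<m. (B * P) $$ (a, 0) * w a) = (\<Sum>a<m. (P * A) $$ (a, 0) * w a)"
      using inter[OF A(1)] A(2) by simp
    also have "\<dots> = (\<Sum>a<m. \<Sum>k<n. A $$ (k, 0) * (P $$ (a, k) * w a))"
      using n by (intro sum.cong refl)
        (simp add: index_mult_mat_sum[OF P A(1)] sum_distrib_left sum_distrib_right ac_simps
          del: index_mult_mat)
    also have "\<dots> = (\<Sum>k<n. A $$ (k, 0) * (\<Sum>a<m. P $$ (a, k) * w a))"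
      by (subst sum.swap) (simp add: sum_distrib_left)
    also have "\<dots> = 0" by (simp add: w)
    finally have 1: "(\<Sum>a<m. (B * P) $$ (a, 0) * w a) = 0" .
    have "(B * P) $$ (a, 0) = (if a = s then P $$ (a0, 0) else 0)" if a: "a < m" for a
    proof -
      have "(B * P) $$ (a, 0) = (\<Sum>k<m. B $$ (a, k) * P $$ (k, 0))"
        by (rule index_mult_mat_sum[OF B P a n])
      also have "\<dots> = (\<Sum>k<m. if k = a0 then (if a = s then P $$ (a0, 0) else 0) else 0)"
        using a by (intro sum.cong) (auto simp: B_def)
      finally show ?thesis using r by simp
    qed
    then have "(\<Sum>a<m. (B * P) $$ (a, 0) * w a) =
        (\<Sum>a<m. if a = s then P $$ (a0, 0) * w s else 0)"
      by (intro sum.cong refl) auto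
    then show False using 1 s P0 by simp
  qed
  have "\<not> m < n"
    using exists_kernel_vector[of m n "\<lambda>a j. P $$ (a, j)"] no_ker by blast
  moreover have "\<not> n < m"
    using exists_kernel_vector[of n m "\<lambda>j a. P $$ (a, j)"] no_coker by blast
  ultimately show nm: "n = m" by simp
  have "P = mat n n (\<lambda>(a, j). P $$ (a, j))" using P nm by (intro eq_matI) auto
  then have detP: "det P \<noteq> 0"
    using exists_kernel_vector[of m n "\<lambda>a j. P $$ (a, j)"] no_ker nm by metis
  show "det (\<psi> A) = det A" if A: "A \<in> carrier_mat n n" for A
  proof -
    have "det (\<psi> A) * det P = det (\<psi> A * P)"
      using closed[OF A] P nm by (simp add: det_mult)
    also have "\<dots> = det P * det A"
      unfolding inter[OF A] using A P nm by (simp add: det_mult)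
    finally show ?thesis using detP by simp
  qed
qed

section \<open>The central subring \<open>F[x]\<close>\<close>

lemma coeff_mult_degree_bounds:
  fixes u v :: "'a::comm_semiring_1 poly"
  assumes "degree u \<le> a" "degree v \<le> b"
  shows "coeff (u * v) (a + b) = coeff u a * coeff v b"
proof -
  have "coeff (u * v) (a + b) = (\<Sum>i\<le>a + b. if i = a then coeff u a * coeff v b else 0)"
    unfolding coeff_mult
  proof (intro sum.cong refl)
    fix i assume "i \<in> {..a + b}"
    consider "i < a" | "i = a" | "i > a" by linarith
    then show "coeff u i * coeff v (a + b - i) = (if i = a then coeff u a * coeff v b else 0)"
      by cases (use assms in \<open>auto simp: coeff_eq_0\<close>)
  qed
  then show ?thesis by simp
qed

text \<open>The D i are only bounds on the degrees, so that the summands of a determinant, some of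
  lower degree, can all be compared in one fixed degree.\<close>

lemma coeff_prod_degree_bounds:
  fixes P :: "'i \<Rightarrow> 'a::comm_semiring_1 poly"
  assumes "finite I" "\<And>i. i \<in> I \<Longrightarrow> degree (P i) \<le> D i"
  shows "degree (prod P I) \<le> sum D I" and "coeff (prod P I) (sum D I) = (\<Prod>i\<in>I. coeff (P i) (D i))"
proof -
  have "degree (prod P I) \<le> sum D I \<and> coeff (prod P I) (sum D I) = (\<Prod>i\<in>I. coeff (P i) (D i))"
    using assms
  proof (induction I)
    case (insert i I)
    then have IH: "degree (P i) \<le> D i" "degree (prod P I) \<le> sum D I"
      "coeff (prod P I) (sum D I) = (\<Prod>i\<in>I. coeff (P i) (D i))" by auto
    then show ?case
      using insert.hyps coeff_mult_degree_bounds[OF IH(1,2)] degree_mult_le[of "P i" "prod P I"]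
      by simp
  qed simp
  then show "degree (prod P I) \<le> sum D I" "coeff (prod P I) (sum D I) = (\<Prod>i\<in>I. coeff (P i) (D i))"
    by auto
qed

locale algebraic_dp = derivation \<delta> for \<delta> :: "'k::field \<Rightarrow> 'k" +
  fixes \<iota> :: "'f::field \<Rightarrow> 'k" and p e :: nat and c :: "nat \<Rightarrow> 'f" and g :: "'f poly"
  assumes prime_p: "prime p" and char_F: "CHAR('f) = p" and field_hom_iota: "field_hom \<iota>"
    and Const_eq: "Const \<delta> = range \<iota>" and minimum_polynomial: "is_minimum_polynomial \<iota> \<delta> g"
    and g_eq: "g = monom 1 (p ^ e) + (\<Sum>i=1..e. monom (c i) (p ^ (e - i)))"
begin

sublocale iota: field_hom \<iota> by (rule field_hom_iota)
sublocale iota_poly: map_poly_inj_idom_hom \<iota> ..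

text \<open>At once the degree of g, the rank of R over K[x] and the size of all matrices
  below.\<close>

definition n where "n = p ^ e"
abbreviation G where "G \<equiv> map_poly \<iota> g"

lemma n_pos [simp]: "n > 0"
  using prime_p by (simp add: n_def prime_gt_0_nat)

lemma coeff_g_power: "coeff g k \<noteq> 0 \<Longrightarrow> \<exists>j. k = p ^ j"
  unfolding g_eq by (auto simp: coeff_sum split: if_splits elim!: sum.not_neutral_contains_not_neutral)

lemma degree_g: "degree g = n" and coeff_g_n: "coeff g n = 1"
proof -
  have p: "p > 1" using prime_p by (rule prime_gt_1_nat)
  have lt: "p ^ (e - i) < n" if "i \<in> {1..e}" for i
    unfolding n_def using that p by (intro power_strict_increasing) auto
  have "(\<Sum>i=1..e. coeff (monom (c i) (p ^ (e - i))) n) = 0"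
    using lt by (intro sum.neutral ballI) (metis coeff_monom less_irrefl)
  then show c: "coeff g n = 1" unfolding g_eq by (simp add: coeff_sum n_def)
  have "degree (\<Sum>i=1..e. monom (c i) (p ^ (e - i))) \<le> n"
    using lt by (intro degree_sum_le) (auto intro!: order_trans[OF degree_monom_le] simp: less_imp_le)
  then have "degree g \<le> n"
    unfolding g_eq by (intro degree_add_le) (simp_all add: degree_monom_le n_def)
  then show "degree g = n" using c by (intro antisym le_degree) auto
qed

declare degree_g [simp] coeff_g_n [simp]

lemma g_nonzero [simp]: "g \<noteq> 0"
  using coeff_g_n by (metis coeff_0 zero_neq_one)

lemma delta_iota [simp]: "\<delta> (\<iota> a) = 0"
  using Const_eq by (auto simp: Const_def)

lemma dd_map_iota [simp]: "dd (map_poly \<iota> q) = 0"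
  by (intro poly_eqI) (simp add: coeff_map_poly)

lemma dd_eq_0_iff: "dd q = 0 \<longleftrightarrow> (\<exists>r. q = map_poly \<iota> r)"
proof
  assume dd: "dd q = 0"
  have "coeff q i \<in> range \<iota>" for i
  proof -
    have "\<delta> (coeff q i) = 0" using dd by (metis coeff_0 coeff_map_poly delta_0)
    then show ?thesis using Const_eq by (auto simp: Const_def)
  qed
  then have "q = map_poly \<iota> (map_poly (Hilbert_Choice.inv \<iota>) q)"
    by (intro poly_eqI) (simp add: coeff_map_poly f_inv_into_f inv_f_eq iota.inj_f)
  then show "\<exists>r. q = map_poly \<iota> r" by blast
qed auto

section \<open>Centrality of g(t)\<close>

lemma char_K: "CHAR('k) = p"
proof -
  have "CHAR('k) dvd m \<longleftrightarrow> p dvd m" for m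
  proof -
    have "of_nat m = (0 :: 'k) \<longleftrightarrow> of_nat m = (0 :: 'f)"
      by (subst iota.hom_of_nat[symmetric]) (rule iota.hom_0_iff)
    then show ?thesis by (simp add: of_nat_eq_0_iff_char_dvd char_F)
  qed
  then show ?thesis by (meson dvd_antisym dvd_refl)
qed

text \<open>Since i (p^k choose i) = p^k (p^k - 1 choose i - 1), a binomial coefficient prime to p
  would force p^k to divide i.\<close>

lemma of_nat_choose_prime_power:
  assumes "0 < i" "i < p ^ k"
  shows "of_nat (p ^ k choose i) = (0 :: 'k poly)"
proof -
  have "p dvd (p ^ k choose i)"
  proof (rule ccontr)
    assume "\<not> p dvd (p ^ k choose i)"
    then have "coprime (p ^ k) (p ^ k choose i)"
      using prime_p by (simp add: prime_imp_coprime)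
    moreover have "p ^ k dvd i * (p ^ k choose i)"
      using times_binomial_minus1_eq[OF assms(1), of "p ^ k"] by simp
    ultimately have "p ^ k dvd i" by (simp add: coprime_dvd_mult_left_iff)
    then show False using assms by (simp add: nat_dvd_not_less)
  qed
  then show ?thesis by (simp add: of_nat_eq_0_iff_char_dvd char_K)
qed

text \<open>Only the two extreme terms of the Leibniz formula survive: t^(p^k) is again the variable
  power plus a derivation, the p^k-th iterate of \<delta>.\<close>

lemma tt_pow_prime_power:
  "(tt ^^ (p ^ k)) q = monom 1 (p ^ k) * q + map_poly (\<delta> ^^ (p ^ k)) q"
proof -
  let ?F = "\<lambda>i. of_nat (p ^ k choose i) * (monom 1 (p ^ k - i) * map_poly (\<delta> ^^ i) q)"
  have "(tt ^^ (p ^ k)) q = (\<Sum>i\<le>p ^ k. ?F i)" by (rule tt_pow_leibniz)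
  also have "\<dots> = (\<Sum>i\<in>{0, p ^ k}. ?F i)"
    by (intro sum.mono_neutral_right) (auto simp: of_nat_choose_prime_power)
  also have "\<dots> = monom 1 (p ^ k) * q + map_poly (\<delta> ^^ (p ^ k)) q"
    using prime_p by (simp add: map_poly_idI prime_gt_0_nat)
  finally show ?thesis .
qed

lemma g_annihilates: "(\<Sum>k\<le>n. \<iota> (coeff g k) * (\<delta> ^^ k) a) = 0"
  using minimum_polynomial
  by (simp add: is_minimum_polynomial_def annihilates_def degree_g)

text \<open>The exponents in g are powers of p, so g(t) f differs from the commutative product by
  g(\<delta>) applied to the coefficients of f, and g(\<delta>) = 0. Together with
  \<open>skew_const_coeffs_right\<close> this makes g(t) central.\<close>

lemma G_skew: "G \<odot> f = G * f"
proof -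
  have "G \<odot> f = (\<Sum>k\<le>n. smult (coeff G k) ((tt ^^ k) f))"
    by (rule dp_mult_sum_bound) simp
  also have "\<dots> = (\<Sum>k\<le>n. monom (coeff G k) k * f + smult (coeff G k) (map_poly (\<delta> ^^ k) f))"
  proof (intro sum.cong refl)
    fix k
    show "smult (coeff G k) ((tt ^^ k) f) =
        monom (coeff G k) k * f + smult (coeff G k) (map_poly (\<delta> ^^ k) f)"
    proof (cases "coeff g k = 0")
      case False
      then obtain j where "k = p ^ j" using coeff_g_power by blast
      then show ?thesis
        by (simp add: tt_pow_prime_power smult_add_right smult_monom flip: mult_smult_left)
    qed simp
  qed
  also have "\<dots> = (\<Sum>k\<le>n. monom (coeff G k) k) * f"
  proof -
    have "(\<Sum>k\<le>n. smult (coeff G k) (map_poly (\<delta> ^^ k) f)) = 0"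
      by (intro poly_eqI) (simp add: coeff_sum coeff_map_poly g_annihilates)
    then show ?thesis by (simp add: sum.distrib sum_distrib_right)
  qed
  also have "(\<Sum>k\<le>n. monom (coeff G k) k) = G"
    by (rule poly_as_sum_of_monoms') simp
  finally show ?thesis .
qed

text \<open>Here u may have any coefficients in K. Hence R as a left K[x]-module is just K[t] with x
  acting as multiplication by g.\<close>

lemma pcompose_G_skew: "(u \<circ>\<^sub>p G) \<odot> f = (u \<circ>\<^sub>p G) * f"
proof (induction u arbitrary: f)
  case (pCons a u)
  have "(G * (u \<circ>\<^sub>p G)) \<odot> f = G \<odot> ((u \<circ>\<^sub>p G) \<odot> f)"
    by (simp add: skew_assoc flip: G_skew)
  then show ?case by (simp add: pcompose_pCons pCons.IH G_skew algebra_simps)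
qed simp

lemma pcompose_G_mult_skew: "((u \<circ>\<^sub>p G) * f) \<odot> q = (u \<circ>\<^sub>p G) * (f \<odot> q)"
  by (metis pcompose_G_skew skew_assoc)

lemma dd_pcompose_G: "dd (u \<circ>\<^sub>p G) = dd u \<circ>\<^sub>p G"
  by (induction u) (simp_all add: pcompose_pCons dd_mult)

abbreviation subst_G where "subst_G q \<equiv> map_poly \<iota> q \<circ>\<^sub>p G"

lemma dd_subst_G [simp]: "dd (subst_G q) = 0"
  by (simp add: dd_pcompose_G)

lemma subst_G_skew: "subst_G q \<odot> f = subst_G q * f" and skew_subst_G: "f \<odot> subst_G q = f * subst_G q"
  by (simp_all add: pcompose_G_skew skew_const_coeffs_right)

lemma subst_center_eq: "subst_center \<iota> \<delta> g q = subst_G q"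
proof -
  have pow: "G [^]\<^bsub>dp_ring \<delta>\<^esub> i = G ^ i" for i :: nat
    by (induction i) (simp_all add: nat_pow_def skew_const_coeffs_right dd_mult mult.commute G_skew)
  have "subst_G q = (\<Sum>i\<le>degree q. smult (\<iota> (coeff q i)) (G ^ i))"
    by (simp add: pcompose_altdef poly_altdef coeff_map_poly degree_map_poly)
  then show ?thesis by (simp add: subst_center_def pow)
qed

lemma subst_G_simps [simp]:
  "subst_G 0 = 0" "subst_G 1 = 1" "subst_G (q + r) = subst_G q + subst_G r"
  "subst_G (q - r) = subst_G q - subst_G r" "subst_G (q * r) = subst_G q * subst_G r"
  by (simp_all add: pcompose_add pcompose_diff pcompose_mult iota_poly.hom_add iota_poly.hom_mult
      iota_poly.hom_minus pcompose_1)

lemma degree_subst_G: "degree (subst_G q) = degree q * n"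
  by (simp add: degree_pcompose)

lemma subst_G_eq_0_iff [simp]: "subst_G q = 0 \<longleftrightarrow> q = 0"
proof -
  have "degree G > 0" by simp
  then show ?thesis using pcompose_eq_0[of "map_poly \<iota> q" G] by auto
qed

section \<open>The matrix representation\<close>

definition expands :: "'k poly \<Rightarrow> (nat \<Rightarrow> 'k poly) \<Rightarrow> bool" where
  "expands f q \<longleftrightarrow> f = (\<Sum>j<n. (q j \<circ>\<^sub>p G) * monom 1 j)"

text \<open>Repeated division by g in K[t]; the remainders supply the coefficients of the
  coordinates. As x^d t^j has leading term t^(nd + j), the coefficients of f from its degree upwards
  reappear unchanged; this clause later controls the degree of the determinant.\<close>

lemma expands_exists:
  "\<exists>q. expands f q \<and> (\<forall>j<n. \<forall>d. degree f \<le> n * d + j \<longrightarrow> coeff (q j) d = coeff f (n * d + j))"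
proof (induction "degree f" arbitrary: f rule: less_induct)
  case less
  show ?case
  proof (cases "degree f < n")
    case True
    have "expands f (\<lambda>j. [:coeff f j:])"
      unfolding expands_def using True
      by (intro poly_eqI) (auto simp: coeff_sum coeff_eq_0 smult_monom)
    moreover have "coeff [:coeff f j:] d = coeff f (n * d + j)" if "j < n" for j d
      using True that by (cases d) (auto simp: coeff_eq_0)
    ultimately show ?thesis by blast
  next
    case False
    define s r where "s = f div G" and "r = f mod G"
    have f: "f = s * G + r" unfolding s_def r_def by (rule div_mult_mod_eq[symmetric])
    have dr: "degree r < n" using degree_mod_less[of G f] False
      by (auto simp: r_def)
    have ds: "degree s + n = degree f" and s0: "s \<noteq> 0"
    proof -
      show "s \<noteq> 0" using f dr False by auto
      then have "degree (s * G) = degree s + n" by (simp add: degree_mult_eq)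
      then show "degree s + n = degree f"
        using dr unfolding f by (simp add: degree_add_eq_left)
    qed
    then have "degree s < degree f" using n_pos by linarith
    from less[OF this] obtain q where q: "expands s q"
      "\<And>j d. j < n \<Longrightarrow> degree s \<le> n * d + j \<Longrightarrow> coeff (q j) d = coeff s (n * d + j)" by blast
    have r: "r = (\<Sum>j<n. [:coeff r j:] * monom 1 j)"
      using dr by (intro poly_eqI) (auto simp: coeff_sum coeff_eq_0 smult_monom)
    let ?q = "\<lambda>j. pCons (coeff r j) (q j)"
    have "f = (\<Sum>j<n. [:coeff r j:] * monom 1 j) + G * (\<Sum>j<n. (q j \<circ>\<^sub>p G) * monom 1 j)"
      using f r q(1) by (simp add: expands_def mult.commute)
    then have "expands f ?q"
      unfolding expands_def
      by (simp add: pcompose_pCons sum.distrib sum_distrib_left distrib_right mult.assoc)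
    moreover have "coeff (?q j) d = coeff f (n * d + j)"
      if j: "j < n" and d: "degree f \<le> n * d + j" for j d
    proof (cases d)
      case 0
      then show ?thesis using j d False by auto
    next
      case (Suc d')
      have le: "degree s \<le> n * d' + j" using d ds Suc by simp
      have "coeff f (n * d + j) = coeff (s * G) ((n * d' + j) + n)"
        unfolding f using dr Suc by (simp add: coeff_eq_0 add_ac)
      also have "\<dots> = coeff s (n * d' + j)"
        using coeff_mult_degree_bounds[OF le, of G n] by simp
      finally show ?thesis using q(2)[OF j le] Suc by simp
    qed
    ultimately show ?thesis by blast
  qed
qed

text \<open>Splitting off the constant terms of all coordinates writes 0 as r + g s with deg r < n,
  which forces r = s = 0. The coefficients thus vanish one power of x at a time.\<close>

lemma expands_0_unique: "expands 0 q \<Longrightarrow> j < n \<Longrightarrow> q j = 0"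
proof -
  have "coeff (q j) d = 0" if "expands 0 q" "j < n" for q j d
    using that
  proof (induction d arbitrary: q j)
    have *: "\<exists>a q'. (\<forall>j. q j = pCons (a j) (q' j)) \<and> (\<forall>j<n. a j = 0) \<and> expands 0 q'"
      if exp: "expands 0 q" for q
    proof -
      have "\<forall>j. \<exists>a r. q j = pCons a r" by (metis pCons_cases)
      then obtain a q' where q: "\<And>j. q j = pCons (a j) (q' j)" by metis
      let ?r = "\<Sum>j<n. [:a j:] * monom 1 j" and ?s = "\<Sum>j<n. (q' j \<circ>\<^sub>p G) * monom 1 j"
      have 0: "?r + G * ?s = 0"
        using exp by (simp add: expands_def q pcompose_pCons sum.distrib sum_distrib_left
            distrib_right mult.assoc)
      have dr: "degree ?r < n"
        by (rule degree_lessI) (auto simp: coeff_sum smult_monom)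
      have "?s = 0"
      proof (rule ccontr)
        assume s: "?s \<noteq> 0"
        then have "degree (G * ?s) \<ge> n" by (simp add: degree_mult_eq)
        moreover have "G * ?s = - ?r" using 0 by (simp add: eq_neg_iff_add_eq_0 add.commute)
        ultimately show False using dr by simp
      qed
      moreover from this have "?r = 0" using 0 by simp
      then have "coeff ?r j = 0" for j by simp
      then have "(if j < n then a j else 0) = 0" for j by (simp add: coeff_sum smult_monom)
      then have "\<forall>j<n. a j = 0" by metis
      ultimately show ?thesis using q by (auto simp: expands_def)
    qed
    {
      case 0
      then show ?case using *[of q] by (metis coeff_pCons_0)
    next
      case (Suc d)
      then show ?case using *[of q] by (metis coeff_pCons_Suc)
    }
  qed
  then show "expands 0 q \<Longrightarrow> j < n \<Longrightarrow> q j = 0" by (intro poly_eqI) simp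
qed

definition rho :: "'k poly \<Rightarrow> nat \<Rightarrow> 'k poly" where
  "rho f = (SOME q. expands f q)"

lemma rho_expands: "f = (\<Sum>j<n. (rho f j \<circ>\<^sub>p G) * monom 1 j)"
proof -
  obtain q where "expands f q" using expands_exists by blast
  then show ?thesis unfolding rho_def using someI[of "expands f" q] by (simp add: expands_def)
qed

lemma rho_eqI:
  assumes "f = (\<Sum>j<n. (q j \<circ>\<^sub>p G) * monom 1 j)" "j < n"
  shows "rho f j = q j"
proof -
  have "(\<Sum>j<n. (rho f j \<circ>\<^sub>p G) * monom 1 j) = (\<Sum>j<n. (q j \<circ>\<^sub>p G) * monom 1 j)"
    using rho_expands[of f] assms(1) by simp
  then have "expands 0 (\<lambda>j. rho f j - q j)"
    by (simp add: expands_def pcompose_diff left_diff_distrib sum_subtractf)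
  then show ?thesis using expands_0_unique assms(2) by fastforce
qed

lemma rho_coeff:
  assumes "j < n" "degree f \<le> n * d + j"
  shows "coeff (rho f j) d = coeff f (n * d + j)"
proof -
  obtain q where "expands f q"
    "\<forall>j<n. \<forall>d. degree f \<le> n * d + j \<longrightarrow> coeff (q j) d = coeff f (n * d + j)"
    using expands_exists by blast
  then show ?thesis using rho_eqI[of f q j] assms by (simp add: expands_def)
qed

lemma rho_add: "j < n \<Longrightarrow> rho (f + f') j = rho f j + rho f' j"
  by (rule rho_eqI)
     (simp_all add: pcompose_add distrib_right sum.distrib flip: rho_expands)

lemma rho_0: "j < n \<Longrightarrow> rho 0 j = 0"
  by (rule rho_eqI) simp_all

lemma rho_mult: "j < n \<Longrightarrow> rho ((u \<circ>\<^sub>p G) * f) j = u * rho f j"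
  by (rule rho_eqI)
     (simp_all add: pcompose_mult mult.assoc flip: sum_distrib_left rho_expands)

lemma rho_sum: "j < n \<Longrightarrow> rho (sum F A) j = (\<Sum>i\<in>A. rho (F i) j)"
  by (induction A rule: infinite_finite_induct) (simp_all add: rho_0 rho_add)

lemma rho_monom: "i < n \<Longrightarrow> j < n \<Longrightarrow> rho (monom a i) j = (if i = j then [:a:] else 0)"
proof (rule rho_eqI)
  assume "i < n"
  have "(\<Sum>j<n. ((if i = j then [:a:] else 0) \<circ>\<^sub>p G) * monom 1 j) =
      (\<Sum>j<n. if i = j then monom a i else 0)"
    by (intro sum.cong) (auto simp: smult_monom)
  then show "monom a i = (\<Sum>j<n. ((if i = j then [:a:] else 0) \<circ>\<^sub>p G) * monom 1 j)"
    using \<open>i < n\<close> by simp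
qed

text \<open>Row i holds the coordinates of t^i f. Coordinates as rows make right multiplication a
  homomorphism and not an antihomomorphism.\<close>

definition Psi :: "'k poly \<Rightarrow> 'k poly mat" where
  "Psi f = mat n n (\<lambda>(i, j). rho (monom 1 i \<odot> f) j)"

lemma Psi_carrier [simp]: "Psi f \<in> carrier_mat n n"
  by (simp add: Psi_def)

lemma Psi_index: "i < n \<Longrightarrow> j < n \<Longrightarrow> Psi f $$ (i, j) = rho (monom 1 i \<odot> f) j"
  by (simp add: Psi_def)

lemma Psi_row: "i < n \<Longrightarrow> monom 1 i \<odot> f = (\<Sum>j<n. (Psi f $$ (i, j) \<circ>\<^sub>p G) * monom 1 j)"
  by (subst rho_expands) (simp add: Psi_index)

lemma Psi_mult: "Psi (f \<odot> f') = Psi f * Psi f'"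
proof (rule eq_matI)
  fix i k assume "i < dim_row (Psi f * Psi f')" "k < dim_col (Psi f * Psi f')"
  then have ik: "i < n" "k < n" by (auto simp: Psi_def)
  have "Psi (f \<odot> f') $$ (i, k) = rho ((monom 1 i \<odot> f) \<odot> f') k"
    using ik by (simp add: Psi_index skew_assoc)
  also have "\<dots> = rho (\<Sum>j<n. (Psi f $$ (i, j) \<circ>\<^sub>p G) * (monom 1 j \<odot> f')) k"
    using ik by (simp only: Psi_row skew_sum_left pcompose_G_mult_skew)
  also have "\<dots> = (Psi f * Psi f') $$ (i, k)"
    using ik by (simp add: rho_sum rho_mult index_mult_mat_sum[OF Psi_carrier Psi_carrier]
        Psi_index del: index_mult_mat)
  finally show "Psi (f \<odot> f') $$ (i, k) = (Psi f * Psi f') $$ (i, k)" .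
qed (auto simp: Psi_def)

lemma Psi_pcompose_G:
  assumes "dd u = 0"
  shows "Psi (u \<circ>\<^sub>p G) = u \<cdot>\<^sub>m 1\<^sub>m n"
proof (rule eq_matI)
  fix i j assume "i < dim_row (u \<cdot>\<^sub>m 1\<^sub>m n)" "j < dim_col (u \<cdot>\<^sub>m 1\<^sub>m n)"
  then have ij: "i < n" "j < n" by auto
  have "dd (u \<circ>\<^sub>p G) = 0" using assms by (simp add: dd_pcompose_G)
  then show "Psi (u \<circ>\<^sub>p G) $$ (i, j) = (u \<cdot>\<^sub>m 1\<^sub>m n) $$ (i, j)"
    using ij by (simp add: Psi_index skew_const_coeffs_right rho_mult rho_monom
        mult.commute[of "monom 1 i"])
qed (auto simp: Psi_def)

lemma Psi_1 [simp]: "Psi 1 = 1\<^sub>m n"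
  using Psi_pcompose_G[of 1] by (simp add: pcompose_1) (auto intro: eq_matI)

text \<open>Moving t past a coefficient u in K[x] gives t u = u t + \<delta>(u): the coordinates are
  multiplied by the matrix of t and, in addition, differentiated.\<close>

lemma rho_tt:
  assumes k: "k < n"
  shows "rho (tt f) k = (\<Sum>j<n. rho f j * rho (tt (monom 1 j)) k) + dd (rho f k)"
proof -
  have "tt f = tt (\<Sum>j<n. (rho f j \<circ>\<^sub>p G) * monom 1 j)" using rho_expands by simp
  also have "\<dots> = (\<Sum>j<n. tt ((rho f j \<circ>\<^sub>p G) * monom 1 j))"
    by (rule tt_sum)
  also have "\<dots> = (\<Sum>j<n. (rho f j \<circ>\<^sub>p G) * tt (monom 1 j)) + (\<Sum>j<n. (dd (rho f j) \<circ>\<^sub>p G) * monom 1 j)"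
    by (simp add: tt_mult sum.distrib dd_pcompose_G)
  finally have tf: "tt f = \<dots>" .
  have "rho (\<Sum>j<n. (dd (rho f j) \<circ>\<^sub>p G) * monom 1 j) k = dd (rho f k)"
    using k by (intro rho_eqI) auto
  then show ?thesis
    unfolding tf using k by (simp add: rho_add rho_sum rho_mult)
qed

lemma tt_monom: "tt (monom 1 i) = monom 1 (Suc i)"
proof -
  have "dd (monom 1 i) = 0" by (intro poly_eqI) (simp add: coeff_map_poly)
  then show ?thesis by (simp add: t_times_def monom_Suc)
qed

lemma tt_skew_commute: "monom 1 i \<odot> tt f = tt (monom 1 i \<odot> f)"
  by (simp add: skew_monom_left funpow_swap1)

lemma monom_1_skew: "monom 1 1 \<odot> f = tt f"
  by (simp add: skew_monom_left)

text \<open>Left multiplication by \<open>t\<close> is only semilinear over \<open>K[x]\<close> but commutes with right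
  multiplication by \<open>f\<close>.\<close>

lemma dd_det_Psi: "dd (det (Psi f)) = 0"
proof (rule derivation_det_commutator[where D = dd and T = "Psi (monom 1 1)" and n = n])
  fix i k assume ik: "i < n" "k < n"
  have "(Psi (monom 1 1) * Psi f) $$ (i, k) = rho (tt (monom 1 i \<odot> f)) k"
    using ik by (simp add: Psi_index monom_1_skew tt_skew_commute flip: Psi_mult del: One_nat_def)
  also have "\<dots> = (\<Sum>j<n. Psi f $$ (i, j) * rho (tt (monom 1 j)) k) + dd (Psi f $$ (i, k))"
    using ik by (simp add: rho_tt Psi_index)
  also have "(\<Sum>j<n. Psi f $$ (i, j) * rho (tt (monom 1 j)) k) = (Psi f * Psi (monom 1 1)) $$ (i, k)"
  proof -
    have "monom 1 j \<odot> monom 1 1 = tt (monom 1 j)" for j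
      using tt_skew_commute[of j 1] by (simp add: tt_monom[of 0, simplified, folded monom_0 one_pCons] monom_0)
    then show ?thesis
      using ik by (simp add: index_mult_mat_sum[OF Psi_carrier Psi_carrier] Psi_index
          del: index_mult_mat One_nat_def)
  qed
  finally show "(Psi (monom 1 1) * Psi f) $$ (i, k) =
      (Psi f * Psi (monom 1 1)) $$ (i, k) + dd (Psi f $$ (i, k))" .
qed (simp_all add: dd_mult)

text \<open>The preimage of the determinant in F[x]. It exists by \<open>dd_det_Psi\<close> and is
  unique because \<iota> is injective; \<open>dp_norm_eq\<close> identifies it with the reduced
  norm.\<close>

definition Nm :: "'k poly \<Rightarrow> 'f poly" where
  "Nm f = (SOME r. det (Psi f) = map_poly \<iota> r)"

lemma Nm: "map_poly \<iota> (Nm f) = det (Psi f)"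
  using someI_ex[of "\<lambda>r. det (Psi f) = map_poly \<iota> r"] dd_det_Psi[of f]
  by (simp add: dd_eq_0_iff Nm_def)

lemma Nm_eqI: "map_poly \<iota> r = det (Psi f) \<Longrightarrow> Nm f = r"
  using Nm[of f] by (metis iota_poly.eq_iff)

lemma Nm_mult: "Nm (f \<odot> f') = Nm f * Nm f'"
  by (rule Nm_eqI) (simp add: Psi_mult det_mult[OF Psi_carrier Psi_carrier] Nm iota_poly.hom_mult)

lemma Nm_1 [simp]: "Nm 1 = 1"
  by (rule Nm_eqI) simp

text \<open>Row 0 of adj(\<open>Psi f\<close>) \<open>Psi f\<close> is (det, 0, ..., 0). Read as
  coordinates, row 0 of the adjugate is therefore an element s for which s f is the determinant
  evaluated at g(t).\<close>

lemma subst_G_Nm: "\<exists>s. subst_G (Nm f) = s \<odot> f"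
proof -
  let ?A = "adj_mat (Psi f)"
  note adj = adj_mat[OF Psi_carrier, of f]
  let ?s = "\<Sum>j<n. (?A $$ (0, j) \<circ>\<^sub>p G) * monom 1 j"
  have "?s \<odot> f = (\<Sum>j<n. (?A $$ (0, j) \<circ>\<^sub>p G) * (\<Sum>k<n. (Psi f $$ (j, k) \<circ>\<^sub>p G) * monom 1 k))"
    by (simp add: skew_sum_left pcompose_G_mult_skew Psi_row)
  also have "\<dots> = (\<Sum>k<n. ((\<Sum>j<n. ?A $$ (0, j) * Psi f $$ (j, k)) \<circ>\<^sub>p G) * monom 1 k)"
    by (simp add: sum_distrib_left sum_distrib_right pcompose_sum pcompose_mult mult.assoc)
       (rule sum.swap)
  also have "\<dots> = (\<Sum>k<n. if k = 0 then det (Psi f) \<circ>\<^sub>p G else 0)"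
    using adj(3)
    by (intro sum.cong refl)
       (auto simp: monom_0 one_pCons simp flip: index_mult_mat_sum[OF adj(1) Psi_carrier])
  also have "\<dots> = subst_G (Nm f)" by (simp add: Nm)
  finally show ?thesis by metis
qed


text \<open>The leading coefficient of \<open>det \<Psi>(f)\<close> for monic \<open>f\<close> of degree \<open>m\<close>. It is \<open>u\<^sup>m\<close> for some \<open>u\<close>,
  and \<open>\<Psi>(x) = x\<close> gives \<open>u\<^sup>n = 1\<close>, whence \<open>u = 1\<close> in characteristic \<open>p\<close>.\<close>

definition top_sign :: "nat \<Rightarrow> 'k" where
  "top_sign m = (\<Sum>q | q permutes {0..<n}.
     signof q * (if \<forall>i<n. \<exists>d. n * d + q i = m + i then 1 else 0))"

text \<open>As t^i f has degree m + i, entry (i, j) has x-degree at most (m + i - j) / n, with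
  coefficient 1 there if the quotient is an exact natural number. Along a permutation these bounds
  add up to m. So x^m arises only from permutations for which all quotients are exact, a condition
  that depends on m alone.\<close>

lemma det_Psi_top:
  assumes f: "lead_coeff f = 1" and m: "degree f = m"
  shows "degree (det (Psi f)) \<le> m" and "coeff (det (Psi f)) m = top_sign m"
proof -
  have f0: "f \<noteq> 0" using f by auto
  have deg: "degree (monom 1 i \<odot> f) = m + i" for i
    using degree_tt_pow[OF f0, of i] m by (simp add: skew_monom_left)
  have lc: "coeff (monom 1 i \<odot> f) (m + i) = 1" for i
    using degree_tt_pow[OF f0, of i] f deg[of i] by (simp add: skew_monom_left) (metis)
  have P: "coeff (Psi f $$ (i, j)) d = (if n * d + j = m + i then 1 else 0)"
    if "i < n" "j < n" "m + i \<le> n * d + j" for i j d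
    using that deg lc by (auto simp: Psi_index rho_coeff coeff_eq_0)
  have main: "degree (\<Prod>i = 0..<n. Psi f $$ (i, q i)) \<le> m \<and>
      coeff (\<Prod>i = 0..<n. Psi f $$ (i, q i)) m =
        (if \<forall>i<n. \<exists>d. n * d + q i = m + i then 1 else 0)"
    if q: "q permutes {0..<n}" for q
  proof (cases "\<exists>i<n. m + i < q i")
    case True
    then obtain i where i: "i < n" "m + i < q i" by blast
    have qi: "q i < n" using permutes_in_image[OF q] i by auto
    \<comment> \<open>Every n d + q i exceeds the degree m + i of t^i f.\<close>
    have "Psi f $$ (i, q i) = 0"
      using P[OF i(1) qi] i by (intro poly_eqI) simp
    then have z: "(\<Prod>i = 0..<n. Psi f $$ (i, q i)) = 0"
      using i by (intro prod_zero) auto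
    have "\<not> (\<forall>i<n. \<exists>d. n * d + q i = m + i)"
      using i by (metis not_add_less2)
    then show ?thesis unfolding z by simp
  next
    case False
    define D where "D i = (m + i - q i) div n" for i
    have qn: "q i < n" if "i < n" for i using permutes_in_image[OF q] that by auto
    have Dle: "n * D i \<le> m + i - q i" for i
      unfolding D_def by (rule times_div_less_eq_dividend)
    have Dgt: "m + i - q i < n * Suc (D i)" for i
      unfolding D_def using n_pos by (metis dividend_less_times_div mult_Suc_right)
    have degP: "degree (Psi f $$ (i, q i)) \<le> D i" if "i \<in> {0..<n}" for i
    proof (rule degree_le, intro allI impI)
      fix d assume "D i < d"
      then have "n * Suc (D i) \<le> n * d" by (intro mult_le_mono2) simp
      then have "m + i - q i < n * d" using Dgt[of i] by linarith
      then show "coeff (Psi f $$ (i, q i)) d = 0" using P[of i "q i" d] that qn[of i] by simp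
    qed
    note prod = coeff_prod_degree_bounds[of "{0..<n}" "\<lambda>i. Psi f $$ (i, q i)" D, OF _ degP, simplified]
    have sum_eq: "(\<Sum>i = 0..<n. m + i - q i) = n * m"
    proof -
      have "(\<Sum>i = 0..<n. m + i - q i) + (\<Sum>i = 0..<n. q i) = (\<Sum>i = 0..<n. m + i)"
        unfolding sum.distrib[symmetric] using False
        by (intro sum.cong refl le_add_diff_inverse2) (meson atLeastLessThan_iff not_less)
      moreover have "(\<Sum>i = 0..<n. q i) = (\<Sum>i = 0..<n. i)"
        using sum.permute[OF q, of "\<lambda>i. i"] by (simp add: comp_def)
      ultimately show ?thesis by (simp add: sum.distrib)
    qed
    have sum_le: "n * sum D {0..<n} \<le> n * m"
      unfolding sum_distrib_left sum_eq[symmetric] by (intro sum_mono Dle)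
    then have D_le: "sum D {0..<n} \<le> m" using n_pos by simp
    have degle: "degree (\<Prod>i = 0..<n. Psi f $$ (i, q i)) \<le> m"
      using prod(1) D_le by linarith
    show ?thesis
    proof (cases "\<forall>i<n. \<exists>d. n * d + q i = m + i")
      case True
      have nD: "n * D i + q i = m + i" if i: "i < n" for i
      proof -
        obtain d where d: "n * d + q i = m + i" using True i by blast
        then have "m + i - q i = n * d" by linarith
        then have "D i = d" unfolding D_def using n_pos by simp
        then show ?thesis using d by simp
      qed
      then have "m + i - q i = n * D i" if "i < n" for i using nD[OF that] by linarith
      then have "n * sum D {0..<n} = n * m"
        unfolding sum_distrib_left sum_eq[symmetric] by (intro sum.cong) auto
      then have "sum D {0..<n} = m" using n_pos by simp
      moreover have "coeff (Psi f $$ (i, q i)) (D i) = 1" if "i < n" for i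
        using P[OF that qn[OF that], of "D i"] nD[OF that] by simp
      ultimately show ?thesis using prod(2) True degle by simp
    next
      case nall: False
      \<comment> \<open>One inexact quotient loses something in rounding down, so the degree bounds
        sum to less than m.\<close>
      then obtain i where i: "i < n" "\<And>d. n * d + q i \<noteq> m + i" by blast
      have "\<not> m + i < q i" using False i(1) by blast
      then have "n * D i < m + i - q i"
        using Dle[of i] i(2)[of "D i"] by linarith
      then have "(\<Sum>i = 0..<n. n * D i) < (\<Sum>i = 0..<n. m + i - q i)"
        using i(1) Dle by (intro sum_strict_mono_ex1) auto
      then have "n * sum D {0..<n} < n * m" by (simp add: sum_eq sum_distrib_left)
      then have "sum D {0..<n} < m" by simp
      then have "coeff (\<Prod>i = 0..<n. Psi f $$ (i, q i)) m = 0"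
        using prod(1) by (intro coeff_eq_0) linarith
      then show ?thesis using degle nall by simp
    qed
  qed
  have sg: "degree (signof q * u) \<le> degree u" "coeff (signof q * u) d = signof q * coeff u d"
    for q :: "nat \<Rightarrow> nat" and u :: "'k poly" and d
    by (simp_all add: sign_def)
  show "degree (det (Psi f)) \<le> m"
    unfolding det_def'[OF Psi_carrier]
  proof (rule degree_sum_le)
    fix q assume "q \<in> {q. q permutes {0..<n}}"
    then show "degree (signof q * (\<Prod>i = 0..<n. Psi f $$ (i, q i))) \<le> m"
      using main[of q] order_trans[OF sg(1)] by blast
  qed (simp add: finite_permutations)
  show "coeff (det (Psi f)) m = top_sign m"
    unfolding det_def'[OF Psi_carrier] top_sign_def coeff_sum sg(2)
    by (intro sum.cong refl) (use main in simp)
qed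

text \<open>Since \<open>top_sign m\<close> is the same for all monic f of degree m, it can be read
  off from f = t^m, where the norm is multiplicative.\<close>

lemma top_sign_power: "top_sign m = top_sign 1 ^ m"
proof -
  have 1: "monom 1 0 = (1 :: 'k poly)" by (simp add: monom_0 one_pCons)
  have mm: "monom 1 (Suc m) = monom 1 m \<odot> monom 1 1" for m
    using tt_skew_commute[of m 1] unfolding tt_monom[of 0, unfolded 1] skew_1_right tt_monom by simp
  have "Nm (monom 1 m) = Nm (monom 1 1) ^ m" for m
  proof (induction m)
    case 0
    then show ?case by (simp add: 1)
  next
    case (Suc m)
    then show ?case using Nm_mult[of "monom 1 m" "monom 1 1"] by (simp only: mm[of m] power_Suc2)
  qed
  then have "map_poly \<iota> (Nm (monom 1 m)) = map_poly \<iota> (Nm (monom 1 1) ^ m)"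
    by (rule arg_cong)
  then have det: "det (Psi (monom 1 m)) = det (Psi (monom 1 1)) ^ m"
    by (simp only: iota_poly.hom_power Nm)
  have lc: "lead_coeff (monom (1 :: 'k) m) = 1" "degree (monom (1 :: 'k) m) = m" for m
    by (simp_all add: Polynomial.degree_monom_eq)
  have "coeff (prod (\<lambda>_. det (Psi (monom 1 1))) {..<m}) (\<Sum>i<m. 1) =
      (\<Prod>i<m. coeff (det (Psi (monom 1 1))) 1)"
    by (rule coeff_prod_degree_bounds) (use det_Psi_top(1)[OF lc] in auto)
  then show ?thesis
    using det_Psi_top(2)[OF lc(1)[of m] lc(2)] det_Psi_top(2)[OF lc(1)[of 1] lc(2)] det by simp
qed

lemma top_sign_1: "top_sign m = 1"
proof -
  have "Psi G = [:0, 1:] \<cdot>\<^sub>m 1\<^sub>m n"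
    using Psi_pcompose_G[of "[:0, 1:]"] by (simp add: pcompose_pCons)
  then have "det (Psi G) = monom 1 n"
    by (simp add: monom_altdef)
  moreover have "coeff (det (Psi G)) n = top_sign n"
    by (rule det_Psi_top) simp_all
  ultimately have s: "top_sign 1 ^ n = 1" using top_sign_power[of n] by simp
  have "(top_sign 1 - 1 + 1) ^ n = (top_sign 1 - 1) ^ n + 1 ^ n"
    by (rule freshmans_dream'[of _ e]) (simp_all add: char_K prime_p n_def)
  then have "(top_sign 1 - 1) ^ n = 0" using s by simp
  then show ?thesis using top_sign_power[of m] by simp
qed

lemma degree_Nm: "lead_coeff f = 1 \<Longrightarrow> degree (Nm f) = degree f"
  and lead_coeff_Nm: "lead_coeff f = 1 \<Longrightarrow> lead_coeff (Nm f) = 1"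
proof -
  assume f: "lead_coeff f = 1"
  have "degree (Nm f) \<le> degree f"
    using det_Psi_top(1)[OF f refl] by (simp flip: Nm)
  moreover have c: "coeff (Nm f) (degree f) = 1"
    using det_Psi_top(2)[OF f refl] by (simp add: top_sign_1 flip: Nm)
  moreover from c have "degree f \<le> degree (Nm f)" by (intro le_degree) simp
  ultimately show d: "degree (Nm f) = degree f" by simp
  show "lead_coeff (Nm f) = 1" using c d by simp
qed

end

section \<open>Factorizations\<close>

lemma monic_eq_1_if_degree_0: "lead_coeff u = 1 \<Longrightarrow> degree u = 0 \<Longrightarrow> u = (1 :: 'a::comm_semiring_1 poly)"
  by (metis degree_0_id one_pCons)

lemma monic_irreducible_dvd_eq:
  fixes u v :: "'a::field poly"
  assumes "Factorial_Ring.irreducible v" "lead_coeff v = 1" "lead_coeff u = 1" "degree u > 0" "u dvd v"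
  shows "u = v"
proof -
  obtain z where z: "v = u * z" using assms(5) by blast
  have "\<not> is_unit u" using assms(4) by (simp add: is_unit_iff_degree)
  then have "is_unit z" using assms(1) z by (metis irreducibleD)
  then have "degree z = 0" by (simp add: poly_dvd_1)
  moreover have "lead_coeff z = 1" using z assms(2,3) by (simp add: lead_coeff_mult)
  ultimately have "z = 1" by (rule monic_eq_1_if_degree_0[rotated])
  then show ?thesis using z by simp
qed

lemma prime_elem_dvd_prod_list:
  assumes "prime_elem (u :: 'a::comm_semiring_1)" "u dvd prod_list us"
  shows "\<exists>v\<in>set us. u dvd v"
  using assms(2)
proof (induction us)
  case Nil
  then show ?case using assms(1) by (simp add: prime_elem_def)
next
  case (Cons v us)
  then show ?case using prime_elem_dvd_multD[OF assms(1)] by fastforce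
qed

lemma irreducible_degree_pos: "Factorial_Ring.irreducible (u :: 'a::field poly) \<Longrightarrow> degree u > 0"
  by (metis irreducible_def is_unit_iff_degree neq0_conv)

text \<open>Among monic irreducible polynomials divisibility is equality, so the factors agree as
  multisets and not merely up to units.\<close>

lemma monic_irreducible_factorization_unique:
  fixes us vs :: "'a::field poly list"
  assumes "\<And>u. u \<in> set us \<Longrightarrow> Factorial_Ring.irreducible u \<and> lead_coeff u = 1"
    and "\<And>u. u \<in> set vs \<Longrightarrow> Factorial_Ring.irreducible u \<and> lead_coeff u = 1"
    and "prod_list us = prod_list vs"
  shows "mset us = mset vs"
  using assms
proof (induction us arbitrary: vs)
  case Nil
  show ?case
  proof (cases vs)
    case (Cons v ws)
    then have "v dvd 1" using Nil.prems(3) by (metis dvd_triv_left prod_list.Cons prod_list.Nil)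
    then show ?thesis using Nil.prems(2)[of v] Cons irreducible_not_unit[of v] by auto
  qed simp
next
  case (Cons u us)
  have u: "Factorial_Ring.irreducible u" "lead_coeff u = 1" using Cons.prems(1) by auto
  have "u dvd prod_list vs" using Cons.prems(3) by (metis dvd_triv_left prod_list.Cons)
  then have "\<exists>v\<in>set vs. u dvd v"
    by (rule prime_elem_dvd_prod_list[OF field_poly_irreducible_imp_prime[OF u(1)]])
  then obtain v where v: "v \<in> set vs" "u dvd v" ..
  then have uv: "u = v"
    using monic_irreducible_dvd_eq[OF _ _ u(2) irreducible_degree_pos[OF u(1)]] Cons.prems(2) by simp
  have p: "prod_list vs = u * prod_list (remove1 u vs)"
    using v(1) unfolding uv[symmetric] by (induction vs) (auto simp: ac_simps)
  have "u \<noteq> 0" using u by auto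
  then have "prod_list us = prod_list (remove1 u vs)" using Cons.prems(3) p by simp
  then have "mset us = mset (remove1 u vs)"
    using Cons.prems by (intro Cons.IH) (auto dest: notin_set_remove1 set_remove1_subset[THEN subsetD])
  then show ?case using v uv by simp
qed

section \<open>Central left multiples of minimal degree\<close>

context algebraic_dp
begin

text \<open>The degree condition on the minimal central left multiple, as a lower bound for all
  nonzero central left multiples. \<open>Nm f\<close> attains it, and in this form it is inherited
  by factors.\<close>

definition has_full_bound :: "'k poly \<Rightarrow> bool" where
  "has_full_bound f \<longleftrightarrow> lead_coeff f = 1 \<and> (\<forall>q s. q \<noteq> 0 \<longrightarrow> subst_G q = s \<odot> f \<longrightarrow> degree f \<le> degree q)"

lemma full_bound_monic: "has_full_bound f \<Longrightarrow> lead_coeff f = 1"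
  by (simp add: has_full_bound_def)

text \<open>The remainder of q modulo \<open>Nm f\<close> is again a central left multiple of f, and
  its degree is below the bound unless it is 0.\<close>

lemma Nm_dvd_if_full_bound:
  assumes f: "has_full_bound f" and q: "subst_G q = s \<odot> f"
  shows "Nm f dvd q"
proof -
  obtain u where u: "subst_G (Nm f) = u \<odot> f" using subst_G_Nm by blast
  have "subst_G (q mod Nm f) = subst_G q - subst_G (q div Nm f) * subst_G (Nm f)"
    by (simp add: minus_div_mult_eq_mod flip: subst_G_simps)
  also have "\<dots> = (s - subst_G (q div Nm f) \<odot> u) \<odot> f"
    by (simp add: q u skew_assoc flip: subst_G_skew)
  finally have r: "subst_G (q mod Nm f) = (s - subst_G (q div Nm f) \<odot> u) \<odot> f" .
  have "q mod Nm f = 0"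
  proof (rule ccontr)
    assume nz: "q mod Nm f \<noteq> 0"
    have "Nm f \<noteq> 0" using lead_coeff_Nm[OF full_bound_monic[OF f]] by auto
    then have "degree (q mod Nm f) < degree (Nm f)"
      using nz degree_mod_less by blast
    moreover have "degree f \<le> degree (q mod Nm f)"
      using f nz r unfolding has_full_bound_def by blast
    ultimately show False using degree_Nm[OF full_bound_monic[OF f]] by simp
  qed
  then show ?thesis by (rule mod_0_imp_dvd)
qed

lemma subst_G_commute: "subst_G q \<odot> f = f \<odot> subst_G q"
  by (simp add: subst_G_skew skew_subst_G mult.commute)

text \<open>The product s a is central, so v (s a) b = (v b)(s a).\<close>

lemma left_multiple_product:
  assumes "subst_G q = s \<odot> a" "subst_G r = v \<odot> b"
  shows "subst_G (q * r) = (v \<odot> s) \<odot> (a \<odot> b)"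
proof -
  have "(v \<odot> s) \<odot> (a \<odot> b) = v \<odot> (subst_G q \<odot> b)"
    by (simp add: assms(1) skew_assoc)
  also have "\<dots> = (v \<odot> b) \<odot> subst_G q"
    by (simp only: subst_G_commute skew_assoc)
  also have "\<dots> = subst_G (q * r)" by (simp add: skew_subst_G flip: assms(2))
  finally show ?thesis ..
qed

text \<open>A central left multiple of a of degree below deg a, multiplied by \<open>Nm b\<close>,
  would be one of a b of degree below deg a + deg b; likewise with a and b exchanged.\<close>

lemma full_bound_factors:
  assumes f: "has_full_bound (a \<odot> b)" and a: "lead_coeff a = 1" and b: "lead_coeff b = 1"
  shows "has_full_bound a" and "has_full_bound b"
proof -
  have nz: "a \<noteq> 0" "b \<noteq> 0" "Nm a \<noteq> 0" "Nm b \<noteq> 0"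
    using a b lead_coeff_Nm[OF a] lead_coeff_Nm[OF b] by auto
  have le: "degree a + degree b \<le> degree q" if "q \<noteq> 0" "subst_G q = s \<odot> (a \<odot> b)" for q s
    using f that nz unfolding has_full_bound_def by (metis degree_skew)
  obtain u v where u: "subst_G (Nm a) = u \<odot> a" and v: "subst_G (Nm b) = v \<odot> b"
    using subst_G_Nm by metis
  have "degree a \<le> degree q" if "q \<noteq> 0" "subst_G q = s \<odot> a" for q s
    using le[OF _ left_multiple_product[OF that(2) v]] that nz degree_Nm[OF b]
    by (simp add: degree_mult_eq)
  then show "has_full_bound a" using a by (auto simp: has_full_bound_def)
  have "degree b \<le> degree q" if "q \<noteq> 0" "subst_G q = s \<odot> b" for q s
    using le[OF _ left_multiple_product[OF u that(2)]] that nz degree_Nm[OF a]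
    by (simp add: degree_mult_eq)
  then show "has_full_bound b" using b by (auto simp: has_full_bound_def)
qed

text \<open>d is the greatest common right divisor of f and k(g(t)). It inherits the full bound, so
  its norm divides k. It is not 1, for otherwise the cofactor of k in \<open>Nm f\<close> would
  already give a central left multiple of f of degree below deg f.\<close>

lemma split_right_factor:
  assumes f: "has_full_bound f" and k: "Factorial_Ring.irreducible k" "lead_coeff k = 1" "k dvd Nm f"
  obtains f' d where "f = f' \<odot> d" "lead_coeff f' = 1" "lead_coeff d = 1" "Nm d = k"
proof -
  have f1: "lead_coeff f = 1" and f0: "f \<noteq> 0" using full_bound_monic[OF f] by auto
  obtain d a b f' h' where d: "lead_coeff d = 1" "d = a \<odot> f + b \<odot> subst_G k" "f = f' \<odot> d"
      "subst_G k = h' \<odot> d"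
    by (rule bezout_right[OF f0, where h = "subst_G k"])
  have f': "lead_coeff f' = 1" using f1 d(1) unfolding d(3) lead_coeff_skew by simp
  have full_d: "has_full_bound d" using full_bound_factors[OF _ f' d(1)] f d(3) by simp
  have "degree d > 0"
  proof (rule ccontr)
    assume "\<not> degree d > 0"
    then have d1: "1 = a \<odot> f + b \<odot> subst_G k" using d(1,2) monic_eq_1_if_degree_0[of d] by simp
    obtain r where r: "Nm f = k * r" using k(3) by blast
    obtain u where u: "subst_G (Nm f) = u \<odot> f" using subst_G_Nm by blast
    have r0: "r \<noteq> 0" and k0: "k \<noteq> 0" using r lead_coeff_Nm[OF f1] by auto
    \<comment> \<open>Multiply the Bezout identity by r(g(t)): the second term becomes b k(g(t))
      r(g(t)), a left multiple of f because k r = \<open>Nm f\<close>.\<close>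
    have "subst_G r = subst_G r \<odot> (a \<odot> f + b \<odot> subst_G k)" using d1 by simp
    also have "\<dots> = (subst_G r \<odot> a) \<odot> f + b \<odot> (subst_G k * subst_G r)"
      unfolding skew_add_right subst_G_commute[of r "b \<odot> subst_G k"] skew_assoc
      by (simp only: skew_subst_G[of "subst_G k"])
    also have "subst_G k * subst_G r = u \<odot> f" using u by (simp add: r)
    finally have "subst_G r = (subst_G r \<odot> a + b \<odot> u) \<odot> f"
      unfolding skew_add_left skew_assoc .
    then have "degree f \<le> degree r" using f r0 unfolding has_full_bound_def by blast
    moreover have "degree f = degree k + degree r"
      using degree_Nm[OF f1] r r0 k0 by (simp add: degree_mult_eq)
    ultimately show False using irreducible_degree_pos[OF k(1)] by simp
  qed
  then have "Nm d = k"
    using monic_irreducible_dvd_eq[OF k(1,2) lead_coeff_Nm[OF d(1)]] Nm_dvd_if_full_bound[OF full_d d(4)]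
      degree_Nm[OF d(1)] by simp
  then show ?thesis using that d(1,3) f' by blast
qed

section \<open>Irreducible factors and decompositions\<close>

lemma not_unit_if_degree_pos:
  assumes "degree f > 0"
  shows "f \<notin> Units (dp_ring \<delta>)"
proof
  assume "f \<in> Units (dp_ring \<delta>)"
  then obtain a where a: "a \<odot> f = 1" by (auto simp: Units_def)
  then have "a \<noteq> 0" "f \<noteq> 0" by auto
  then have "degree a + degree f = 0" using degree_skew[of a f] a by simp
  then show False using assms by simp
qed

lemma dp_irreducible_if_irreducible_Nm:
  assumes d: "lead_coeff d = 1" and irr: "Factorial_Ring.irreducible (Nm d)"
  shows "dp_irreducible \<delta> d"
  unfolding dp_irreducible_def
proof (intro conjI notI)
  have "degree d > 0" using irreducible_degree_pos[OF irr] degree_Nm[OF d] by simp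
  then show "d \<in> Units (dp_ring \<delta>) \<Longrightarrow> False" using not_unit_if_degree_pos by blast
  assume "\<exists>q r. d = q \<otimes>\<^bsub>dp_ring \<delta>\<^esub> r \<and> 1 \<le> degree q \<and> degree q < degree d \<and>
      1 \<le> degree r \<and> degree r < degree d"
  then obtain q r where qr: "d = q \<odot> r" "1 \<le> degree q" "1 \<le> degree r" by auto
  \<comment> \<open>The leading coefficient of r is moved into q, so that both factors are monic and
    their norms have known degrees.\<close>
  define z where "z = lead_coeff r"
  have z0: "z \<noteq> 0" using qr(3) by (auto simp: z_def)
  define r1 q1 where "r1 = smult (inverse z) r" and "q1 = q \<odot> [:z:]"
  have d1: "d = q1 \<odot> r1"
    using z0 by (simp add: qr(1) q1_def r1_def skew_assoc)
  have r1: "lead_coeff r1 = 1" "degree r1 = degree r" using z0 by (simp_all add: r1_def z_def)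
  have q1: "lead_coeff q1 = 1" using d r1(1) unfolding d1 lead_coeff_skew by simp
  have "q \<noteq> 0" using qr(2) by auto
  then have dq1: "degree q1 = degree q" using z0 by (simp add: q1_def degree_skew)
  have "Nm d = Nm q1 * Nm r1" unfolding d1 by (rule Nm_mult)
  then have "is_unit (Nm q1) \<or> is_unit (Nm r1)" using irr by (metis irreducibleD)
  then have "degree q1 = 0 \<or> degree r1 = 0"
    using degree_Nm[OF q1] degree_Nm[OF r1(1)] by (auto simp: poly_dvd_1)
  then show False using qr dq1 r1 by simp
qed

lemma dp_prod_list_Nil [simp]: "dp_prod_list \<delta> [] = 1"
  and dp_prod_list_Cons [simp]: "dp_prod_list \<delta> (q # qs) = q \<odot> dp_prod_list \<delta> qs"
  by (simp_all add: dp_prod_list_def)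

lemma dp_prod_list_append [simp]:
  "dp_prod_list \<delta> (qs @ rs) = dp_prod_list \<delta> qs \<odot> dp_prod_list \<delta> rs"
  by (induction qs) (simp_all add: skew_assoc)

lemma lead_coeff_dp_prod_list:
  "(\<And>q. q \<in> set qs \<Longrightarrow> lead_coeff q = 1) \<Longrightarrow> lead_coeff (dp_prod_list \<delta> qs) = 1"
  by (induction qs) (simp_all only: dp_prod_list_Nil dp_prod_list_Cons lead_coeff_skew, simp_all)

lemma Nm_dp_prod_list: "Nm (dp_prod_list \<delta> qs) = prod_list (map Nm qs)"
  by (induction qs) (simp_all add: Nm_mult)

text \<open>Factors are split off on the right, hence the induction from the end of the list; the
  order of \<open>hs\<close> decides which norm comes next.\<close>

lemma decomposition_exists:
  assumes "has_full_bound f" and "\<And>h. h \<in> set hs \<Longrightarrow> Factorial_Ring.irreducible h \<and> lead_coeff h = 1"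
    and "prod_list hs = Nm f"
  shows "\<exists>fs. map Nm fs = hs \<and> f = dp_prod_list \<delta> fs \<and>
    (\<forall>q\<in>set fs. dp_irreducible \<delta> q \<and> lead_coeff q = 1)"
  using assms
proof (induction hs arbitrary: f rule: rev_induct)
  case Nil
  then have "f = 1"
    using degree_Nm[OF full_bound_monic[OF Nil.prems(1)]] monic_eq_1_if_degree_0[OF full_bound_monic[OF Nil.prems(1)]]
    by simp
  then show ?case by (intro exI[of _ "[]"]) simp
next
  case (snoc k hs)
  have k: "Factorial_Ring.irreducible k" "lead_coeff k = 1" using snoc.prems(2) by auto
  have "k dvd Nm f" using snoc.prems(3) by (metis prod_list.append prod_list.Cons prod_list.Nil dvd_triv_right mult.right_neutral)
  then obtain f' d where fd: "f = f' \<odot> d" "lead_coeff f' = 1" "lead_coeff d = 1" "Nm d = k"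
    using split_right_factor[OF snoc.prems(1) k] by blast
  have "has_full_bound f'" using full_bound_factors(1)[OF _ fd(2,3)] snoc.prems(1) fd(1) by simp
  moreover have "prod_list hs = Nm f'"
  proof -
    have "k \<noteq> 0" using k by auto
    then show ?thesis using snoc.prems(3) Nm_mult[of f' d] fd(1,4) by simp
  qed
  ultimately obtain fs where fs: "map Nm fs = hs" "f' = dp_prod_list \<delta> fs"
      "\<forall>q\<in>set fs. dp_irreducible \<delta> q \<and> lead_coeff q = 1"
    using snoc.IH[of f'] snoc.prems(2) by auto
  have "dp_irreducible \<delta> d" using dp_irreducible_if_irreducible_Nm fd(3,4) k(1) by blast
  then show ?case using fs fd by (intro exI[of _ "fs @ [d]"]) auto
qed

text \<open>A right factor with irreducible norm can be split off, and irreducibility of f leaves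
  only the cofactor 1.\<close>

lemma irreducible_Nm_if_full_bound:
  assumes f: "has_full_bound f" and irr: "dp_irreducible \<delta> f"
  shows "Factorial_Ring.irreducible (Nm f)"
proof -
  note f1 = full_bound_monic[OF f]
  have "f \<noteq> 1" using irr by (auto simp: dp_irreducible_def Units_def)
  then have "degree (Nm f) > 0" using degree_Nm[OF f1] monic_eq_1_if_degree_0[OF f1] by auto
  then obtain k r where k: "Factorial_Ring.irreducible k" "Nm f = k * r" "lead_coeff k = 1"
    using irreducible_monic_factor by blast
  have "k dvd Nm f" using k(2) by simp
  then obtain f' d where fd: "f = f' \<odot> d" "lead_coeff f' = 1" "lead_coeff d = 1" "Nm d = k"
    using split_right_factor[OF f k(1,3)] by blast
  have nz: "f' \<noteq> 0" "d \<noteq> 0" using fd by auto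
  have dd: "degree d > 0" using irreducible_degree_pos[OF k(1)] degree_Nm[OF fd(3)] fd(4) by simp
  have deg: "degree f = degree f' + degree d" unfolding fd(1) by (rule degree_skew[OF nz])
  have "degree f' = 0"
  proof (rule ccontr)
    assume "degree f' \<noteq> 0"
    then have "f = f' \<otimes>\<^bsub>dp_ring \<delta>\<^esub> d \<and> 1 \<le> degree f' \<and> degree f' < degree f \<and>
        1 \<le> degree d \<and> degree d < degree f"
      using fd(1) dd deg by auto
    then show False using irr unfolding dp_irreducible_def by blast
  qed
  then have "f = d" using monic_eq_1_if_degree_0[OF fd(2)] fd(1) by simp
  then show ?thesis using k(1) fd(4) by simp
qed

lemma full_bound_dp_prod_list:
  assumes "has_full_bound (dp_prod_list \<delta> qs)" "\<And>q. q \<in> set qs \<Longrightarrow> lead_coeff q = 1" "q \<in> set qs"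
  shows "has_full_bound q"
  using assms
proof (induction qs)
  case (Cons r qs)
  have "has_full_bound r" "has_full_bound (dp_prod_list \<delta> qs)"
    using full_bound_factors[of r "dp_prod_list \<delta> qs"] Cons.prems(1,2) lead_coeff_dp_prod_list[of qs] by auto
  then show ?case using Cons by auto
qed simp

text \<open>Let d be the greatest common right divisor of f and \<open>Nm a\<close> at g(t). A monic
  right factor z of f with norm \<open>Nm a\<close> right divides d, while \<open>Nm d\<close>
  divides \<open>Nm a\<close> and bounds deg d by deg z. So z = d.\<close>

lemma right_factor_unique:
  assumes f: "has_full_bound f" and a: "f = b \<odot> a" "lead_coeff a = 1" and a': "f = b' \<odot> a'" "lead_coeff a' = 1"
    and N: "Nm a = Nm a'"
  shows "a = a'"
proof -
  have f1: "lead_coeff f = 1" and f0: "f \<noteq> 0" using full_bound_monic[OF f] by auto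
  obtain d x y f' h' where d: "lead_coeff d = 1" "d = x \<odot> f + y \<odot> subst_G (Nm a)" "f = f' \<odot> d"
      "subst_G (Nm a) = h' \<odot> d"
    by (rule bezout_right[OF f0, where h = "subst_G (Nm a)"])
  have f': "lead_coeff f' = 1" using f1 d(1) unfolding d(3) lead_coeff_skew by simp
  have "has_full_bound d" using full_bound_factors[OF _ f' d(1)] f d(3) by simp
  then have dvd: "Nm d dvd Nm a" using Nm_dvd_if_full_bound d(4) by blast
  have *: "z = d" if z: "f = w \<odot> z" "lead_coeff z = 1" "Nm z = Nm a" for w z
  proof -
    obtain u where u: "subst_G (Nm a) = u \<odot> z" using subst_G_Nm[of z] z(3) by auto
    have dz: "d = (x \<odot> w + y \<odot> u) \<odot> z"
      unfolding d(2) u by (simp add: z(1) skew_assoc)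
    let ?s = "x \<odot> w + y \<odot> u"
    have s: "lead_coeff ?s = 1" using d(1) z(2) unfolding dz lead_coeff_skew by simp
    then have "?s \<noteq> 0" "z \<noteq> 0" using z(2) by (metis coeff_0 zero_neq_one)+
    then have "degree d = degree ?s + degree z" unfolding dz by (rule degree_skew)
    moreover have "degree d \<le> degree z"
    proof -
      have "Nm a \<noteq> 0" using lead_coeff_Nm[OF a(2)] by auto
      then have "degree (Nm d) \<le> degree (Nm z)" using dvd z(3) by (simp add: dvd_imp_degree_le)
      then show ?thesis using degree_Nm d(1) z(2) by simp
    qed
    ultimately have "?s = 1" using monic_eq_1_if_degree_0[OF s] by simp
    then show ?thesis using dz by simp
  qed
  show ?thesis using *[OF a refl] *[OF a' N[symmetric]] by simp
qed

lemma decomposition_unique: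
  assumes "has_full_bound (dp_prod_list \<delta> fs)" "dp_prod_list \<delta> fs = dp_prod_list \<delta> fs'"
    and "map Nm fs = map Nm fs'"
    and "\<And>q. q \<in> set fs \<Longrightarrow> lead_coeff q = 1" "\<And>q. q \<in> set fs' \<Longrightarrow> lead_coeff q = 1"
  shows "fs = fs'"
  using assms
proof (induction fs arbitrary: fs' rule: rev_induct)
  case (snoc a gs)
  then obtain gs' a' where fs': "fs' = gs' @ [a']" by (cases fs' rule: rev_cases) auto
  have a: "lead_coeff a = 1" "lead_coeff a' = 1" using snoc.prems(4,5) fs' by auto
  have eq: "dp_prod_list \<delta> gs \<odot> a = dp_prod_list \<delta> gs' \<odot> a'" using snoc.prems(2) fs' by simp
  have "has_full_bound (dp_prod_list \<delta> gs \<odot> a)" using snoc.prems(1) by simp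
  then have "a = a'"
    using right_factor_unique[OF _ refl a(1) eq a(2)] snoc.prems(3) fs' by simp
  moreover from this have "dp_prod_list \<delta> gs = dp_prod_list \<delta> gs'"
    using eq a(1) skew_right_cancel[of a] by (metis coeff_0 zero_neq_one)
  moreover have "has_full_bound (dp_prod_list \<delta> gs)"
    using full_bound_factors(1)[of "dp_prod_list \<delta> gs" a] snoc.prems(1,4) lead_coeff_dp_prod_list[of gs] a(1)
    by simp
  ultimately show ?case using snoc.IH[of gs'] snoc.prems(3-5) fs' by simp
qed simp

text \<open>Unique right factors give injectivity and \<open>decomposition_exists\<close> gives
  surjectivity; that each sequence of norms is an ordering of \<open>hs\<close> is unique
  factorization in F[x].\<close>

lemma bij_betw_decompositions:
  assumes f: "has_full_bound f" and hs: "\<And>h. h \<in> set hs \<Longrightarrow> Factorial_Ring.irreducible h \<and> lead_coeff h = 1"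
    and prod: "prod_list hs = Nm f" and dist: "distinct hs"
  shows "bij_betw (map Nm) (monic_decompositions \<delta> f) (permutations_of_set (set hs))"
  unfolding bij_betw_def
proof (intro conjI equalityI subsetI)
  show "inj_on (map Nm) (monic_decompositions \<delta> f)"
    by (rule inj_onI, rule decomposition_unique) (use f in \<open>auto simp: monic_decompositions_def\<close>)
next
  fix ks assume "ks \<in> map Nm ` monic_decompositions \<delta> f"
  then obtain fs where fs: "ks = map Nm fs" "dp_prod_list \<delta> fs = f"
      "\<And>q. q \<in> set fs \<Longrightarrow> dp_irreducible \<delta> q" "\<And>q. q \<in> set fs \<Longrightarrow> lead_coeff q = 1"
    by (auto simp: monic_decompositions_def)
  have "Factorial_Ring.irreducible h \<and> lead_coeff h = 1" if h: "h \<in> set ks" for h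
  proof -
    obtain q where q: "q \<in> set fs" "h = Nm q" using h fs(1) by auto
    then have "has_full_bound q" using full_bound_dp_prod_list f fs(2,4) by blast
    then show ?thesis using irreducible_Nm_if_full_bound lead_coeff_Nm q fs(3,4) by blast
  qed
  then have "mset ks = mset hs"
    using hs prod Nm_dp_prod_list[of fs] fs(1,2)
    by (intro monic_irreducible_factorization_unique) auto
  then show "ks \<in> permutations_of_set (set hs)"
    using dist by (metis mset_eq_imp_distinct_iff mset_eq_setD permutations_of_setI)
next
  fix ks assume "ks \<in> permutations_of_set (set hs)"
  then have ks: "set ks = set hs" "distinct ks" by (auto simp: permutations_of_set_def)
  then have "mset ks = mset hs" using dist by (metis set_eq_iff_mset_eq_distinct)
  then have "prod_list ks = Nm f" using prod by (metis prod_mset_prod_list)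
  then obtain fs where "map Nm fs = ks" "f = dp_prod_list \<delta> fs"
      "\<forall>q\<in>set fs. dp_irreducible \<delta> q \<and> lead_coeff q = 1"
    using decomposition_exists[OF f, of ks] hs ks(1) by auto
  then show "ks \<in> map Nm ` monic_decompositions \<delta> f"
    by (auto simp: monic_decompositions_def image_iff)
qed

end

section \<open>The embedding of \<open>K\<close> into the algebraic closure of \<open>F(x)\<close>\<close>

lemma derivation_power:
  fixes D :: "'a::comm_ring_1 \<Rightarrow> 'a"
  assumes D1: "D 1 = 0" and mult: "\<And>a b. D (a * b) = D a * b + a * D b"
  shows "D (a ^ m) = of_nat m * a ^ (m - 1) * D a"
proof (induction m)
  case (Suc m)
  then show ?case by (cases m) (simp_all add: mult algebra_simps)
qed (simp add: D1)

lemma power_char_inj: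
  fixes y z :: "'a::field"
  assumes "prime CHAR('a)" "y ^ CHAR('a) = z ^ CHAR('a)"
  shows "y = z"
proof -
  have "(y - z + z) ^ CHAR('a) = (y - z) ^ CHAR('a) + z ^ CHAR('a)"
    by (rule freshmans_dream) (simp_all add: assms(1))
  then have "(y - z) ^ CHAR('a) = 0" using assms(2) by simp
  then show ?thesis by simp
qed

lemma CHAR_poly_fract: "CHAR('a::field poly fract) = CHAR('a)"
proof -
  have of_nat: "of_nat m = to_fract (of_nat m :: 'a poly)" for m
    by (induction m) simp_all
  have "CHAR('a poly fract) dvd m \<longleftrightarrow> CHAR('a) dvd m" for m
  proof -
    have "of_nat m = (0 :: 'a poly fract) \<longleftrightarrow> of_nat m = (0 :: 'a poly)"
      unfolding of_nat by simp
    then show ?thesis by (simp add: of_nat_eq_0_iff_char_dvd)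
  qed
  then show ?thesis by (meson dvd_antisym dvd_refl)
qed

lemma smult_mat_assoc: "a \<cdot>\<^sub>m (b \<cdot>\<^sub>m A) = (a * b :: 'a::semigroup_mult) \<cdot>\<^sub>m A"
  by (rule eq_matI) (simp_all add: mult.assoc)

lemma smult_mat_mult_smult_mat:
  fixes A B :: "'a::comm_ring_1 mat"
  assumes A: "A \<in> carrier_mat l m" and B: "B \<in> carrier_mat m r"
  shows "(a \<cdot>\<^sub>m A) * (b \<cdot>\<^sub>m B) = (a * b) \<cdot>\<^sub>m (A * B)"
  using mult_smult_assoc_mat[OF A smult_carrier_mat[OF B], of a b] mult_smult_distrib[OF A B, of b]
  by (simp add: smult_mat_assoc)

lemma map_poly_pCons_if_0: "f 0 = 0 \<Longrightarrow> map_poly f (pCons a q) = pCons (f a) (map_poly f q)"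
  by (intro poly_eqI) (simp add: coeff_map_poly coeff_pCons split: nat.splits)

type_synonym 'f closure = "'f poly fract alg_closure"

context algebraic_dp
begin

abbreviation embed_Fx :: "'f poly \<Rightarrow> 'f closure" where "embed_Fx q \<equiv> to_ac (to_fract q)"

definition x_L :: "'f closure" where "x_L = embed_Fx [:0, 1:]"

lemma CHAR_closure: "CHAR('f closure) = p"
  by (simp add: CHAR_poly_fract char_F)

text \<open>The p-th root of a^p, which lies in F. Roots are unique in characteristic p, so this
  choice is forced and compatible with sums by the Frobenius identity.\<close>

definition embed_K :: "'k \<Rightarrow> 'f closure" where
  "embed_K a = (SOME y. \<exists>b. \<iota> b = a ^ p \<and> y ^ p = embed_Fx [:b:])"

lemma embed_K_power: "\<iota> b = a ^ p \<Longrightarrow> embed_K a ^ p = embed_Fx [:b:]"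
proof -
  assume b: "\<iota> b = a ^ p"
  have p0: "p > 0" using prime_p by (rule prime_gt_0_nat)
  obtain y where "y ^ p = embed_Fx [:b:]" using nth_root_exists[OF p0] by blast
  then have "\<exists>b. \<iota> b = a ^ p \<and> embed_K a ^ p = embed_Fx [:b:]"
    unfolding embed_K_def using b by (intro someI) blast
  then show ?thesis using b by (metis iota.eq_iff)
qed

text \<open>\<delta>(a^p) = p a^(p-1) \<delta>(a) = 0, and the constants are F.\<close>

lemma power_in_F: "\<exists>b. \<iota> b = a ^ p"
proof -
  have "of_nat p = (0 :: 'k)" by (simp add: of_nat_eq_0_iff_char_dvd char_K)
  then have "\<delta> (a ^ p) = 0"
    by (subst derivation_power[of \<delta>]) (simp_all add: delta_mult)
  then have "a ^ p \<in> Const \<delta>" by (simp add: Const_def)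
  then have "a ^ p \<in> range \<iota>" by (simp only: Const_eq)
  then show ?thesis by (metis imageE)
qed

lemma embed_K_eqI: "\<iota> b = a ^ p \<Longrightarrow> y ^ p = embed_Fx [:b:] \<Longrightarrow> embed_K a = y"
  using power_char_inj[of "embed_K a" y] prime_p by (simp add: CHAR_closure embed_K_power del: CHAR_alg_closure)

lemma embed_K_add: "embed_K (a + b) = embed_K a + embed_K b"
proof -
  obtain a' b' where ab: "\<iota> a' = a ^ p" "\<iota> b' = b ^ p" using power_in_F by metis
  show ?thesis
  proof (rule embed_K_eqI[of "a' + b'"])
    show "\<iota> (a' + b') = (a + b) ^ p"
      by (subst freshmans_dream) (simp_all add: char_K prime_p iota.hom_add ab)
    have "[:a' + b':] = [:a':] + [:b':]" by simp
    then show "(embed_K a + embed_K b) ^ p = embed_Fx [:a' + b':]"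
      by (subst freshmans_dream)
        (simp_all add: CHAR_closure prime_p embed_K_power[OF ab(1)] embed_K_power[OF ab(2)] del: CHAR_alg_closure
          flip: to_ac_add to_fract_add)
  qed
qed

lemma embed_K_mult: "embed_K (a * b) = embed_K a * embed_K b"
proof -
  obtain a' b' where ab: "\<iota> a' = a ^ p" "\<iota> b' = b ^ p" using power_in_F by metis
  have "[:a' * b':] = [:a':] * [:b':]" by simp
  then show ?thesis
    by (intro embed_K_eqI[of "a' * b'"])
      (simp_all add: power_mult_distrib iota.hom_mult ab embed_K_power[OF ab(1)] embed_K_power[OF ab(2)]
        flip: to_ac_mult to_fract_mult)
qed

lemma embed_K_iota: "embed_K (\<iota> a) = embed_Fx [:a:]"
proof (rule embed_K_eqI[of "a ^ p"])
  have "[:a ^ p:] = [:a:] ^ p" by (simp add: poly_const_pow)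
  moreover have "embed_Fx (q ^ m) = embed_Fx q ^ m" for q m by (induction m) simp_all
  ultimately show "embed_Fx [:a:] ^ p = embed_Fx [:a ^ p:]" by simp
qed (simp add: iota.hom_power)

lemma embed_K_0 [simp]: "embed_K 0 = 0" and embed_K_1 [simp]: "embed_K 1 = 1"
  using embed_K_iota[of 0] embed_K_iota[of 1] by (simp_all add: one_pCons[symmetric])

sublocale embed_K: field_hom embed_K
  by unfold_locales (simp_all add: embed_K_add embed_K_mult)

sublocale embed_K_poly: map_poly_inj_idom_hom embed_K ..

definition embed_Kx :: "'k poly \<Rightarrow> 'f closure" where
  "embed_Kx q = poly (map_poly embed_K q) x_L"

sublocale embed_Kx: comm_ring_hom embed_Kx
  by unfold_locales (simp_all add: embed_Kx_def embed_K_poly.hom_add embed_K_poly.hom_mult)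

lemma embed_Kx_pCons [simp]: "embed_Kx (pCons a q) = embed_K a + x_L * embed_Kx q"
  by (simp add: embed_Kx_def map_poly_pCons_if_0)

lemma embed_Kx_iota: "embed_Kx (map_poly \<iota> q) = embed_Fx q"
proof (induction q)
  case (pCons a q)
  have "pCons a q = [:a:] + [:0, 1:] * q" by simp
  then have "embed_Fx (pCons a q) = embed_Fx [:a:] + x_L * embed_Fx q"
    unfolding x_L_def by (metis to_ac_add to_ac_mult to_fract_add to_fract_mult)
  then show ?case by (simp add: map_poly_pCons_if_0 embed_K_iota pCons.IH)
qed simp

text \<open>If \<open>q\<close> is in \<open>K[x]\<close> then \<open>q\<^sup>p\<close> is in \<open>F[x]\<close>.\<close>

lemma embed_Kx_eq_0_iff [simp]: "embed_Kx q = 0 \<longleftrightarrow> q = 0"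
proof
  assume q: "embed_Kx q = 0"
  have p: "p > 0" using prime_p by (rule prime_gt_0_nat)
  have "of_nat p = (0 :: 'k poly)" by (simp add: of_nat_eq_0_iff_char_dvd char_K)
  then have "dd (q ^ p) = 0"
    by (subst derivation_power[of dd]) (simp_all add: dd_mult)
  then obtain r where r: "q ^ p = map_poly \<iota> r" by (auto simp: dd_eq_0_iff)
  have "embed_Fx r = embed_Kx q ^ p" by (simp only: embed_Kx_iota[symmetric] embed_Kx.hom_power r[symmetric])
  then have "r = 0" using q p by (simp add: power_0_left)
  then show "q = 0" using r p by simp
qed simp

lemma embed_Kx_eq_iff: "embed_Kx q = embed_Kx r \<longleftrightarrow> q = r"
  using embed_Kx_eq_0_iff[of "q - r"] by (simp add: embed_Kx.hom_minus)

definition mat_L :: "'k poly \<Rightarrow> 'f closure mat" where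
  "mat_L f = map_mat embed_Kx (Psi f)"

lemma mat_L_carrier [simp]: "mat_L f \<in> carrier_mat n n"
  by (simp add: mat_L_def)

lemma mat_L_dim [simp]: "dim_row (mat_L f) = n" "dim_col (mat_L f) = n"
  using mat_L_carrier[of f] by (auto simp del: mat_L_carrier)

lemma mat_L_index: "i < n \<Longrightarrow> j < n \<Longrightarrow> mat_L f $$ (i, j) = embed_Kx (rho (monom 1 i \<odot> f) j)"
  by (simp add: mat_L_def Psi_def)

lemma mat_L_mult: "mat_L (f \<odot> f') = mat_L f * mat_L f'"
  by (simp add: mat_L_def Psi_mult embed_Kx.mat_hom_mult[OF Psi_carrier Psi_carrier])

lemma mat_L_add: "mat_L (f + f') = mat_L f + mat_L f'"
  by (rule eq_matI) (simp_all add: mat_L_index rho_add embed_Kx.hom_add)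

lemma mat_L_1 [simp]: "mat_L 1 = 1\<^sub>m n"
  by (rule eq_matI) (auto simp: mat_L_def)

lemma mat_L_0 [simp]: "mat_L 0 = 0\<^sub>m n n"
  by (rule eq_matI) (simp_all add: mat_L_index rho_0)

lemma mat_L_subst_G_mult: "mat_L (subst_G q * f) = embed_Fx q \<cdot>\<^sub>m mat_L f"
proof -
  have "mat_L (subst_G q) = embed_Fx q \<cdot>\<^sub>m 1\<^sub>m n"
    by (rule eq_matI) (auto simp: mat_L_def Psi_pcompose_G embed_Kx_iota)
  then have "mat_L (subst_G q * f) = (embed_Fx q \<cdot>\<^sub>m 1\<^sub>m n) * mat_L f"
    by (simp add: mat_L_mult flip: subst_G_skew)
  also have "\<dots> = embed_Fx q \<cdot>\<^sub>m mat_L f"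
    using mult_smult_assoc_mat[OF one_carrier_mat mat_L_carrier] left_mult_one_mat[OF mat_L_carrier] by metis
  finally show ?thesis .
qed

lemma mat_L_inj: "mat_L f = mat_L f' \<longleftrightarrow> f = f'"
proof
  assume eq: "mat_L f = mat_L f'"
  have "rho f j = rho f' j" if j: "j < n" for j
  proof -
    \<comment> \<open>Row 0 is the coordinate vector of f itself, because t^0 = 1.\<close>
    have "mat_L f $$ (0, j) = mat_L f' $$ (0, j)" using eq by simp
    then show ?thesis using j by (simp add: mat_L_index embed_Kx_eq_iff monom_0 flip: one_pCons)
  qed
  then have "(\<Sum>j<n. (rho f j \<circ>\<^sub>p G) * monom 1 j) = (\<Sum>j<n. (rho f' j \<circ>\<^sub>p G) * monom 1 j)"
    by (intro sum.cong) auto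
  then show "f = f'" using rho_expands by metis
qed simp

lemma det_mat_L: "det (mat_L f) = embed_Fx (Nm f)"
  by (simp add: mat_L_def embed_Kx_iota flip: Nm)

lemma mat_L_sum: "finite I \<Longrightarrow> mat_L (\<Sum>k\<in>I. subst_G (r k) * F k) = mat_lincomb n I (\<lambda>k. embed_Fx (r k)) (\<lambda>k. mat_L (F k))"
proof (induction I rule: finite_induct)
  case empty
  show ?case by (rule eq_matI) (auto simp: mat_lincomb_def)
next
  case (insert k I)
  then show ?case
    by (simp add: mat_L_add mat_L_subst_G_mult) (rule eq_matI, auto simp: mat_lincomb_def)
qed

section \<open>The ring of central quotients\<close>

abbreviation C where "C \<equiv> cq_class \<iota> \<delta> g"
abbreviation Q where "Q \<equiv> cq_ring \<iota> \<delta> g"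
abbreviation \<sigma> where "\<sigma> \<equiv> cq_scalar \<iota> \<delta> g"

lemma in_C_iff: "(f', q') \<in> C f q \<longleftrightarrow> q' \<noteq> 0 \<and> subst_G q' * f = subst_G q * f'"
  by (simp add: cq_class_def subst_center_eq subst_G_skew)

lemma in_C_self: "q \<noteq> 0 \<Longrightarrow> (f, q) \<in> C f q"
  by (simp add: in_C_iff)

lemma C_eqI:
  assumes "q \<noteq> 0" "q' \<noteq> 0" "subst_G q' * f = subst_G q * f'"
  shows "C f q = C f' q'"
proof -
  have "(a, b) \<in> C f q \<longleftrightarrow> (a, b) \<in> C f' q'" for a b
  proof -
    have "subst_G b * f = subst_G q * a \<longleftrightarrow> subst_G q' * (subst_G b * f) = subst_G q' * (subst_G q * a)"
      using assms(2) by simp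
    also have "subst_G q' * (subst_G b * f) = subst_G q * (subst_G b * f')"
      using assms(3) by (simp add: mult.left_commute)
    also have "\<dots> = subst_G q' * (subst_G q * a) \<longleftrightarrow> subst_G b * f' = subst_G q' * a"
      using assms(1) by (simp add: mult.left_commute[of "subst_G q'"])
    finally show ?thesis by (simp add: in_C_iff)
  qed
  then show ?thesis by auto
qed

text \<open>The matrix of the fraction f/q, taken from any representative; by
  \<open>scaled_mat_L_eq\<close> all pairs in a class give the same matrix, and different classes
  give different ones.\<close>

definition Theta :: "('k poly \<times> 'f poly) set \<Rightarrow> 'f closure mat" where
  "Theta U = (SOME M. \<exists>f q. (f, q) \<in> U \<and> M = inverse (embed_Fx q) \<cdot>\<^sub>m mat_L f)"

lemma scaled_mat_L_eq:
  assumes "q \<noteq> 0" "q' \<noteq> 0"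
  shows "inverse (embed_Fx q) \<cdot>\<^sub>m mat_L f = inverse (embed_Fx q') \<cdot>\<^sub>m mat_L f' \<longleftrightarrow> subst_G q' * f = subst_G q * f'"
proof -
  have nz: "embed_Fx q \<noteq> 0" "embed_Fx q' \<noteq> 0" using assms by simp_all
  have "inverse (embed_Fx q) \<cdot>\<^sub>m mat_L f = inverse (embed_Fx q') \<cdot>\<^sub>m mat_L f' \<longleftrightarrow>
      embed_Fx q' \<cdot>\<^sub>m mat_L f = embed_Fx q \<cdot>\<^sub>m mat_L f'"
  proof -
    have "inverse (embed_Fx q) * u = inverse (embed_Fx q') * v \<longleftrightarrow> embed_Fx q' * u = embed_Fx q * v" for u v
      using nz by (simp add: field_simps)
    then show ?thesis by (auto simp: mat_eq_iff)
  qed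
  also have "\<dots> \<longleftrightarrow> subst_G q' * f = subst_G q * f'"
    by (simp add: mat_L_inj flip: mat_L_subst_G_mult)
  finally show ?thesis .
qed

lemma Theta_C:
  assumes "q \<noteq> 0"
  shows "Theta (C f q) = inverse (embed_Fx q) \<cdot>\<^sub>m mat_L f"
proof -
  have "\<exists>f' q'. (f', q') \<in> C f q \<and> Theta (C f q) = inverse (embed_Fx q') \<cdot>\<^sub>m mat_L f'"
    unfolding Theta_def by (rule someI_ex) (use in_C_self[OF assms] in blast)
  then obtain f' q' where "(f', q') \<in> C f q" "Theta (C f q) = inverse (embed_Fx q') \<cdot>\<^sub>m mat_L f'"
    by blast
  then show ?thesis using scaled_mat_L_eq[of q q' f f'] assms by (simp add: in_C_iff)
qed

lemma carrier_Q: "carrier Q = {C f q | f q. q \<noteq> 0}"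
  by (simp add: cq_ring_def)

lemma C_in_carrier: "q \<noteq> 0 \<Longrightarrow> C f q \<in> carrier Q"
  by (auto simp: carrier_Q)

lemma Theta_carrier: "U \<in> carrier Q \<Longrightarrow> Theta U \<in> carrier_mat n n"
  by (auto simp: carrier_Q Theta_C)

lemma Theta_inj:
  assumes "U \<in> carrier Q" "V \<in> carrier Q" "Theta U = Theta V"
  shows "U = V"
proof -
  obtain f q f' q' where UV: "U = C f q" "V = C f' q'" "q \<noteq> 0" "q' \<noteq> 0"
    using assms(1,2) by (auto simp: carrier_Q)
  then show ?thesis
    using assms(3) C_eqI[OF UV(3,4)] by (simp add: Theta_C scaled_mat_L_eq)
qed

lemma subst_G_mult_skew_mult:
  "(subst_G q * a) \<odot> (subst_G r * b) = subst_G (q * r) * (a \<odot> b)"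
proof -
  have "a \<odot> (subst_G r * b) = (a \<odot> b) * subst_G r"
    by (metis subst_G_skew subst_G_commute skew_assoc skew_subst_G)
  then show ?thesis
    unfolding pcompose_G_mult_skew by (simp add: mult_ac)
qed

text \<open>The operations of \<open>cq_ring\<close> are unions over representatives. If the result
  does not depend on them, the union of equal sets over nonempty classes is that set.\<close>

lemma UN_C_eq:
  assumes "q \<noteq> 0" "q' \<noteq> 0"
    and "\<And>a b a' b'. (a, b) \<in> C f q \<Longrightarrow> (a', b') \<in> C f' q' \<Longrightarrow> F a b a' b' = U"
  shows "(\<Union>(f, q)\<in>C f q. \<Union>(f', q')\<in>C f' q'. F f q f' q') = U"
proof (rule SUP_eq_const)
  show "C f q \<noteq> {}" using in_C_self[OF assms(1)] by (metis empty_iff)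
  fix z assume z: "z \<in> C f q"
  have "(\<Union>(f', q')\<in>C f' q'. F (fst z) (snd z) f' q') = U"
  proof (rule SUP_eq_const)
    show "C f' q' \<noteq> {}" using in_C_self[OF assms(2)] by (metis empty_iff)
    fix z' assume "z' \<in> C f' q'"
    then show "(case z' of (f', q') \<Rightarrow> F (fst z) (snd z) f' q') = U"
      using z assms(3)[of "fst z" "snd z" "fst z'" "snd z'"] by (simp add: case_prod_beta)
  qed
  then show "(case z of (f, q) \<Rightarrow> \<Union>(f', q')\<in>C f' q'. F f q f' q') = U"
    by (simp add: case_prod_beta)
qed

lemma Q_mult:
  assumes "q \<noteq> 0" "q' \<noteq> 0"
  shows "C f q \<otimes>\<^bsub>Q\<^esub> C f' q' = C (f \<odot> f') (q * q')"
proof -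
  have "C (a \<odot> a') (b * b') = C (f \<odot> f') (q * q')"
    if "(a, b) \<in> C f q" "(a', b') \<in> C f' q'" for a b a' b'
  proof (rule C_eqI)
    have "subst_G (q * q') * (a \<odot> a') = (subst_G q * a) \<odot> (subst_G q' * a')"
      by (simp only: subst_G_mult_skew_mult)
    also have "\<dots> = (subst_G b * f) \<odot> (subst_G b' * f')" using that by (simp only: in_C_iff)
    also have "\<dots> = subst_G (b * b') * (f \<odot> f')" by (simp only: subst_G_mult_skew_mult)
    finally show "subst_G (q * q') * (a \<odot> a') = subst_G (b * b') * (f \<odot> f')" .
  qed (use that assms in \<open>auto simp: in_C_iff\<close>)
  then show ?thesis unfolding cq_ring_def using assms by (simp add: UN_C_eq)
qed

lemma Q_add:
  assumes "q \<noteq> 0" "q' \<noteq> 0"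
  shows "C f q \<oplus>\<^bsub>Q\<^esub> C f' q' = C (subst_G q' * f + subst_G q * f') (q * q')"
proof -
  have "C (subst_G b' * a + subst_G b * a') (b * b') = C (subst_G q' * f + subst_G q * f') (q * q')"
    if "(a, b) \<in> C f q" "(a', b') \<in> C f' q'" for a b a' b'
  proof (rule C_eqI)
    have eq: "subst_G b * f = subst_G q * a" "subst_G b' * f' = subst_G q' * a'"
      using that by (simp_all add: in_C_iff)
    have "subst_G (q * q') * (subst_G b' * a + subst_G b * a') =
        subst_G q' * subst_G b' * (subst_G q * a) + subst_G q * subst_G b * (subst_G q' * a')"
      by (simp add: algebra_simps)
    also have "\<dots> = subst_G (b * b') * (subst_G q' * f + subst_G q * f')"
      unfolding eq[symmetric] by (simp add: algebra_simps)
    finally show "subst_G (q * q') * (subst_G b' * a + subst_G b * a') =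
        subst_G (b * b') * (subst_G q' * f + subst_G q * f')" .
  qed (use that assms in \<open>auto simp: in_C_iff\<close>)
  then show ?thesis
    unfolding cq_ring_def using assms by (simp add: UN_C_eq subst_center_eq subst_G_skew)
qed

lemma Q_one: "\<one>\<^bsub>Q\<^esub> = C 1 1" and Q_zero: "\<zero>\<^bsub>Q\<^esub> = C 0 1"
  by (simp_all add: cq_ring_def)

lemma Theta_mult:
  assumes "U \<in> carrier Q" "V \<in> carrier Q"
  shows "Theta (U \<otimes>\<^bsub>Q\<^esub> V) = Theta U * Theta V"
proof -
  obtain f q f' q' where UV: "U = C f q" "V = C f' q'" "q \<noteq> 0" "q' \<noteq> 0"
    using assms by (auto simp: carrier_Q)
  show ?thesis
    using UV(3,4)
    by (simp add: UV(1,2) Q_mult Theta_C mat_L_mult smult_mat_mult_smult_mat[OF mat_L_carrier mat_L_carrier])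
qed

lemma Theta_add:
  assumes "U \<in> carrier Q" "V \<in> carrier Q"
  shows "Theta (U \<oplus>\<^bsub>Q\<^esub> V) = Theta U + Theta V"
proof -
  obtain f q f' q' where UV: "U = C f q" "V = C f' q'" "q \<noteq> 0" "q' \<noteq> 0"
    using assms by (auto simp: carrier_Q)
  have nz: "embed_Fx q \<noteq> 0" "embed_Fx q' \<noteq> 0" using UV by simp_all
  have "inverse (a * b) * (b * u + a * v) = inverse a * u + inverse b * v"
    if ab: "a \<noteq> 0" "b \<noteq> 0" for a b u v :: "'f closure"
  proof -
    have "inverse (a * b) * (b * u + a * v) =
        inverse a * (inverse b * b) * u + inverse b * (inverse a * a) * v"
      by (simp only: inverse_mult_distrib distrib_left mult_ac)
    then show ?thesis using ab by simp
  qed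
  from this[OF nz] have eq: "inverse (embed_Fx (q * q')) * (embed_Fx q' * u + embed_Fx q * v) =
      inverse (embed_Fx q) * u + inverse (embed_Fx q') * v" for u v
    by (simp only: to_ac_mult to_fract_mult)
  show ?thesis
    unfolding UV(1,2) Q_add[OF UV(3,4)] Theta_C[OF UV(3)] Theta_C[OF UV(4)]
      Theta_C[OF no_zero_divisors[OF UV(3,4)]] mat_L_add mat_L_subst_G_mult
    by (rule eq_matI) (simp_all add: eq del: to_ac_mult to_fract_mult to_ac_inverse)
qed

lemma Theta_one: "Theta \<one>\<^bsub>Q\<^esub> = 1\<^sub>m n" and Theta_zero: "Theta \<zero>\<^bsub>Q\<^esub> = 0\<^sub>m n n"
  by (auto simp: Q_one Q_zero Theta_C intro: eq_matI)

lemma Q_closed: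
  "U \<in> carrier Q \<Longrightarrow> V \<in> carrier Q \<Longrightarrow> U \<oplus>\<^bsub>Q\<^esub> V \<in> carrier Q"
  "U \<in> carrier Q \<Longrightarrow> V \<in> carrier Q \<Longrightarrow> U \<otimes>\<^bsub>Q\<^esub> V \<in> carrier Q"
  "\<zero>\<^bsub>Q\<^esub> \<in> carrier Q" "\<one>\<^bsub>Q\<^esub> \<in> carrier Q"
proof -
  assume "U \<in> carrier Q" "V \<in> carrier Q"
  then obtain f q f' q' where UV: "U = C f q" "V = C f' q'" "q \<noteq> 0" "q' \<noteq> 0"
    by (auto simp: carrier_Q)
  then show "U \<oplus>\<^bsub>Q\<^esub> V \<in> carrier Q" "U \<otimes>\<^bsub>Q\<^esub> V \<in> carrier Q"
    by (simp_all add: Q_add Q_mult C_in_carrier)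
qed (simp_all add: Q_one Q_zero C_in_carrier)

text \<open>The laws are those of matrices, pulled back along the injective \<open>Theta\<close>;
  they make finite sums in \<open>Q\<close> available.\<close>

lemma abelian_monoid_Q: "abelian_monoid Q"
proof (rule abelian_monoidI)
  fix U V W assume UVW: "U \<in> carrier Q" "V \<in> carrier Q"
  show "U \<oplus>\<^bsub>Q\<^esub> V = V \<oplus>\<^bsub>Q\<^esub> U"
    using UVW by (intro Theta_inj Q_closed)
      (simp_all add: Theta_add comm_add_mat[OF Theta_carrier Theta_carrier])
  assume W: "W \<in> carrier Q"
  show "U \<oplus>\<^bsub>Q\<^esub> V \<oplus>\<^bsub>Q\<^esub> W = U \<oplus>\<^bsub>Q\<^esub> (V \<oplus>\<^bsub>Q\<^esub> W)"
    using UVW W by (intro Theta_inj Q_closed)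
      (simp_all add: Theta_add Q_closed assoc_add_mat[OF Theta_carrier Theta_carrier Theta_carrier])
next
  fix U assume U: "U \<in> carrier Q"
  then show "\<zero>\<^bsub>Q\<^esub> \<oplus>\<^bsub>Q\<^esub> U = U"
    by (intro Theta_inj Q_closed)
      (simp_all add: Theta_add Theta_zero Q_closed left_add_zero_mat[OF Theta_carrier])
qed (simp_all add: Q_closed)

lemma cq_scalar_eq:
  assumes "b \<noteq> 0"
  shows "\<sigma> (Fract a b) = C (subst_G a) b"
proof -
  have "C (subst_center \<iota> \<delta> g a') b' = C (subst_G a) b" if "b' \<noteq> 0" "Fract a b = Fract a' b'" for a' b'
  proof -
    have "a * b' = a' * b" using that assms by (simp add: eq_fract)
    then show ?thesis
      using that assms by (intro C_eqI) (simp_all add: subst_center_eq flip: subst_G_simps, simp add: ac_simps)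
  qed
  note * = this
  have "{C (subst_center \<iota> \<delta> g a') b' | a' b'. b' \<noteq> 0 \<and> Fract a b = Fract a' b'} = {C (subst_G a) b}"
  proof (intro equalityI subsetI)
    fix U assume "U \<in> {C (subst_G a) b}"
    then have "U = C (subst_center \<iota> \<delta> g a) b \<and> b \<noteq> 0 \<and> Fract a b = Fract a b"
      using assms by (simp add: subst_center_eq)
    then show "U \<in> {C (subst_center \<iota> \<delta> g a') b' | a' b'. b' \<noteq> 0 \<and> Fract a b = Fract a' b'}"
      by (intro CollectI exI)
  qed (use * in auto)
  then show ?thesis by (simp add: cq_scalar_def)
qed

lemma cq_scalar_carrier: "\<sigma> z \<in> carrier Q"
  by (cases z) (auto simp: cq_scalar_eq C_in_carrier)

lemma Theta_scalar: "Theta (\<sigma> z) = to_ac z \<cdot>\<^sub>m 1\<^sub>m n"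
proof (cases z)
  case (Fract a b)
  have "mat_L (subst_G a) = embed_Fx a \<cdot>\<^sub>m 1\<^sub>m n" using mat_L_subst_G_mult[of a 1] by simp
  then have "Theta (\<sigma> z) = inverse (embed_Fx b) \<cdot>\<^sub>m (embed_Fx a \<cdot>\<^sub>m 1\<^sub>m n)"
    unfolding Fract(1) cq_scalar_eq[OF Fract(2)] Theta_C[OF Fract(2)] by simp
  then show ?thesis
    by (simp add: Fract(1) Fract_conv_to_fract smult_mat_assoc divide_inverse mult.commute)
qed

lemma Theta_ring_hom: "Theta \<in> Ring.ring_hom Q (ring_mat TYPE('f closure) n ())"
  by (rule ring_hom_memI) (simp_all add: ring_mat_simps Theta_carrier Theta_mult Theta_add Theta_one)

end

section \<open>Triangular systems and linear combinations of matrices\<close>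

lemma exists_triangular_solution:
  fixes Y :: "nat \<Rightarrow> nat \<Rightarrow> 'a::ab_group_add"
  shows "\<exists>\<mu>. \<forall>k<N. \<forall>s. \<mu> k s + (\<Sum>l<k. H k s l (\<mu> l)) = Y k s"
proof (induction N)
  case (Suc N)
  then obtain \<mu> where \<mu>: "\<And>k s. k < N \<Longrightarrow> \<mu> k s + (\<Sum>l<k. H k s l (\<mu> l)) = Y k s" by blast
  \<comment> \<open>Forward substitution: the new row is determined by the earlier ones, whatever
    the functions H are.\<close>
  let ?\<mu> = "\<mu>(N := \<lambda>s. Y N s - (\<Sum>l<N. H N s l (\<mu> l)))"
  have "?\<mu> k s + (\<Sum>l<k. H k s l (?\<mu> l)) = Y k s" if "k < Suc N" for k s
  proof -
    have "(\<Sum>l<k. H k s l (?\<mu> l)) = (\<Sum>l<k. H k s l (\<mu> l))"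
      using that by (intro sum.cong) auto
    then show ?thesis using that \<mu> by (cases "k = N") auto
  qed
  then show ?case by blast
qed simp

text \<open>A basis is a list, so the pair (i, j) of basis indices is coded as k = j n + i.\<close>

lemma sum_mod_div:
  fixes n :: nat
  assumes "n > 0"
  shows "(\<Sum>k<n * n. F (k mod n) (k div n)) = (\<Sum>i<n. \<Sum>j<n. F i j)"
proof -
  have "(\<Sum>i<n. \<Sum>j<n. F i j) = (\<Sum>(i, j)\<in>{..<n} \<times> {..<n}. F i j)"
    by (simp add: sum.cartesian_product)
  also have "\<dots> = (\<Sum>k<n * n. F (k mod n) (k div n))"
  proof (rule sum.reindex_bij_witness[of _ "\<lambda>k. (k mod n, k div n)" "\<lambda>(i, j). j * n + i"])
    fix z assume z: "z \<in> {..<n} \<times> {..<n}"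
    obtain i j where ij: "z = (i, j)" "i < n" "j < n" using z by auto
    have "j * n + i < Suc j * n" using ij by simp
    also have "\<dots> \<le> n * n" using ij by (intro mult_le_mono1) simp
    finally show "(case z of (i, j) \<Rightarrow> j * n + i) \<in> {..<n * n}" using ij by simp
    show "((case z of (i, j) \<Rightarrow> j * n + i) mod n, (case z of (i, j) \<Rightarrow> j * n + i) div n) = z"
      using ij by simp
    show "F ((case z of (i, j) \<Rightarrow> j * n + i) mod n) ((case z of (i, j) \<Rightarrow> j * n + i) div n) =
        (case z of (i, j) \<Rightarrow> F i j)"
      using ij by simp
  qed (use assms in \<open>auto simp: less_mult_imp_div_less\<close>)
  finally show ?thesis by simp
qed

lemma mat_lincomb_mult:
  assumes "finite I" "finite J"
    and "\<And>i. i \<in> I \<Longrightarrow> P i \<in> carrier_mat n n" "\<And>j. j \<in> J \<Longrightarrow> R j \<in> carrier_mat n n"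
  shows "mat_lincomb n I c P * mat_lincomb n J d R =
    mat_lincomb n (I \<times> J) (\<lambda>(i, j). c i * d j) (\<lambda>(i, j). P i * R j)"
proof (rule eq_matI)
  fix a b assume "a < dim_row (mat_lincomb n (I \<times> J) (\<lambda>(i, j). c i * d j) (\<lambda>(i, j). P i * R j))"
    "b < dim_col (mat_lincomb n (I \<times> J) (\<lambda>(i, j). c i * d j) (\<lambda>(i, j). P i * R j))"
  then have ab: "a < n" "b < n" by (auto simp: mat_lincomb_def)
  have "(mat_lincomb n I c P * mat_lincomb n J d R) $$ (a, b) =
      (\<Sum>k<n. (\<Sum>i\<in>I. c i * P i $$ (a, k)) * (\<Sum>j\<in>J. d j * R j $$ (k, b)))"
    using ab by (subst index_mult_mat_sum[OF mat_lincomb_carrier mat_lincomb_carrier ab])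
      (simp add: mat_lincomb_index)
  also have "\<dots> = (\<Sum>k<n. \<Sum>(i, j)\<in>I \<times> J. c i * P i $$ (a, k) * (d j * R j $$ (k, b)))"
    by (simp add: sum_product sum.cartesian_product)
  also have "\<dots> = (\<Sum>(i, j)\<in>I \<times> J. \<Sum>k<n. c i * P i $$ (a, k) * (d j * R j $$ (k, b)))"
    by (subst sum.swap) (simp add: case_prod_beta)
  also have "\<dots> = (\<Sum>(i, j)\<in>I \<times> J. c i * d j * (P i * R j) $$ (a, b))"
    using assms(3,4) ab
    by (intro sum.cong refl)
      (auto simp: index_mult_mat_sum[of _ n n _ n] sum_distrib_left ac_simps simp del: index_mult_mat)
  finally show "(mat_lincomb n I c P * mat_lincomb n J d R) $$ (a, b) =
      mat_lincomb n (I \<times> J) (\<lambda>(i, j). c i * d j) (\<lambda>(i, j). P i * R j) $$ (a, b)"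
    using ab by (simp add: mat_lincomb_index case_prod_beta)
qed (auto simp: mat_lincomb_def)

lemma mat_lincomb_cong:
  "(\<And>i. i \<in> I \<Longrightarrow> c i = c' i) \<Longrightarrow> (\<And>i. i \<in> I \<Longrightarrow> M i = M' i) \<Longrightarrow>
    mat_lincomb n I c M = mat_lincomb n I c' M'"
  by (simp add: mat_lincomb_def)

lemma mat_lincomb_add:
  "mat_lincomb n I c M + mat_lincomb n I d M = mat_lincomb n I (\<lambda>i. c i + d i) M"
  by (rule eq_matI) (auto simp: mat_lincomb_def distrib_right sum.distrib)

lemma smult_mat_lincomb: "a \<cdot>\<^sub>m mat_lincomb n I c M = mat_lincomb n I (\<lambda>i. a * c i) M"
  by (rule eq_matI) (auto simp: mat_lincomb_def sum_distrib_left mult.assoc)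

lemma mat_lincomb_insert:
  "finite I \<Longrightarrow> k \<notin> I \<Longrightarrow> M k \<in> carrier_mat n n \<Longrightarrow>
    mat_lincomb n (insert k I) c M = c k \<cdot>\<^sub>m M k + mat_lincomb n I c M"
  by (rule eq_matI) (auto simp: mat_lincomb_def)

lemma mat_lincomb_empty: "mat_lincomb n {} c M = 0\<^sub>m n n"
  by (rule eq_matI) (auto simp: mat_lincomb_def)

lemma finsum_ring_mat:
  fixes M :: "'i \<Rightarrow> 'a::comm_ring_1 mat"
  assumes "finite I" "\<And>k. k \<in> I \<Longrightarrow> M k \<in> carrier_mat n n"
  shows "(\<Oplus>\<^bsub>ring_mat TYPE('a) n ()\<^esub>k\<in>I. (c k \<cdot>\<^sub>m 1\<^sub>m n) \<otimes>\<^bsub>ring_mat TYPE('a) n ()\<^esub> M k) =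
    mat_lincomb n I c M"
proof -
  interpret R: ring "ring_mat TYPE('a) n ()" by (rule ring_mat)
  have m: "(c k \<cdot>\<^sub>m 1\<^sub>m n) * M k = c k \<cdot>\<^sub>m M k" if "M k \<in> carrier_mat n n" for k
    using mult_smult_assoc_mat[OF one_carrier_mat that] left_mult_one_mat[OF that] by metis
  show ?thesis using assms
  proof (induction I rule: finite_induct)
    case empty
    then show ?case by (simp add: ring_mat_simps mat_lincomb_empty)
  next
    case (insert k I)
    then show ?case
      by (subst R.finsum_insert) (auto simp: ring_mat_simps mat_lincomb_insert m)
  qed
qed

context algebraic_dp
begin

section \<open>A basis of \<open>K\<close> over \<open>F\<close>\<close>

text \<open>Make a relation of least degree monic and apply \<delta>: subtracting the relation at
  \<delta> x leaves one with differentiated coefficients and smaller degree. So these vanish, the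
  relation has coefficients in F, and this contradicts the minimality of g.\<close>

lemma delta_powers_independent:
  "w \<noteq> 0 \<Longrightarrow> degree w < n \<Longrightarrow> \<exists>x. (\<Sum>k<n. coeff w k * (\<delta> ^^ k) x) \<noteq> 0"
proof (induction "degree w" arbitrary: w rule: less_induct)
  case less
  show ?case
  proof (rule ccontr)
    assume "\<not> ?thesis"
    then have w: "(\<Sum>k<n. coeff w k * (\<delta> ^^ k) x) = 0" for x by blast
    define v where "v = smult (inverse (lead_coeff w)) w"
    have v: "lead_coeff v = 1" "degree v = degree w" using less.prems(1) by (simp_all add: v_def)
    have act: "(\<Sum>k<n. coeff v k * (\<delta> ^^ k) x) = 0" for x
      using w[of x] by (simp add: v_def mult.assoc flip: sum_distrib_left)
    have act_dd: "(\<Sum>k<n. coeff (dd v) k * (\<delta> ^^ k) x) = 0" for x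
    proof -
      have "\<delta> (\<Sum>k<n. coeff v k * (\<delta> ^^ k) x) =
          (\<Sum>k<n. coeff (dd v) k * (\<delta> ^^ k) x) + (\<Sum>k<n. coeff v k * (\<delta> ^^ k) (\<delta> x))"
        by (simp add: delta_sum delta_mult sum.distrib coeff_map_poly funpow_swap1)
      then show ?thesis by (simp add: act)
    qed
    have "dd v = 0"
    proof (rule ccontr)
      assume nz: "dd v \<noteq> 0"
      have "coeff (dd v) (degree v) = 0" using v(1) by (simp add: coeff_map_poly)
      then have "degree (dd v) < degree v"
        using nz degree_dd_le[of v] by (metis leading_coeff_0_iff order_le_less)
      then show False using less.hyps[of "dd v"] nz less.prems(2) v(2) act_dd by auto
    qed
    then obtain r where r: "v = map_poly \<iota> r" by (auto simp: dd_eq_0_iff)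
    have dr: "degree r = degree w" using v(2) r by simp
    have "annihilates \<iota> \<delta> r"
      unfolding annihilates_def
    proof
      fix x
      have "(\<Sum>i\<le>degree r. \<iota> (coeff r i) * (\<delta> ^^ i) x) = (\<Sum>k<n. coeff v k * (\<delta> ^^ k) x)"
        using less.prems(2) dr
        by (intro sum.mono_neutral_cong_left) (auto simp: r coeff_eq_0)
      then show "(\<Sum>i\<le>degree r. \<iota> (coeff r i) * (\<delta> ^^ i) x) = 0" using act by simp
    qed
    moreover have "r \<noteq> 0" using v(1) r by auto
    ultimately have "n \<le> degree r"
      using minimum_polynomial unfolding is_minimum_polynomial_def by simp
    then show False using dr less.prems(2) by simp
  qed
qed

text \<open>Chosen by a nonzero Wronskian, since this one condition yields both spanning over F and,
  after embedding K, independence of the matrices over the algebraic closure.\<close>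

definition K_basis :: "nat \<Rightarrow> 'k" where
  "K_basis = (SOME b. det (mat n n (\<lambda>(k, i). (\<delta> ^^ k) (b i))) \<noteq> 0)"

lemma wronskian_K_basis: "det (mat n n (\<lambda>(k, i). (\<delta> ^^ k) (K_basis i))) \<noteq> 0"
proof -
  have "\<exists>b. det (mat n n (\<lambda>(k, i). (\<delta> ^^ k) (b i))) \<noteq> 0"
  proof (rule exists_nonsingular_points)
    fix a assume a: "\<And>x. (\<Sum>k<n. a k * (\<delta> ^^ k) x) = 0"
    define w where "w = (\<Sum>k<n. monom (a k) k)"
    have cw: "coeff w k = (if k < n then a k else 0)" for k by (simp add: w_def coeff_sum)
    have "w = 0"
    proof (rule ccontr)
      assume nz: "w \<noteq> 0"
      have "degree w < n" using cw by (intro degree_lessI) auto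
      then show False using delta_powers_independent[OF nz] a by (simp add: cw)
    qed
    then show "\<forall>k<n. a k = 0" using cw by (metis coeff_0)
  qed
  then show ?thesis unfolding K_basis_def by (rule someI_ex)
qed

text \<open>Solve for a and its first n - 1 derivatives with coefficients u in K; g(\<delta>) = 0
  adds the equation for the n-th derivative. Differentiating the equations shows that the \<delta>(u
  i) solve the homogeneous system, so the u i are constants.\<close>

lemma K_basis_spans: "\<exists>c. a = (\<Sum>i<n. \<iota> (c i) * K_basis i)"
proof -
  obtain u where u: "\<And>k. k < n \<Longrightarrow> (\<Sum>i<n. (\<delta> ^^ k) (K_basis i) * u i) = (\<delta> ^^ k) a"
    using det_solve[OF wronskian_K_basis, of "\<lambda>k. (\<delta> ^^ k) a"] by blast
  have top: "(\<delta> ^^ n) x = - (\<Sum>k<n. \<iota> (coeff g k) * (\<delta> ^^ k) x)" for x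
    using g_annihilates[of x] by (simp add: lessThan_Suc_atMost[symmetric] eq_neg_iff_add_eq_0 add.commute)
  have un: "(\<Sum>i<n. (\<delta> ^^ n) (K_basis i) * u i) = (\<delta> ^^ n) a"
  proof -
    have "(\<Sum>i<n. (\<delta> ^^ n) (K_basis i) * u i) =
        - (\<Sum>k<n. \<iota> (coeff g k) * (\<Sum>i<n. (\<delta> ^^ k) (K_basis i) * u i))"
      unfolding top sum_distrib_left
      by (simp add: sum_negf sum_distrib_right mult.assoc) (rule sum.swap)
    also have "\<dots> = (\<delta> ^^ n) a" unfolding top by (simp add: u)
    finally show ?thesis .
  qed
  have u': "(\<Sum>i<n. (\<delta> ^^ Suc k) (K_basis i) * u i) = (\<delta> ^^ Suc k) a" if "k < n" for k
    using un u[of "Suc k"] that by (cases "Suc k = n") auto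
  have "\<delta> (u i) = 0" if i: "i < n" for i
  proof (rule det_kernel[OF wronskian_K_basis _ i])
    fix k assume k: "k < n"
    have "(\<delta> ^^ Suc k) a = \<delta> (\<Sum>i<n. (\<delta> ^^ k) (K_basis i) * u i)" using u[OF k] by simp
    also have "\<dots> = (\<Sum>i<n. (\<delta> ^^ Suc k) (K_basis i) * u i) + (\<Sum>i<n. (\<delta> ^^ k) (K_basis i) * \<delta> (u i))"
      by (simp add: delta_sum delta_mult sum.distrib)
    finally show "(\<Sum>i<n. (\<delta> ^^ k) (K_basis i) * \<delta> (u i)) = 0" using u'[OF k] by simp
  qed
  then have "\<forall>i. \<exists>b. i < n \<longrightarrow> u i = \<iota> b"
    using Const_eq by (auto simp: Const_def)
  then obtain c where c: "\<And>i. i < n \<Longrightarrow> u i = \<iota> (c i)" by metis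
  have "a = (\<Sum>i<n. \<iota> (c i) * K_basis i)"
    using u[of 0] c by (simp add: mult.commute)
  then show ?thesis by blast
qed

lemma K_basis_spans_poly: "\<exists>r. u = (\<Sum>i<n. smult (K_basis i) (map_poly \<iota> (r i)))"
proof (induction u)
  case 0
  show ?case by (rule exI[of _ "\<lambda>_. 0"]) simp
next
  case (pCons a u)
  then obtain r where r: "u = (\<Sum>i<n. smult (K_basis i) (map_poly \<iota> (r i)))" by blast
  obtain c where c: "a = (\<Sum>i<n. \<iota> (c i) * K_basis i)" using K_basis_spans by blast
  have "pCons a u = [:a:] + pCons 0 u" by simp
  also have "\<dots> = (\<Sum>i<n. smult (K_basis i) (map_poly \<iota> (pCons (c i) (r i))))"
    unfolding r c
    by (intro poly_eqI)
      (simp add: coeff_sum coeff_pCons mult.commute split: nat.splits)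
  finally show ?case by (intro exI)
qed

lemma R_basis_spans: "\<exists>r. f = (\<Sum>i<n. \<Sum>j<n. subst_G (r i j) * monom (K_basis i) j)"
proof -
  have "\<forall>j. \<exists>r. rho f j = (\<Sum>i<n. smult (K_basis i) (map_poly \<iota> (r i)))"
    using K_basis_spans_poly by blast
  then obtain r where r: "\<And>j. rho f j = (\<Sum>i<n. smult (K_basis i) (map_poly \<iota> (r j i)))" by metis
  have "f = (\<Sum>j<n. (rho f j \<circ>\<^sub>p G) * monom 1 j)" by (rule rho_expands)
  also have "\<dots> = (\<Sum>j<n. \<Sum>i<n. subst_G (r j i) * monom (K_basis i) j)"
  proof (intro sum.cong refl)
    fix j
    have "smult b (subst_G q) * monom 1 j = subst_G q * monom b j" for b q
      by (simp add: smult_monom flip: mult_smult_right)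
    then show "(rho f j \<circ>\<^sub>p G) * monom 1 j = (\<Sum>i<n. subst_G (r j i) * monom (K_basis i) j)"
      by (simp only: r pcompose_sum pcompose_smult sum_distrib_right)
  qed
  also have "\<dots> = (\<Sum>i<n. \<Sum>j<n. subst_G (r j i) * monom (K_basis i) j)" by (rule sum.swap)
  finally show ?thesis by (intro exI[of _ "\<lambda>i j. r j i"])
qed

section \<open>Splittings and the reduced norm\<close>

definition tau :: "nat \<Rightarrow> nat \<Rightarrow> 'f closure" where
  "tau m s = embed_Kx (rho (monom 1 m) s)"

lemma tau_small: "j < n \<Longrightarrow> s < n \<Longrightarrow> tau j s = (if j = s then 1 else 0)"
  by (simp add: tau_def rho_monom)

lemma mat_L_monom:
  assumes "k < n" "s < n"
  shows "mat_L (monom a j) $$ (k, s) =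
    (\<Sum>l\<le>k. of_nat (k choose l) * embed_K ((\<delta> ^^ l) a) * tau (k - l + j) s)"
proof -
  have "monom 1 k \<odot> monom a j =
      (\<Sum>l\<le>k. ([:of_nat (k choose l) * (\<delta> ^^ l) a:] \<circ>\<^sub>p G) * monom 1 (k - l + j))"
    unfolding skew_monom_left tt_pow_leibniz smult_1_left
    by (intro sum.cong refl) (simp add: map_poly_monom mult_monom smult_monom of_nat_poly)
  then have "mat_L (monom a j) $$ (k, s) =
      embed_Kx (\<Sum>l\<le>k. [:of_nat (k choose l) * (\<delta> ^^ l) a:] * rho (monom 1 (k - l + j)) s)"
    using assms by (simp only: mat_L_index rho_sum rho_mult)
  also have "\<dots> = (\<Sum>l\<le>k. of_nat (k choose l) * embed_K ((\<delta> ^^ l) a) * tau (k - l + j) s)"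
    unfolding embed_Kx.hom_sum embed_Kx.hom_mult tau_def
    by (intro sum.cong refl) (simp add: embed_K.hom_mult embed_K.hom_of_nat)
  finally show ?thesis .
qed

text \<open>In row k the term l = k involves only t^j with j < n, whose coordinates are unit
  vectors, and gives \<open>mu k s\<close>; the other terms use \<open>mu l\<close> with l < k. So
  the matrix entries depend on mu through a unipotent triangular system, and mu depends on la
  through the Wronskian matrix.\<close>

lemma lincomb_mat_L_monom:
  assumes ks: "k < n" "s < n" and mu: "\<And>l j. l < n \<Longrightarrow> j < n \<Longrightarrow> mu l j = (\<Sum>i<n. embed_K ((\<delta> ^^ l) (K_basis i)) * la i j)"
  shows "(\<Sum>i<n. \<Sum>j<n. la i j * mat_L (monom (K_basis i) j) $$ (k, s)) =
    mu k s + (\<Sum>l<k. of_nat (k choose l) * (\<Sum>j<n. mu l j * tau (k - l + j) s))"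
proof -
  have "(\<Sum>i<n. \<Sum>j<n. la i j * mat_L (monom (K_basis i) j) $$ (k, s)) =
      (\<Sum>i<n. \<Sum>j<n. \<Sum>l\<le>k. of_nat (k choose l) * (embed_K ((\<delta> ^^ l) (K_basis i)) * la i j * tau (k - l + j) s))"
    using ks by (simp add: mat_L_monom sum_distrib_left ac_simps)
  also have "\<dots> = (\<Sum>i<n. \<Sum>l\<le>k. \<Sum>j<n. of_nat (k choose l) * (embed_K ((\<delta> ^^ l) (K_basis i)) * la i j * tau (k - l + j) s))"
    by (rule sum.cong[OF refl], rule sum.swap)
  also have "\<dots> = (\<Sum>l\<le>k. \<Sum>i<n. \<Sum>j<n. of_nat (k choose l) * (embed_K ((\<delta> ^^ l) (K_basis i)) * la i j * tau (k - l + j) s))"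
    by (rule sum.swap)
  also have "\<dots> = (\<Sum>l\<le>k. of_nat (k choose l) * (\<Sum>j<n. mu l j * tau (k - l + j) s))"
  proof (intro sum.cong refl)
    fix l assume "l \<in> {..k}"
    then have l: "l < n" using ks by simp
    have "(\<Sum>i<n. \<Sum>j<n. of_nat (k choose l) * (embed_K ((\<delta> ^^ l) (K_basis i)) * la i j * tau (k - l + j) s)) =
        (\<Sum>j<n. \<Sum>i<n. of_nat (k choose l) * (embed_K ((\<delta> ^^ l) (K_basis i)) * la i j * tau (k - l + j) s))"
      by (rule sum.swap)
    also have "\<dots> = (\<Sum>j<n. of_nat (k choose l) * (mu l j * tau (k - l + j) s))"
      using l by (intro sum.cong refl) (simp add: mu sum_distrib_left sum_distrib_right)
    finally show "(\<Sum>i<n. \<Sum>j<n. of_nat (k choose l) * (embed_K ((\<delta> ^^ l) (K_basis i)) * la i j * tau (k - l + j) s)) =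
        of_nat (k choose l) * (\<Sum>j<n. mu l j * tau (k - l + j) s)"
      by (simp add: sum_distrib_left)
  qed
  also have "\<dots> = (\<Sum>j<n. mu k j * tau j s) +
      (\<Sum>l<k. of_nat (k choose l) * (\<Sum>j<n. mu l j * tau (k - l + j) s))"
    by (simp add: lessThan_Suc_atMost[symmetric] add.commute)
  also have "(\<Sum>j<n. mu k j * tau j s) = (\<Sum>j<n. if j = s then mu k s else 0)"
    using ks by (intro sum.cong refl) (auto simp: tau_small)
  also have "\<dots> = mu k s" using ks by simp
  finally show ?thesis .
qed

lemma wronskian_embed_K: "det (mat n n (\<lambda>(l, i). embed_K ((\<delta> ^^ l) (K_basis i)))) \<noteq> 0"
proof -
  have "mat n n (\<lambda>(l, i). embed_K ((\<delta> ^^ l) (K_basis i))) = map_mat embed_K (mat n n (\<lambda>(l, i). (\<delta> ^^ l) (K_basis i)))"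
    by (rule eq_matI) auto
  then show ?thesis using wronskian_K_basis by simp
qed

text \<open>Forward substitution yields mu, and Cramer's rule with the Wronskian matrix then
  recovers la for each j.\<close>

lemma mat_L_monom_spans:
  "\<exists>la. \<forall>k<n. \<forall>s<n. (\<Sum>i<n. \<Sum>j<n. la i j * mat_L (monom (K_basis i) j) $$ (k, s)) = Y k s"
proof -
  obtain mu where mu: "\<And>k s. k < n \<Longrightarrow>
      mu k s + (\<Sum>l<k. of_nat (k choose l) * (\<Sum>j<n. mu l j * tau (k - l + j) s)) = Y k s"
    using exists_triangular_solution[of n "\<lambda>k s l m. of_nat (k choose l) * (\<Sum>j<n. m j * tau (k - l + j) s)" Y]
    by blast
  have "\<forall>j. \<exists>c. \<forall>l<n. (\<Sum>i<n. embed_K ((\<delta> ^^ l) (K_basis i)) * c i) = mu l j"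
    by (rule allI, rule det_solve[OF wronskian_embed_K])
  from choice[OF this] obtain c
    where c': "\<forall>j. \<forall>l<n. (\<Sum>i<n. embed_K ((\<delta> ^^ l) (K_basis i)) * c j i) = mu l j" ..
  have c: "mu l j = (\<Sum>i<n. embed_K ((\<delta> ^^ l) (K_basis i)) * c j i)" if "l < n" for l j
    using c'[rule_format, OF that, symmetric] .
  have "(\<Sum>i<n. \<Sum>j<n. c j i * mat_L (monom (K_basis i) j) $$ (k, s)) = Y k s" if "k < n" "s < n" for k s
    using lincomb_mat_L_monom[OF that c] mu[OF that(1)] by simp
  then show ?thesis by (intro exI[of _ "\<lambda>i j. c j i"]) blast
qed

text \<open>The triangular relation kills mu row by row, and the nonzero Wronskian then kills
  la.\<close>

lemma mat_L_monom_independent: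
  assumes 0: "\<And>k s. k < n \<Longrightarrow> s < n \<Longrightarrow> (\<Sum>i<n. \<Sum>j<n. la i j * mat_L (monom (K_basis i) j) $$ (k, s)) = 0"
    and ij: "i < n" "j < n"
  shows "la i j = 0"
proof -
  define mu where "mu l j = (\<Sum>i<n. embed_K ((\<delta> ^^ l) (K_basis i)) * la i j)" for l j
  have "\<forall>s<n. mu k s = 0" if "k < n" for k
    using that
  proof (induction k rule: less_induct)
    case (less k)
    have "mu l j = 0" if "l < k" "j < n" for l j using less that by simp
    then have "(\<Sum>l<k. of_nat (k choose l) * (\<Sum>j<n. mu l j * tau (k - l + j) s)) = 0" for s
      by simp
    then show ?case
      using lincomb_mat_L_monom[OF less.prems _ mu_def] 0[OF less.prems] by simp
  qed
  then show ?thesis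
    by (intro det_kernel[OF wronskian_embed_K _ ij(1), of "\<lambda>i. la i j"]) (simp add: mu_def ij(2))
qed

section \<open>The basis of n^2 elements and the comparison of splittings\<close>

definition R_basis :: "nat \<Rightarrow> 'k poly" where
  "R_basis k = monom (K_basis (k mod n)) (k div n)"

lemma mat_L_R_basis_spans:
  assumes "A \<in> carrier_mat n n"
  shows "\<exists>la. A = mat_lincomb n {..<n * n} la (\<lambda>k. mat_L (R_basis k))"
proof -
  obtain la where l: "\<And>k s. k < n \<Longrightarrow> s < n \<Longrightarrow>
      (\<Sum>i<n. \<Sum>j<n. la i j * mat_L (monom (K_basis i) j) $$ (k, s)) = A $$ (k, s)"
    using mat_L_monom_spans[of "\<lambda>k s. A $$ (k, s)"] by blast
  have "A = mat_lincomb n {..<n * n} (\<lambda>k. la (k mod n) (k div n)) (\<lambda>k. mat_L (R_basis k))"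
  proof (rule eq_matI)
    fix k s assume "k < dim_row (mat_lincomb n {..<n * n} (\<lambda>k. la (k mod n) (k div n)) (\<lambda>k. mat_L (R_basis k)))"
      "s < dim_col (mat_lincomb n {..<n * n} (\<lambda>k. la (k mod n) (k div n)) (\<lambda>k. mat_L (R_basis k)))"
    then have ks: "k < n" "s < n" by (auto simp: mat_lincomb_def)
    then show "A $$ (k, s) = mat_lincomb n {..<n * n} (\<lambda>k. la (k mod n) (k div n)) (\<lambda>k. mat_L (R_basis k)) $$ (k, s)"
      using sum_mod_div[OF n_pos, of "\<lambda>i j. la i j * mat_L (monom (K_basis i) j) $$ (k, s)"] l[OF ks]
      by (simp add: mat_lincomb_index R_basis_def)
  qed (use assms in \<open>auto simp: mat_lincomb_def\<close>)
  then show ?thesis by blast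
qed

lemma mat_L_R_basis_independent:
  assumes eq: "mat_lincomb n {..<n * n} la (\<lambda>k. mat_L (R_basis k)) = mat_lincomb n {..<n * n} la' (\<lambda>k. mat_L (R_basis k))"
    and k: "k < n * n"
  shows "la k = la' k"
proof -
  define d where "d i j = la (j * n + i) - la' (j * n + i)" for i j
  have d: "d (k mod n) (k div n) = la k - la' k" for k
    unfolding d_def div_mult_mod_eq ..
  have "(\<Sum>i<n. \<Sum>j<n. d i j * mat_L (monom (K_basis i) j) $$ (a, s)) = 0" if as: "a < n" "s < n" for a s
  proof -
    have "mat_lincomb n {..<n * n} la (\<lambda>k. mat_L (R_basis k)) $$ (a, s) =
        mat_lincomb n {..<n * n} la' (\<lambda>k. mat_L (R_basis k)) $$ (a, s)" using eq by simp
    then have "(\<Sum>k<n * n. (la k - la' k) * mat_L (R_basis k) $$ (a, s)) = 0"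
      using as by (simp add: mat_lincomb_index left_diff_distrib sum_subtractf)
    then show ?thesis
      using sum_mod_div[OF n_pos, of "\<lambda>i j. d i j * mat_L (monom (K_basis i) j) $$ (a, s)"]
      by (simp add: d R_basis_def)
  qed
  moreover have "k mod n < n" "k div n < n" using k by (auto simp: less_mult_imp_div_less)
  ultimately have "d (k mod n) (k div n) = 0" by (rule mat_L_monom_independent)
  then show ?thesis by (simp add: d)
qed

text \<open>For an arbitrary homomorphism, because it is applied both to \<open>Theta\<close> and to
  the splitting that is compared with it.\<close>

lemma hom_finsum_Q:
  fixes a :: "'i \<Rightarrow> 'f poly fract"
  assumes hom: "\<phi> \<in> Ring.ring_hom Q (ring_mat TYPE('f closure) m ())"
    and sc: "\<And>z. \<phi> (\<sigma> z) = to_ac z \<cdot>\<^sub>m 1\<^sub>m m"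
    and "finite I" "\<And>k. k \<in> I \<Longrightarrow> B k \<in> carrier Q"
  shows "(\<Oplus>\<^bsub>Q\<^esub>k\<in>I. \<sigma> (a k) \<otimes>\<^bsub>Q\<^esub> B k) \<in> carrier Q"
    and "\<phi> (\<Oplus>\<^bsub>Q\<^esub>k\<in>I. \<sigma> (a k) \<otimes>\<^bsub>Q\<^esub> B k) = mat_lincomb m I (\<lambda>k. to_ac (a k)) (\<lambda>k. \<phi> (B k))"
proof -
  interpret Q: abelian_monoid Q by (rule abelian_monoid_Q)
  have closed: "\<phi> U \<in> carrier_mat m m" if "U \<in> carrier Q" for U
    using ring_hom_closed[OF hom that] by (simp add: ring_mat_simps)
  have mult: "\<phi> (U \<otimes>\<^bsub>Q\<^esub> V) = \<phi> U * \<phi> V" if "U \<in> carrier Q" "V \<in> carrier Q" for U V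
    using ring_hom_mult[OF hom that] by (simp add: ring_mat_simps)
  have add: "\<phi> (U \<oplus>\<^bsub>Q\<^esub> V) = \<phi> U + \<phi> V" if "U \<in> carrier Q" "V \<in> carrier Q" for U V
    using ring_hom_add[OF hom that] by (simp add: ring_mat_simps)
  \<comment> \<open>\<open>ring_hom\<close> does not include preservation of 0, so it is obtained by
    cancelling in the image of 0 + 0 = 0.\<close>
  have zero: "\<phi> \<zero>\<^bsub>Q\<^esub> = 0\<^sub>m m m"
  proof -
    have Z: "\<phi> \<zero>\<^bsub>Q\<^esub> \<in> carrier_mat m m" by (simp add: closed)
    have "\<phi> \<zero>\<^bsub>Q\<^esub> = \<phi> \<zero>\<^bsub>Q\<^esub> + \<phi> \<zero>\<^bsub>Q\<^esub>" using add[of "\<zero>\<^bsub>Q\<^esub>" "\<zero>\<^bsub>Q\<^esub>"] by simp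
    then have "\<phi> \<zero>\<^bsub>Q\<^esub> $$ (i, j) = \<phi> \<zero>\<^bsub>Q\<^esub> $$ (i, j) + \<phi> \<zero>\<^bsub>Q\<^esub> $$ (i, j)" if "i < m" "j < m" for i j
      using Z that by (metis carrier_matD index_add_mat(1))
    then have "\<phi> \<zero>\<^bsub>Q\<^esub> $$ (i, j) = 0" if "i < m" "j < m" for i j
      using that by (metis add_cancel_right_right)
    then show ?thesis using Z by (intro eq_matI) auto
  qed
  have summand: "\<sigma> (a k) \<otimes>\<^bsub>Q\<^esub> B k \<in> carrier Q" if "B k \<in> carrier Q" for k
    using that by (simp add: Q_closed cq_scalar_carrier)
  have sm: "\<phi> (\<sigma> (a k) \<otimes>\<^bsub>Q\<^esub> B k) = to_ac (a k) \<cdot>\<^sub>m \<phi> (B k)" if "B k \<in> carrier Q" for k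
    unfolding mult[OF cq_scalar_carrier that] sc
    using mult_smult_assoc_mat[OF one_carrier_mat closed[OF that]] left_mult_one_mat[OF closed[OF that]]
    by metis
  have "(\<Oplus>\<^bsub>Q\<^esub>k\<in>I. \<sigma> (a k) \<otimes>\<^bsub>Q\<^esub> B k) \<in> carrier Q \<and>
    \<phi> (\<Oplus>\<^bsub>Q\<^esub>k\<in>I. \<sigma> (a k) \<otimes>\<^bsub>Q\<^esub> B k) = mat_lincomb m I (\<lambda>k. to_ac (a k)) (\<lambda>k. \<phi> (B k))"
    using assms(3,4)
  proof (induction I rule: finite_induct)
    case empty
    then show ?case by (simp add: zero mat_lincomb_empty)
  next
    case (insert k I)
    have Bk: "B k \<in> carrier Q" using insert.prems by simp
    have eq: "(\<Oplus>\<^bsub>Q\<^esub>k\<in>insert k I. \<sigma> (a k) \<otimes>\<^bsub>Q\<^esub> B k) =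
        (\<sigma> (a k) \<otimes>\<^bsub>Q\<^esub> B k) \<oplus>\<^bsub>Q\<^esub> (\<Oplus>\<^bsub>Q\<^esub>k\<in>I. \<sigma> (a k) \<otimes>\<^bsub>Q\<^esub> B k)"
      using insert.hyps insert.prems summand by (intro Q.finsum_insert) auto
    show ?case
      unfolding eq using insert Bk
      by (simp add: Q_closed summand add sm mat_lincomb_insert closed)
  qed
  then show "(\<Oplus>\<^bsub>Q\<^esub>k\<in>I. \<sigma> (a k) \<otimes>\<^bsub>Q\<^esub> B k) \<in> carrier Q"
    "\<phi> (\<Oplus>\<^bsub>Q\<^esub>k\<in>I. \<sigma> (a k) \<otimes>\<^bsub>Q\<^esub> B k) = mat_lincomb m I (\<lambda>k. to_ac (a k)) (\<lambda>k. \<phi> (B k))"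
    by auto
qed


abbreviation Q_basis :: "nat \<Rightarrow> ('k poly \<times> 'f poly) set" where
  "Q_basis k \<equiv> C (R_basis k) 1"

lemma Q_basis_carrier: "Q_basis k \<in> carrier Q"
  by (simp add: C_in_carrier)

lemma Theta_Q_basis: "Theta (Q_basis k) = mat_L (R_basis k)"
  by (simp add: Theta_C) (rule eq_matI, auto)

lemma Q_basis_spans:
  assumes U: "U \<in> carrier Q"
  shows "\<exists>a. U = (\<Oplus>\<^bsub>Q\<^esub>k\<in>{..<n * n}. \<sigma> (a k) \<otimes>\<^bsub>Q\<^esub> Q_basis k)"
proof -
  obtain f q where fq: "U = C f q" "q \<noteq> 0" using U by (auto simp: carrier_Q)
  obtain r where r: "f = (\<Sum>i<n. \<Sum>j<n. subst_G (r i j) * monom (K_basis i) j)"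
    using R_basis_spans by blast
  define b where "b k = r (k mod n) (k div n)" for k
  define a where "a k = Fract (b k) q" for k
  have "f = (\<Sum>k<n * n. subst_G (b k) * R_basis k)"
    using r sum_mod_div[OF n_pos, of "\<lambda>i j. subst_G (r i j) * monom (K_basis i) j"]
    by (simp add: b_def R_basis_def)
  then have "mat_L f = mat_lincomb n {..<n * n} (\<lambda>k. embed_Fx (b k)) (\<lambda>k. mat_L (R_basis k))"
    by (simp only: mat_L_sum finite_lessThan)
  then have "Theta U = mat_lincomb n {..<n * n} (\<lambda>k. to_ac (a k)) (\<lambda>k. Theta (Q_basis k))"
    unfolding fq(1) Theta_C[OF fq(2)] Theta_Q_basis
    by (simp add: smult_mat_lincomb a_def Fract_conv_to_fract divide_inverse mult.commute)
  then have "Theta U = Theta (\<Oplus>\<^bsub>Q\<^esub>k\<in>{..<n * n}. \<sigma> (a k) \<otimes>\<^bsub>Q\<^esub> Q_basis k)"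
    by (simp add: hom_finsum_Q(2)[OF Theta_ring_hom Theta_scalar] Q_basis_carrier)
  then have "U = (\<Oplus>\<^bsub>Q\<^esub>k\<in>{..<n * n}. \<sigma> (a k) \<otimes>\<^bsub>Q\<^esub> Q_basis k)"
    by (rule Theta_inj[OF U hom_finsum_Q(1)[OF Theta_ring_hom Theta_scalar], rotated 2])
      (simp_all add: Q_basis_carrier)
  then show ?thesis by blast
qed

text \<open>Coefficients over F(x) exist by \<open>Q_basis_spans\<close>; their uniqueness is
  inherited from the independence of the images over the algebraic closure.\<close>

lemma Theta_splitting: "is_splitting Q \<sigma> n Theta"
proof -
  let ?bs = "map Q_basis [0..<n * n]"
  let ?M = "ring_mat TYPE('f closure) n ()"
  have len: "length ?bs = n * n" by simp
  have fin: "(\<Oplus>\<^bsub>Q\<^esub>i\<in>{..<length ?bs}. \<sigma> (cs ! i) \<otimes>\<^bsub>Q\<^esub> ?bs ! i) =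
      (\<Oplus>\<^bsub>Q\<^esub>k\<in>{..<n * n}. \<sigma> (cs ! k) \<otimes>\<^bsub>Q\<^esub> Q_basis k)" for cs
  proof -
    interpret Q: abelian_monoid Q by (rule abelian_monoid_Q)
    show ?thesis
      by (rule Q.finsum_cong') (simp_all add: Q_closed cq_scalar_carrier Q_basis_carrier)
  qed
  have Theta_fin: "Theta (\<Oplus>\<^bsub>Q\<^esub>k\<in>{..<n * n}. \<sigma> (a k) \<otimes>\<^bsub>Q\<^esub> Q_basis k) =
      mat_lincomb n {..<n * n} (\<lambda>k. to_ac (a k)) (\<lambda>k. mat_L (R_basis k))" for a
    by (simp add: hom_finsum_Q(2)[OF Theta_ring_hom Theta_scalar] Q_basis_carrier Theta_Q_basis)
  have "is_algebra_basis Q \<sigma> ?bs"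
    unfolding is_algebra_basis_def fin
  proof (intro conjI ballI)
    show "set ?bs \<subseteq> carrier Q" by (auto simp: Q_basis_carrier)
    fix U assume U: "U \<in> carrier Q"
    obtain a where a: "U = (\<Oplus>\<^bsub>Q\<^esub>k\<in>{..<n * n}. \<sigma> (a k) \<otimes>\<^bsub>Q\<^esub> Q_basis k)"
      using Q_basis_spans[OF U] by blast
    show "\<exists>!cs. length cs = length ?bs \<and>
        U = (\<Oplus>\<^bsub>Q\<^esub>k\<in>{..<n * n}. \<sigma> (cs ! k) \<otimes>\<^bsub>Q\<^esub> Q_basis k)"
    proof (rule ex1I)
      show "length (map a [0..<n * n]) = length ?bs \<and>
          U = (\<Oplus>\<^bsub>Q\<^esub>k\<in>{..<n * n}. \<sigma> (map a [0..<n * n] ! k) \<otimes>\<^bsub>Q\<^esub> Q_basis k)"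
      proof -
        interpret Q: abelian_monoid Q by (rule abelian_monoid_Q)
        have "(\<Oplus>\<^bsub>Q\<^esub>k\<in>{..<n * n}. \<sigma> (a k) \<otimes>\<^bsub>Q\<^esub> Q_basis k) =
            (\<Oplus>\<^bsub>Q\<^esub>k\<in>{..<n * n}. \<sigma> (map a [0..<n * n] ! k) \<otimes>\<^bsub>Q\<^esub> Q_basis k)"
          by (rule Q.finsum_cong') (simp_all add: Q_closed cq_scalar_carrier Q_basis_carrier)
        then show ?thesis using a by simp
      qed
      fix cs assume cs: "length cs = length ?bs \<and>
          U = (\<Oplus>\<^bsub>Q\<^esub>k\<in>{..<n * n}. \<sigma> (cs ! k) \<otimes>\<^bsub>Q\<^esub> Q_basis k)"
      then have "U = (\<Oplus>\<^bsub>Q\<^esub>k\<in>{..<n * n}. \<sigma> (cs ! k) \<otimes>\<^bsub>Q\<^esub> Q_basis k)" by (rule conjunct2)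
      from arg_cong[OF trans[OF this[symmetric] a], of Theta]
      have "mat_lincomb n {..<n * n} (\<lambda>k. to_ac (cs ! k)) (\<lambda>k. mat_L (R_basis k)) =
          mat_lincomb n {..<n * n} (\<lambda>k. to_ac (a k)) (\<lambda>k. mat_L (R_basis k))"
        unfolding Theta_fin .
      from mat_L_R_basis_independent[OF this] have "cs ! k = a k" if "k < n * n" for k
        using that by simp
      then show "cs = map a [0..<n * n]" using cs by (intro nth_equalityI) auto
    qed
  qed
  moreover have "is_algebra_basis ?M (\<lambda>l. l \<cdot>\<^sub>m 1\<^sub>m n) (map Theta ?bs)"
  proof -
    have fin: "(\<Oplus>\<^bsub>?M\<^esub>i\<in>{..<length (map Theta ?bs)}. (cs ! i \<cdot>\<^sub>m 1\<^sub>m n) \<otimes>\<^bsub>?M\<^esub> map Theta ?bs ! i) =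
        mat_lincomb n {..<n * n} (\<lambda>k. cs ! k) (\<lambda>k. mat_L (R_basis k))" for cs
      by (subst finsum_ring_mat) (auto simp: Theta_Q_basis intro!: mat_lincomb_cong)
    show ?thesis
      unfolding is_algebra_basis_def fin
    proof (intro conjI ballI)
      show "set (map Theta ?bs) \<subseteq> carrier ?M" by (auto simp: ring_mat_simps Theta_Q_basis)
      fix A assume "A \<in> carrier ?M"
      then have "A \<in> carrier_mat n n" by (simp add: ring_mat_simps)
      from mat_L_R_basis_spans[OF this] obtain a where a: "A = mat_lincomb n {..<n * n} a (\<lambda>k. mat_L (R_basis k))"
        by blast
      show "\<exists>!cs. length cs = length (map Theta ?bs) \<and>
          A = mat_lincomb n {..<n * n} (\<lambda>k. cs ! k) (\<lambda>k. mat_L (R_basis k))"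
      proof (rule ex1I)
        show "length (map a [0..<n * n]) = length (map Theta ?bs) \<and>
            A = mat_lincomb n {..<n * n} (\<lambda>k. map a [0..<n * n] ! k) (\<lambda>k. mat_L (R_basis k))"
          using a by (auto intro!: mat_lincomb_cong)
        fix cs assume cs: "length cs = length (map Theta ?bs) \<and>
            A = mat_lincomb n {..<n * n} (\<lambda>k. cs ! k) (\<lambda>k. mat_L (R_basis k))"
        then have "A = mat_lincomb n {..<n * n} (\<lambda>k. cs ! k) (\<lambda>k. mat_L (R_basis k))" by (rule conjunct2)
        note trans[OF this[symmetric] a]
        from mat_L_R_basis_independent[OF this] show "cs = map a [0..<n * n]"
          using cs by (intro nth_equalityI) auto
      qed
    qed
  qed
  ultimately show ?thesis
    unfolding is_splitting_def using Theta_ring_hom Theta_scalar by blast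
qed

text \<open>Matrices of size 0 form the zero ring, whose only basis is empty. Then the quotient ring
  would be zero as well, although \<open>Theta\<close> separates 1 from 0.\<close>

lemma splitting_pos:
  assumes "is_splitting Q \<sigma> m \<phi>"
  shows "m > 0"
proof (rule ccontr)
  assume "\<not> m > 0"
  then have m: "m = 0" by simp
  obtain bs where bs: "is_algebra_basis Q \<sigma> bs"
      "is_algebra_basis (ring_mat TYPE('f closure) 0 ()) (\<lambda>l. l \<cdot>\<^sub>m 1\<^sub>m 0) (map \<phi> bs)"
    using assms unfolding is_splitting_def m by blast
  let ?M = "ring_mat TYPE('f closure) 0 ()"
  interpret M: ring ?M by (rule ring_mat)
  have zero: "A = B" if "A \<in> carrier ?M" "B \<in> carrier ?M" for A B
    using that by (intro eq_matI) (auto simp: ring_mat_simps)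
  have closed: "(\<Oplus>\<^bsub>?M\<^esub>i\<in>{..<length (map \<phi> bs)}. (cs ! i \<cdot>\<^sub>m 1\<^sub>m 0) \<otimes>\<^bsub>?M\<^esub> map \<phi> bs ! i) \<in> carrier ?M" for cs
  proof (rule M.finsum_closed, rule Pi_I)
    fix i assume "i \<in> {..<length (map \<phi> bs)}"
    then have "map \<phi> bs ! i \<in> carrier ?M"
      using bs(2) unfolding is_algebra_basis_def by (meson lessThan_iff nth_mem subsetD)
    then show "(cs ! i \<cdot>\<^sub>m 1\<^sub>m 0) \<otimes>\<^bsub>?M\<^esub> map \<phi> bs ! i \<in> carrier ?M"
      unfolding ring_mat_simps by (rule mult_carrier_mat[OF smult_carrier_mat[OF one_carrier_mat]])
  qed
  have "\<exists>!cs. length cs = length (map \<phi> bs) \<and> \<zero>\<^bsub>?M\<^esub> =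
      (\<Oplus>\<^bsub>?M\<^esub>i\<in>{..<length (map \<phi> bs)}. (cs ! i \<cdot>\<^sub>m 1\<^sub>m 0) \<otimes>\<^bsub>?M\<^esub> map \<phi> bs ! i)"
    using bs(2) unfolding is_algebra_basis_def by blast
  then have ex1: "\<exists>!cs :: 'f closure list. length cs = length (map \<phi> bs)"
    using zero[OF M.zero_closed closed] by simp
  \<comment> \<open>All coefficient lists of the right length represent the zero matrix, so
    uniqueness identifies the list of zeros with the list of ones.\<close>
  have "replicate (length (map \<phi> bs)) (0 :: 'f closure) = replicate (length (map \<phi> bs)) 1"
    using ex1 by (metis length_replicate)
  then have "bs = []" by simp
  then have "\<exists>!cs :: 'f poly fract list. cs = [] \<and> \<one>\<^bsub>Q\<^esub> = \<zero>\<^bsub>Q\<^esub>"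
    using bs(1) Q_closed(4) abelian_monoid.finsum_empty[OF abelian_monoid_Q]
    unfolding is_algebra_basis_def by force
  then have "Theta \<one>\<^bsub>Q\<^esub> = Theta \<zero>\<^bsub>Q\<^esub>" by auto
  then have "(1\<^sub>m n :: 'f closure mat) $$ (0, 0) = 0\<^sub>m n n $$ (0, 0)"
    by (simp only: Theta_one Theta_zero)
  then show False by simp
qed

text \<open>Extending \<open>Theta V\<close> to \<phi> V linearly over the algebraic closure gives
  an algebra homomorphism \<psi> from n by n onto m by m matrices. By Skolem--Noether it preserves
  determinants.\<close>

lemma splitting_det:
  assumes spl: "is_splitting Q \<sigma> m \<phi>" and U: "U \<in> carrier Q"
  shows "det (\<phi> U) = det (Theta U)"
proof -
  have hom: "\<phi> \<in> Ring.ring_hom Q (ring_mat TYPE('f closure) m ())"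
    and sc: "\<And>z. \<phi> (\<sigma> z) = to_ac z \<cdot>\<^sub>m 1\<^sub>m m"
    using spl unfolding is_splitting_def by auto
  have closed: "\<phi> V \<in> carrier_mat m m" if "V \<in> carrier Q" for V
    using ring_hom_closed[OF hom that] by (simp add: ring_mat_simps)
  let ?I = "{..<n * n}"
  let ?L = "\<lambda>la. mat_lincomb n ?I la (\<lambda>k. mat_L (R_basis k))"
  let ?L' = "\<lambda>la. mat_lincomb m ?I la (\<lambda>k. \<phi> (Q_basis k))"
  define co where "co A = (SOME la. A = ?L la)" for A
  have co: "A = ?L (co A)" if "A \<in> carrier_mat n n" for A
    unfolding co_def using mat_L_R_basis_spans[OF that] by (rule someI_ex)
  define \<psi> where "\<psi> A = ?L' (co A)" for A
  have psi: "\<psi> (?L la) = ?L' la" for la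
    unfolding \<psi>_def
  proof (rule mat_lincomb_cong)
    fix k assume "k \<in> ?I"
    then show "co (?L la) k = la k"
      using mat_L_R_basis_independent[OF co[OF mat_lincomb_carrier, symmetric]] by simp
  qed simp
  have psi_closed: "\<psi> A \<in> carrier_mat m m" for A
    by (simp add: \<psi>_def)
  have psi_Theta: "\<psi> (Theta V) = \<phi> V" if V: "V \<in> carrier Q" for V
  proof -
    obtain a where a: "V = (\<Oplus>\<^bsub>Q\<^esub>k\<in>?I. \<sigma> (a k) \<otimes>\<^bsub>Q\<^esub> Q_basis k)" using Q_basis_spans[OF V] by blast
    have "Theta V = ?L (\<lambda>k. to_ac (a k))"
      unfolding a by (simp add: hom_finsum_Q(2)[OF Theta_ring_hom Theta_scalar] Q_basis_carrier Theta_Q_basis)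
    moreover have "\<phi> V = ?L' (\<lambda>k. to_ac (a k))"
      unfolding a by (simp add: hom_finsum_Q(2)[OF hom sc] Q_basis_carrier)
    ultimately show ?thesis by (simp add: psi)
  qed
  have psi_add: "\<psi> (A + B) = \<psi> A + \<psi> B" if "A \<in> carrier_mat n n" "B \<in> carrier_mat n n" for A B
  proof -
    have "A + B = ?L (\<lambda>k. co A k + co B k)"
      by (simp only: mat_lincomb_add[symmetric] co[OF that(1), symmetric] co[OF that(2), symmetric])
    then show ?thesis by (simp only: psi) (simp add: \<psi>_def mat_lincomb_add)
  qed
  have psi_smult: "\<psi> (a \<cdot>\<^sub>m A) = a \<cdot>\<^sub>m \<psi> A" if "A \<in> carrier_mat n n" for a A
  proof -
    have "a \<cdot>\<^sub>m A = ?L (\<lambda>k. a * co A k)"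
      by (simp only: smult_mat_lincomb[symmetric] co[OF that, symmetric])
    then show ?thesis by (simp only: psi) (simp add: \<psi>_def smult_mat_lincomb)
  qed
  note lin = linear_mat_lincomb[of n \<psi> m, OF psi_add psi_smult psi_closed]
  \<comment> \<open>Expand both factors in the basis; on products of basis elements \<psi> is
    multiplicative because \<open>Theta\<close> and \<phi> are.\<close>
  have psi_mult: "\<psi> (A * B) = \<psi> A * \<psi> B" if "A \<in> carrier_mat n n" "B \<in> carrier_mat n n" for A B
  proof -
    let ?c = "\<lambda>(i, j). co A i * co B j"
    have "A * B = ?L (co A) * ?L (co B)" using co[OF that(1)] co[OF that(2)] by simp
    also have "\<dots> = mat_lincomb n (?I \<times> ?I) ?c (\<lambda>(i, j). mat_L (R_basis i) * mat_L (R_basis j))"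
      by (rule mat_lincomb_mult) auto
    also have "\<dots> = mat_lincomb n (?I \<times> ?I) ?c (\<lambda>(i, j). Theta (Q_basis i \<otimes>\<^bsub>Q\<^esub> Q_basis j))"
      by (rule mat_lincomb_cong) (auto simp: Theta_mult Q_basis_carrier Theta_Q_basis)
    finally have "\<psi> (A * B) = mat_lincomb m (?I \<times> ?I) ?c (\<lambda>z. \<psi> ((\<lambda>(i, j). Theta (Q_basis i \<otimes>\<^bsub>Q\<^esub> Q_basis j)) z))"
      by (simp only:) (rule lin, auto intro!: Theta_carrier Q_closed Q_basis_carrier)
    also have "\<dots> = mat_lincomb m (?I \<times> ?I) ?c (\<lambda>(i, j). \<phi> (Q_basis i) * \<phi> (Q_basis j))"
      using ring_hom_mult[OF hom Q_basis_carrier Q_basis_carrier]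
      by (intro mat_lincomb_cong) (auto simp: psi_Theta Q_closed Q_basis_carrier ring_mat_simps)
    also have "\<dots> = ?L' (co A) * ?L' (co B)"
      by (rule mat_lincomb_mult[symmetric]) (auto intro!: closed Q_basis_carrier)
    finally show ?thesis by (simp add: \<psi>_def)
  qed
  have psi_one: "\<psi> (1\<^sub>m n) = 1\<^sub>m m"
    using psi_Theta[OF Q_closed(4)] ring_hom_one[OF hom] by (simp add: Theta_one ring_mat_simps)
  \<comment> \<open>The basis \<open>bs\<close> supplied with the splitting \<phi> need not be
    \<open>R_basis\<close>; its images under \<phi> span all m by m matrices, and each is the
    \<psi>-image of the corresponding \<open>Theta\<close> value.\<close>
  have psi_surj: "\<exists>A\<in>carrier_mat n n. \<psi> A = B" if B: "B \<in> carrier_mat m m" for B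
  proof -
    let ?M = "ring_mat TYPE('f closure) m ()"
    obtain bs where bs0: "is_algebra_basis Q \<sigma> bs"
        and bs2: "is_algebra_basis ?M (\<lambda>l. l \<cdot>\<^sub>m 1\<^sub>m m) (map \<phi> bs)"
      using spl unfolding is_splitting_def by blast
    have "set bs \<subseteq> carrier Q" using bs0 unfolding is_algebra_basis_def by (rule conjunct1)
    note bs = this bs2
    have bsi: "bs ! i \<in> carrier Q" if "i < length bs" for i using bs(1) that by auto
    obtain cs where cs: "B = (\<Oplus>\<^bsub>?M\<^esub>i\<in>{..<length (map \<phi> bs)}. (cs ! i \<cdot>\<^sub>m 1\<^sub>m m) \<otimes>\<^bsub>?M\<^esub> map \<phi> bs ! i)"
      using bs(2) B unfolding is_algebra_basis_def ring_mat_simps by blast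
    have "B = mat_lincomb m {..<length bs} (\<lambda>i. cs ! i) (\<lambda>i. map \<phi> bs ! i)"
      unfolding cs by (subst finsum_ring_mat) (auto intro!: closed bsi)
    also have "\<dots> = mat_lincomb m {..<length bs} (\<lambda>i. cs ! i) (\<lambda>i. \<psi> (Theta (bs ! i)))"
      by (rule mat_lincomb_cong) (auto simp: psi_Theta bsi)
    also have "\<dots> = \<psi> (mat_lincomb n {..<length bs} (\<lambda>i. cs ! i) (\<lambda>i. Theta (bs ! i)))"
      by (rule lin[symmetric]) (auto intro!: Theta_carrier bsi)
    finally show ?thesis using mat_lincomb_carrier by metis
  qed
  have "det (\<psi> (Theta U)) = det (Theta U)"
    by (rule skolem_noether_det(2)[OF psi_closed psi_add psi_mult psi_smult psi_one psi_surj
          splitting_pos[OF spl] Theta_carrier[OF U]])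
  then show ?thesis by (simp add: psi_Theta U)
qed

text \<open>\<open>Theta\<close> witnesses the value and \<open>splitting_det\<close> makes it the
  only one, so the definite description in \<open>reduced_norm\<close> denotes it.\<close>

lemma dp_norm_eq: "dp_norm \<iota> \<delta> g f = to_fract (Nm f)"
proof -
  have U: "C f 1 \<in> carrier Q" by (simp add: C_in_carrier)
  have "Theta (C f 1) = mat_L f" by (simp add: Theta_C) (rule eq_matI, auto)
  then have det: "det (Theta (C f 1)) = embed_Fx (Nm f)" by (simp add: det_mat_L)
  show ?thesis
    unfolding dp_norm_def reduced_norm_def
  proof (rule the_equality)
    show "\<exists>n \<phi>. is_splitting Q \<sigma> n \<phi> \<and> embed_Fx (Nm f) = det (\<phi> (C f 1))"
      using Theta_splitting det by metis
    fix z assume "\<exists>n \<phi>. is_splitting Q \<sigma> n \<phi> \<and> to_ac z = det (\<phi> (C f 1))"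
    then have "to_ac z = embed_Fx (Nm f)" using splitting_det[OF _ U] det by metis
    then show "z = to_fract (Nm f)" by simp
  qed
qed

end

theorem corollary23:
  fixes \<iota> :: "'f::field \<Rightarrow> 'k::field" and \<delta> :: "'k \<Rightarrow> 'k" and p e m :: nat
    and c :: "nat \<Rightarrow> 'f" and g hh :: "'f poly" and f h :: "'k poly"
  assumes "prime p" and "CHAR('f) = p"
    and "field_hom \<iota>" and "purely_inseparable_of_exponent p \<iota> 1"
    and "algebraic_derivation \<iota> \<delta>" and "Const \<delta> = range \<iota>"
    and "is_minimum_polynomial \<iota> \<delta> g"
    and "g = monom 1 (p ^ e) + (\<Sum>i=1..e. monom (c i) (p ^ (e - i)))"
    and "lead_coeff f = 1" and "degree f = m"
    and "is_min_central_left_multiple \<iota> \<delta> g f h"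
    and "h = subst_center \<iota> \<delta> g hh" and "lead_coeff hh = 1" and "degree hh = m"
  shows "(\<forall>hs :: 'f poly list.
            (\<forall>q \<in> set hs. Factorial_Ring.irreducible q \<and> lead_coeff q = 1) \<and>
            dp_norm \<iota> \<delta> g f = to_fract (prod_list hs) \<longrightarrow>
            (\<exists>fs. length fs = length hs \<and> f = dp_prod_list \<delta> fs \<and>
                  (\<forall>i < length hs. dp_irreducible \<delta> (fs ! i) \<and>
                     dp_norm \<iota> \<delta> g (fs ! i) = to_fract (hs ! i) \<and>
                     degree (fs ! i) = degree (hs ! i)))) \<and>
         (\<forall>hs :: 'f poly list.
            (\<forall>q \<in> set hs. Factorial_Ring.irreducible q \<and> lead_coeff q = 1) \<and> distinct hs \<and>
            dp_norm \<iota> \<delta> g f = to_fract (prod_list hs) \<longrightarrow>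
            card (monic_decompositions \<delta> f) = fact (length hs) \<and>
            bij_betw (map (dp_norm \<iota> \<delta> g)) (monic_decompositions \<delta> f)
              {map to_fract ks | ks. set ks = set hs \<and> distinct ks})"
proof -
  interpret algebraic_dp \<delta> \<iota> p e c g
  proof (intro algebraic_dp.intro derivation.intro algebraic_dp_axioms.intro)
    show "is_derivation \<delta>" using assms(5) by (simp add: algebraic_derivation_def)
  qed (rule assms)+
  have "has_full_bound f"
    unfolding has_full_bound_def
  proof (intro conjI allI impI)
    fix q s assume q: "q \<noteq> 0" "subst_G q = s \<odot> f"
    have "subst_G q \<in> ring_center (dp_ring \<delta>)"
      by (simp add: ring_center_def subst_G_commute)
    moreover have "\<exists>s. subst_G q = s \<otimes>\<^bsub>dp_ring \<delta>\<^esub> f" using q(2) by auto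
    ultimately have "subst_G q \<in> central_left_multiples \<delta> f"
      using q(1) by (simp add: central_left_multiples_def)
    then have "degree h \<le> degree (subst_G q)"
      using assms(11) unfolding is_min_central_left_multiple_def by blast
    \<comment> \<open>Degrees in t are n times degrees in x, and n is positive.\<close>
    then show "degree f \<le> degree q"
      using assms(10,14) by (simp add: assms(12) subst_center_eq degree_subst_G)
  qed (rule assms(9))
  note has_full_bound = this
  show ?thesis
  proof (intro conjI allI impI; elim conjE)
    fix hs assume hs: "\<forall>q\<in>set hs. Factorial_Ring.irreducible q \<and> lead_coeff q = 1"
      and "dp_norm \<iota> \<delta> g f = to_fract (prod_list hs)"
    then have "prod_list hs = Nm f" by (simp add: dp_norm_eq)
    then obtain fs where fs: "map Nm fs = hs" "f = dp_prod_list \<delta> fs"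
        "\<forall>q\<in>set fs. dp_irreducible \<delta> q \<and> lead_coeff q = 1"
      using decomposition_exists[OF has_full_bound] hs by blast
    then show "\<exists>fs. length fs = length hs \<and> f = dp_prod_list \<delta> fs \<and>
        (\<forall>i<length hs. dp_irreducible \<delta> (fs ! i) \<and> dp_norm \<iota> \<delta> g (fs ! i) = to_fract (hs ! i) \<and>
          degree (fs ! i) = degree (hs ! i))"
      by (intro exI[of _ fs]) (auto simp: dp_norm_eq degree_Nm)
  next
    fix hs assume hs: "\<forall>q\<in>set hs. Factorial_Ring.irreducible q \<and> lead_coeff q = 1"
      and dist: "distinct hs" and N: "dp_norm \<iota> \<delta> g f = to_fract (prod_list hs)"
    have "prod_list hs = Nm f" using N by (simp add: dp_norm_eq)
    then have bij: "bij_betw (map Nm) (monic_decompositions \<delta> f) (permutations_of_set (set hs))"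
      using bij_betw_decompositions[OF has_full_bound] hs dist by blast
    then show "card (monic_decompositions \<delta> f) = fact (length hs)"
      using bij_betw_same_card[OF bij] dist by (simp add: distinct_card)
    have eq: "{map to_fract ks | ks. set ks = set hs \<and> distinct ks} =
        map to_fract ` permutations_of_set (set hs)"
      by (auto simp: permutations_of_set_def)
    have "inj_on (map to_fract) (permutations_of_set (set hs))"
      by (rule inj_on_subset[OF inj_mapI]) (auto intro: injI)
    then have "bij_betw (map to_fract) (permutations_of_set (set hs))
        {map to_fract ks | ks. set ks = set hs \<and> distinct ks}"
      unfolding eq by (rule inj_on_imp_bij_betw)
    from bij_betw_trans[OF bij this]
    show "bij_betw (map (dp_norm \<iota> \<delta> g)) (monic_decompositions \<delta> f)
        {map to_fract ks | ks. set ks = set hs \<and> distinct ks}"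
      by (simp add: comp_def dp_norm_eq[abs_def])
  qed
qed

end
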